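(* Let $\alpha=\frac{1}{N(m-1)+1}$. Let $x_0\in\Omega$, $X>0$, $t_0>0$ and $T>0$ be such that $B\big(x_0,X^{-1}(\alpha^{-1}t_0T)^\alpha\big)\subset\Omega$. Set $$r(t)=\big(\alpha^{-1}(t_0+t)\big)^\alpha,\qquad B_t:=B\big(x_0,X^{-1}T^\alpha r(t)\big),$$ and let $\tau=\sup\{t>0:\ B_t\Subset\Omega\}$. Then the function $$u_s(t,x)=T^{\frac1{m-1}-\alpha N}X^{-\frac1{m-1}}(r(t))^{-N}\chi_{B_t}(x)$$ is, in $(0,\tau)\times\Omega$ and with initial datum $u_0=u_s(0,\cdot)$, an entropy solution both of the Dirichlet problem (D) with $g=0$ and of the homogeneous Neumann problem (N) for the equation $u_t=\operatorname{div}\big(u^m\frac{\nabla u}{|\nabla u|}\big)$.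
   Context: Standing assumptions and notation. $m>1$; $\Omega\subset\mathbb R^N$ is a bounded open set with Lipschitz boundary $\partial\Omega$ and outer unit normal $\nu^\Omega$; $\varphi(s)=s^m$ for $s\ge 0$. $B(x_0,\rho)$ is the ball of center $x_0$ and radius $\rho$; $\chi_A$ is the characteristic function of $A$. The subscript $+$ on a function space means that its elements are nonnegative. $Q_\tau=(0,\tau)\times\Omega$. $\mathcal M(\Omega)$ is the space of finite (signed) Radon measures on $\Omega$; $\mathcal H^{N-1}$ is the $(N-1)$-dimensional Hausdorff measure. (D) denotes: $u_t=\operatorname{div}(u^m\nabla u/|\nabla u|)$ in $Q_\tau$, $u(0)=u_0$ in $\Omega$, $u=g$ on $(0,\tau)\times\partial\Omega$. (N) denotes the same equation and initial condition, with $u^m\frac{Du}{|Du|}\cdot\nu^\Omega=0$ on $(0,\tau)\times\partial\Omega$. Test functions: $\mathcal L$ is the set of $\ell:[0,\infty)\to[0,\infty)$ that are Lipschitz with $\ell'\ge 0$, $\ell(0)=0$, $\operatorname{supp}(\ell')\subset(0,\infty)$ (in particular $\ell$ vanishes near $0$). For $\ell\in\mathcal L$: $J_\ell(s)=\int_0^s\ell(\sigma)\,d\sigma$, $\Phi_\ell(s)=\int_0^s\ell'(\sigma)\varphi(\sigma)\,d\sigma$, and $h(u,D\ell(u)):=|D\Phi_\ell(u)|$ (total variation measure of the distributional spatial gradient of $\Phi_\ell(u)$). $TBV_+(\Omega)$ is the set of nonnegative $u\in L^1(\Omega)$ with $\max\{u,a\}\in BV(\Omega)$ for all $a>0$; such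 $u$ has a trace on $\partial\Omega$, namely the limit as $a\to0^+$ of the $BV$-traces of $\max\{u,a\}$. For $\mathbf z\in L^\infty(\Omega;\mathbb R^N)$ with $\operatorname{div}\mathbf z\in\mathcal M(\Omega)$, $[\mathbf z,\nu^\Omega]\in L^\infty(\partial\Omega)$ denotes its weak normal trace (Anzellotti), characterized by $\int_\Omega v\,d(\operatorname{div}\mathbf z)+\int_\Omega\mathbf z\cdot\nabla v\,dx=\int_{\partial\Omega}[\mathbf z,\nu^\Omega]\,v\,d\mathcal H^{N-1}$ for all $v\in C^1(\overline\Omega)$. $L^\infty_{loc,w}((0,\tau];\mathcal M(\Omega))$ is the set of Radon measures $\mu$ on $Q_\tau$ such that for a.e. $t\in(0,\tau)$ there is $\mu(\cdot,t)\in\mathcal M(\Omega)$ such that: for all $\zeta\in C_c(Q_\tau)$ the map $t\mapsto\langle\mu(\cdot,t),\zeta(\cdot,t)\rangle_\Omega$ is in $L^1(0,\tau)$ and $\langle\mu,\zeta\rangle_{Q_\tau}=\int_0^\tau\langle\mu(\cdot,t),\zeta(\cdot,t)\rangle_\Omega\,dt$; and $t\mapsto\|\mu(t)\|_{\mathcal M(\Omega)}$ is in $L^\infty_{loc}((0,\tau])$. Entropy solution of (D). Let $u_0\in L^\infty_+(\Omega)$, $g\in L^\infty_+(\partial\Omega)$, $\tau<+\infty$. A nonnegative $u\in C([0,\tau);L^1(\Omega))\cap L^\infty((0,\tau)\times\Omega)$ is an entropy solution of (D) in $Q_\tau$ if: (i) $\ell(u)\in L^1((0,\tau);BV(\Omega))$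 for all $\ell\in\mathcal L$; (ii) $u_t\in L^\infty_{loc,w}((0,\tau];\mathcal M(\Omega))$; (iii) there exists $\mathbf w\in L^\infty((0,\tau)\times\Omega;\mathbb R^N)$ with $\|\mathbf w\|_\infty\le1$ such that $\mathbf z:=\varphi(u)\mathbf w$ satisfies $u_t(t)=\operatorname{div}\mathbf z(t)$ as distributions in $\Omega$ for a.e. $t\in(0,\tau)$; (iv) for every $\ell\in\mathcal L$ and every nonnegative $\psi\in C_c^\infty((0,\tau)\times\Omega)$, $$\int_0^\tau\!\!\int_\Omega\psi\,dh(u,D\ell(u))\,dt\le\int_0^\tau\!\!\int_\Omega J_\ell(u)\psi_t\,dx\,dt-\int_0^\tau\!\!\int_\Omega\ell(u)\,\mathbf z\cdot\nabla\psi\,dx\,dt;$$ (v) for a.e. $t\in(0,\tau)$, in the sense of traces, $u(t)\ge g$ $\mathcal H^{N-1}$-a.e. on $\partial\Omega$, and $[\mathbf z(t),\nu^\Omega]=-\varphi(u(t))$ for $\mathcal H^{N-1}$-a.e. point of $\partial\Omega$ where $u(t)>g$; (vi) $u(0)=u_0$ in $L^1(\Omega)$. Entropy solution of (N) in $Q_\tau$: same definition, except that (iv) is required for all nonnegative $\psi\in C_c^\infty((0,\tau)\times\overline\Omega)$ and (v) is replaced by: for a.e. $t\in(0,\tau)$, $[\mathbf z(t),\nu^\Omega]=0$ $\mathcal H^{N-1}$-a.e. on $\partial\Omega$. *)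

theory Defs
  imports "HOL-Analysis.Analysis"
begin

definition partial_deriv :: "'a::euclidean_space \<Rightarrow> ('a \<Rightarrow> real) \<Rightarrow> 'a \<Rightarrow> real" where
  "partial_deriv e f x = frechet_derivative f (at x) e"

definition grad :: "('a::euclidean_space \<Rightarrow> real) \<Rightarrow> 'a \<Rightarrow> 'a" where
  "grad f x = (\<Sum>e\<in>Basis. partial_deriv e f x *\<^sub>R e)"

text \<open>Class \<open>C\<^sup>\<infinity>\<close>: every iterated partial derivative is differentiable everywhere
  (hence continuous).\<close>

definition smooth :: "('a::euclidean_space \<Rightarrow> real) \<Rightarrow> bool" where
  "smooth f \<longleftrightarrow> (\<forall>es\<in>lists Basis. foldr partial_deriv es f differentiable_on UNIV)"

definition supp :: "('a::topological_space \<Rightarrow> real) \<Rightarrow> 'a set" where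
  "supp f = closure {x. f x \<noteq> 0}"

text \<open>Functions with compact support in an open set \<open>U\<close> are extended by zero to the whole space.\<close>

definition Cc :: "'a::euclidean_space set \<Rightarrow> ('a \<Rightarrow> real) set" where
  "Cc U = {f. continuous_on UNIV f \<and> compact (supp f) \<and> supp f \<subseteq> U}"

definition Cc_inf :: "'a::euclidean_space set \<Rightarrow> ('a \<Rightarrow> real) set" where
  "Cc_inf U = {f. smooth f \<and> compact (supp f) \<and> supp f \<subseteq> U}"

text \<open>\<open>C\<^sub>c\<^sup>\<infinity>((0,\<tau>) \<times> closure \<Omega>)\<close>: restrictions of smooth functions whose support relative to
  \<open>(0,\<tau>) \<times> closure \<Omega>\<close> is compact. They need not vanish on the lateral boundary.\<close>

definition Cc_inf_upto :: "real \<Rightarrow> 'a::euclidean_space set \<Rightarrow> (real \<times> 'a \<Rightarrow> real) set" where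
  "Cc_inf_upto \<tau> \<Omega> = {\<psi>. smooth \<psi> \<and>
     (\<exists>K. compact K \<and> K \<subseteq> {0<..<\<tau>} \<times> closure \<Omega> \<and>
          (\<forall>p\<in>({0<..<\<tau>} \<times> closure \<Omega>) - K. \<psi> p = 0))}"

text \<open>\<open>C\<^sup>1(closure \<Omega>)\<close>: \<open>v\<close> is continuous on the closure, \<open>C\<^sup>1\<close> in \<open>\<Omega>\<close>, and its gradient extends
  continuously to the closure.\<close>

definition C1_closure :: "'a::euclidean_space set \<Rightarrow> ('a \<Rightarrow> real) set" where
  "C1_closure \<Omega> = {v. continuous_on (closure \<Omega>) v \<and> v differentiable_on \<Omega> \<and>
     (\<exists>G. continuous_on (closure \<Omega>) G \<and> (\<forall>x\<in>\<Omega>. G x = grad v x))}"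

text \<open>Near each boundary point, \<open>\<Omega>\<close> is the region strictly below the graph, in some unit direction \<open>e\<close>,
  of a Lipschitz function of the component orthogonal to \<open>e\<close>.\<close>

definition lipschitz_boundary :: "'a::euclidean_space set \<Rightarrow> bool" where
  "lipschitz_boundary \<Omega> \<longleftrightarrow> (\<forall>p\<in>frontier \<Omega>. \<exists>r>0. \<exists>e \<gamma> C. norm e = 1 \<and>
     C-lipschitz_on {y. y \<bullet> e = 0} \<gamma> \<and>
     \<Omega> \<inter> ball p r = {x \<in> ball p r. x \<bullet> e < \<gamma> (x - (x \<bullet> e) *\<^sub>R e)})"

definition hausdorff_content :: "nat \<Rightarrow> real \<Rightarrow> 'a::euclidean_space set \<Rightarrow> ennreal" where
  "hausdorff_content s \<delta> A =
     (INF U \<in> {U :: nat \<Rightarrow> 'a set. A \<subseteq> (\<Union>n. U n) \<and> (\<forall>n. bounded (U n) \<and> diameter (U n) \<le> \<delta>)}.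
        \<Sum>n. if U n = {} then 0 else ennreal (unit_ball_vol (real s) * (diameter (U n) / 2) ^ s))"

text \<open>The outer measure \<open>SUP \<delta>\<close> below is a metric outer measure, hence a measure on the Borel sets.
  With this normalization the \<open>0\<close>-dimensional measure is the counting measure.\<close>

definition hausdorff_measure :: "nat \<Rightarrow> 'a::euclidean_space measure" where
  "hausdorff_measure s =
     measure_of UNIV (sets borel) (\<lambda>A. SUP \<delta>\<in>{0<..}. hausdorff_content s \<delta> A)"

definition surface :: "'a::euclidean_space set \<Rightarrow> 'a measure" where
  "surface \<Omega> = restrict_space (hausdorff_measure (DIM('a) - 1)) (frontier \<Omega>)"

definition Linf :: "'a measure \<Rightarrow> ('a \<Rightarrow> 'b::euclidean_space) \<Rightarrow> bool" where
  "Linf M f \<longleftrightarrow> f \<in> borel_measurable M \<and> (\<exists>C. AE x in M. norm (f x) \<le> C)"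

definition Linf_plus :: "'a measure \<Rightarrow> ('a \<Rightarrow> real) \<Rightarrow> bool" where
  "Linf_plus M f \<longleftrightarrow> Linf M f \<and> (AE x in M. 0 \<le> f x)"

text \<open>On an open subset of a Euclidean space the positive Radon measures are the Borel measures that
  are finite on compact sets. A signed Radon measure on an open set \<open>U\<close> is given as the difference of two positive Radon
  measures. The two parts need not be mutually singular: only the difference is ever used, through
  the values \<open>sm_val\<close> (for finite measures) and the integrals \<open>sm_int\<close>.\<close>

type_synonym 'a smeasure = "'a measure \<times> 'a measure"

definition pos_radon :: "'a::euclidean_space set \<Rightarrow> 'a measure \<Rightarrow> bool" where
  "pos_radon U P \<longleftrightarrow> sets P = sets (restrict_space borel U) \<and>
     (\<forall>K. compact K \<and> K \<subseteq> U \<longrightarrow> emeasure P K < \<infinity>)"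

definition signed_radon :: "'a::euclidean_space set \<Rightarrow> 'a smeasure \<Rightarrow> bool" where
  "signed_radon U \<mu> \<longleftrightarrow> pos_radon U (fst \<mu>) \<and> pos_radon U (snd \<mu>)"

definition finite_radon :: "'a::euclidean_space set \<Rightarrow> 'a smeasure \<Rightarrow> bool" where
  "finite_radon U \<mu> \<longleftrightarrow> signed_radon U \<mu> \<and> finite_measure (fst \<mu>) \<and> finite_measure (snd \<mu>)"

definition sm_val :: "'a smeasure \<Rightarrow> 'a set \<Rightarrow> real" where
  "sm_val \<mu> A = measure (fst \<mu>) A - measure (snd \<mu>) A"

definition sm_int :: "'a smeasure \<Rightarrow> ('a \<Rightarrow> real) \<Rightarrow> real" where
  "sm_int \<mu> f = (\<integral>x. f x \<partial>(fst \<mu>)) - (\<integral>x. f x \<partial>(snd \<mu>))"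

text \<open>Used only for countably additive set functions, scalar or vector valued.\<close>

definition tot_var :: "('a::euclidean_space set \<Rightarrow> 'b::real_normed_vector) \<Rightarrow> 'a set \<Rightarrow> ennreal" where
  "tot_var \<nu> A = (SUP \<P> \<in> {\<P>. finite \<P> \<and> disjoint \<P> \<and> \<P> \<subseteq> sets borel \<and> \<Union>\<P> \<subseteq> A}.
     \<Sum>B\<in>\<P>. ennreal (norm (\<nu> B)))"

definition tot_var_measure ::
  "'a::euclidean_space set \<Rightarrow> ('a set \<Rightarrow> 'b::real_normed_vector) \<Rightarrow> 'a measure" where
  "tot_var_measure U \<nu> = measure_of U (sets (restrict_space borel U)) (tot_var \<nu>)"

text \<open>\<open>D e\<close> is the component of the distributional gradient of \<open>v\<close> in the direction \<open>e \<in> Basis\<close>.\<close>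

definition distr_gradient ::
  "'a::euclidean_space set \<Rightarrow> ('a \<Rightarrow> real) \<Rightarrow> ('a \<Rightarrow> 'a smeasure) \<Rightarrow> bool" where
  "distr_gradient \<Omega> v D \<longleftrightarrow> (\<forall>e\<in>Basis. finite_radon \<Omega> (D e) \<and>
     (\<forall>\<phi>\<in>Cc_inf \<Omega>. (\<integral>x. v x * partial_deriv e \<phi> x \<partial>(lebesgue_on \<Omega>)) = - sm_int (D e) \<phi>))"

definition BV :: "'a::euclidean_space set \<Rightarrow> ('a \<Rightarrow> real) set" where
  "BV \<Omega> = {v. integrable (lebesgue_on \<Omega>) v \<and> (\<exists>D. distr_gradient \<Omega> v D)}"

text \<open>\<open>\<eta> = |Dv|\<close> for \<open>v \<in> BV(\<Omega>)\<close>. As a vector valued set function \<open>Dv\<close> is determined by \<open>v\<close>, so there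
  is exactly one such \<open>\<eta>\<close>.\<close>

definition is_abs_gradient :: "'a::euclidean_space set \<Rightarrow> ('a \<Rightarrow> real) \<Rightarrow> 'a measure \<Rightarrow> bool" where
  "is_abs_gradient \<Omega> v \<eta> \<longleftrightarrow> v \<in> BV \<Omega> \<and>
     (\<exists>D. distr_gradient \<Omega> v D \<and>
          \<eta> = tot_var_measure \<Omega> (\<lambda>A. \<Sum>e\<in>Basis. sm_val (D e) A *\<^sub>R e))"

text \<open>The boundary trace \<open>\<theta> x\<close> is the one-sided approximate limit of \<open>v\<close> at the boundary point \<open>x\<close>;
  on Lipschitz domains it exists at almost every boundary point.\<close>

definition BV_trace :: "'a::euclidean_space set \<Rightarrow> ('a \<Rightarrow> real) \<Rightarrow> ('a \<Rightarrow> real) \<Rightarrow> bool" where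
  "BV_trace \<Omega> v \<theta> \<longleftrightarrow> v \<in> BV \<Omega> \<and>
     (AE x in surface \<Omega>.
        ((\<lambda>\<rho>. (\<integral>y. \<bar>v y - \<theta> x\<bar> \<partial>(lebesgue_on (\<Omega> \<inter> ball x \<rho>))) / \<rho> ^ DIM('a))
           \<longlongrightarrow> 0) (at_right 0))"

definition TBV_plus :: "'a::euclidean_space set \<Rightarrow> ('a \<Rightarrow> real) set" where
  "TBV_plus \<Omega> = {u. integrable (lebesgue_on \<Omega>) u \<and> (AE x in lebesgue_on \<Omega>. 0 \<le> u x) \<and>
     (\<forall>a>0. (\<lambda>x. max (u x) a) \<in> BV \<Omega>)}"

definition TBV_trace :: "'a::euclidean_space set \<Rightarrow> ('a \<Rightarrow> real) \<Rightarrow> ('a \<Rightarrow> real) \<Rightarrow> bool" where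
  "TBV_trace \<Omega> u \<theta> \<longleftrightarrow> u \<in> TBV_plus \<Omega> \<and>
     (\<exists>\<Theta>. (\<forall>a>0. BV_trace \<Omega> (\<lambda>x. max (u x) a) (\<Theta> a)) \<and>
          (AE x in surface \<Omega>. ((\<lambda>a. \<Theta> a x) \<longlongrightarrow> \<theta> x) (at_right 0)))"

definition has_divergence :: "'a::euclidean_space set \<Rightarrow> ('a \<Rightarrow> 'a) \<Rightarrow> 'a smeasure \<Rightarrow> bool" where
  "has_divergence \<Omega> z \<mu> \<longleftrightarrow> finite_radon \<Omega> \<mu> \<and>
     (\<forall>\<phi>\<in>Cc_inf \<Omega>. sm_int \<mu> \<phi> = - (\<integral>x. z x \<bullet> grad \<phi> x \<partial>(lebesgue_on \<Omega>)))"

text \<open>\<open>\<kappa> = [z, \<nu>\<^sup>\<Omega>]\<close>, the weak (Anzellotti) normal trace.\<close>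

definition normal_trace :: "'a::euclidean_space set \<Rightarrow> ('a \<Rightarrow> 'a) \<Rightarrow> ('a \<Rightarrow> real) \<Rightarrow> bool" where
  "normal_trace \<Omega> z \<kappa> \<longleftrightarrow> Linf (lebesgue_on \<Omega>) z \<and> Linf (surface \<Omega>) \<kappa> \<and>
     (\<exists>\<mu>. has_divergence \<Omega> z \<mu> \<and>
       (\<forall>v\<in>C1_closure \<Omega>.
          sm_int \<mu> v + (\<integral>x. z x \<bullet> grad v x \<partial>(lebesgue_on \<Omega>)) = (\<integral>x. \<kappa> x * v x \<partial>(surface \<Omega>))))"

text \<open>Used for \<open>s \<ge> 0\<close>; note that \<open>0 powr m = 0\<close>.\<close>

definition phi :: "real \<Rightarrow> real \<Rightarrow> real" where
  "phi m s = s powr m"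

text \<open>The class of truncations; only values on \<open>[0,\<infinity>)\<close> are relevant. The last clause says that
  \<open>0\<close> is not in the support of \<open>l'\<close>, which is defined almost everywhere.\<close>

definition Lfun :: "(real \<Rightarrow> real) set" where
  "Lfun = {l. (\<forall>s\<ge>0. 0 \<le> l s) \<and> (\<exists>C. C-lipschitz_on {0..} l) \<and>
     (AE s in lebesgue_on {0<..}. 0 \<le> deriv l s) \<and> l 0 = 0 \<and>
     (\<exists>\<delta>>0. AE s in lebesgue_on {0<..<\<delta>}. deriv l s = 0)}"

definition J_fun :: "(real \<Rightarrow> real) \<Rightarrow> real \<Rightarrow> real" where
  "J_fun l s = (\<integral>\<sigma>. l \<sigma> \<partial>(lebesgue_on {0..s}))"

definition Phi_fun :: "real \<Rightarrow> (real \<Rightarrow> real) \<Rightarrow> real \<Rightarrow> real" where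
  "Phi_fun m l s = (\<integral>\<sigma>. deriv l \<sigma> * phi m \<sigma> \<partial>(lebesgue_on {0..s}))"

definition in_C_L1 :: "real \<Rightarrow> 'a::euclidean_space set \<Rightarrow> (real \<Rightarrow> 'a \<Rightarrow> real) \<Rightarrow> bool" where
  "in_C_L1 \<tau> \<Omega> u \<longleftrightarrow> (\<forall>t\<in>{0..<\<tau>}. integrable (lebesgue_on \<Omega>) (u t) \<and>
     ((\<lambda>s. \<integral>x. \<bar>u s x - u t x\<bar> \<partial>(lebesgue_on \<Omega>)) \<longlongrightarrow> 0) (at t within {0..<\<tau>}))"

text \<open>\<open>v \<in> L\<^sup>1((0,\<tau>); BV(\<Omega>))\<close> in the weak sense usual for the nonseparable space \<open>BV\<close>: \<open>v\<close> is
  measurable on \<open>Q\<^sub>\<tau>\<close> and the \<open>BV\<close> norm of \<open>v(t)\<close> is integrable.\<close>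

definition in_L1_BV :: "real \<Rightarrow> 'a::euclidean_space set \<Rightarrow> (real \<Rightarrow> 'a \<Rightarrow> real) \<Rightarrow> bool" where
  "in_L1_BV \<tau> \<Omega> v \<longleftrightarrow>
     case_prod v \<in> borel_measurable (lebesgue_on ({0<..<\<tau>} \<times> \<Omega>)) \<and>
     (\<exists>\<eta>. (AE t in lebesgue_on {0<..<\<tau>}. is_abs_gradient \<Omega> (v t) (\<eta> t)) \<and>
          integrable (lebesgue_on {0<..<\<tau>})
            (\<lambda>t. (\<integral>x. \<bar>v t x\<bar> \<partial>(lebesgue_on \<Omega>)) + measure (\<eta> t) \<Omega>))"

text \<open>\<open>\<mu> \<in> L\<^sup>\<infinity>\<^bsub>loc,w\<^esub>((0,\<tau>]; M(\<Omega>))\<close> with time slices \<open>\<mu>t t\<close>.\<close>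

definition in_Linf_loc_w ::
  "real \<Rightarrow> 'a::euclidean_space set \<Rightarrow> (real \<times> 'a) smeasure \<Rightarrow> (real \<Rightarrow> 'a smeasure) \<Rightarrow> bool" where
  "in_Linf_loc_w \<tau> \<Omega> \<mu> \<mu>t \<longleftrightarrow>
     signed_radon ({0<..<\<tau>} \<times> \<Omega>) \<mu> \<and>
     (AE t in lebesgue_on {0<..<\<tau>}. finite_radon \<Omega> (\<mu>t t)) \<and>
     (\<forall>\<zeta>\<in>Cc ({0<..<\<tau>} \<times> \<Omega>).
        integrable (lebesgue_on {0<..<\<tau>}) (\<lambda>t. sm_int (\<mu>t t) (\<lambda>x. \<zeta> (t, x))) \<and>
        sm_int \<mu> \<zeta> = (\<integral>t. sm_int (\<mu>t t) (\<lambda>x. \<zeta> (t, x)) \<partial>(lebesgue_on {0<..<\<tau>}))) \<and>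
     (\<lambda>t. tot_var (sm_val (\<mu>t t)) \<Omega>) \<in> borel_measurable (lebesgue_on {0<..<\<tau>}) \<and>
     (\<forall>a>0. \<exists>C::real. AE t in lebesgue_on {0<..<\<tau>}.
        a \<le> t \<longrightarrow> tot_var (sm_val (\<mu>t t)) \<Omega> \<le> ennreal C)"

definition is_time_derivative ::
  "real \<Rightarrow> 'a::euclidean_space set \<Rightarrow> (real \<Rightarrow> 'a \<Rightarrow> real) \<Rightarrow> (real \<times> 'a) smeasure \<Rightarrow> bool" where
  "is_time_derivative \<tau> \<Omega> u \<mu> \<longleftrightarrow> (\<forall>\<psi>\<in>Cc_inf ({0<..<\<tau>} \<times> \<Omega>).
     sm_int \<mu> \<psi> =
       - (\<integral>p. u (fst p) (snd p) * partial_deriv (1, 0) \<psi> p \<partial>(lebesgue_on ({0<..<\<tau>} \<times> \<Omega>))))"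

definition flux :: "real \<Rightarrow> (real \<Rightarrow> 'a \<Rightarrow> real) \<Rightarrow> (real \<Rightarrow> 'a \<Rightarrow> 'a::euclidean_space) \<Rightarrow> real \<Rightarrow> 'a \<Rightarrow> 'a" where
  "flux m u w t x = phi m (u t x) *\<^sub>R w t x"

text \<open>The entropy inequality for all nonnegative test functions in the class \<open>\<T>\<close>; \<open>\<eta> t\<close> is
  the measure \<open>h(u(t), Dl(u(t)))\<close>.\<close>

definition entropy_ineq :: "real \<Rightarrow> 'a::euclidean_space set \<Rightarrow> real \<Rightarrow> (real \<times> 'a \<Rightarrow> real) set \<Rightarrow>
    (real \<Rightarrow> 'a \<Rightarrow> real) \<Rightarrow> (real \<Rightarrow> 'a \<Rightarrow> 'a) \<Rightarrow> bool" where
  "entropy_ineq m \<Omega> \<tau> \<T> u z \<longleftrightarrow> (\<forall>l\<in>Lfun. \<exists>\<eta>.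
     (AE t in lebesgue_on {0<..<\<tau>}. is_abs_gradient \<Omega> (\<lambda>x. Phi_fun m l (u t x)) (\<eta> t)) \<and>
     (\<forall>\<psi>\<in>\<T>. (\<forall>t\<in>{0<..<\<tau>}. \<forall>x\<in>\<Omega>. 0 \<le> \<psi> (t, x)) \<longrightarrow>
        integrable (lebesgue_on {0<..<\<tau>}) (\<lambda>t. \<integral>x. \<psi> (t, x) \<partial>(\<eta> t)) \<and>
        (\<integral>t. (\<integral>x. \<psi> (t, x) \<partial>(\<eta> t)) \<partial>(lebesgue_on {0<..<\<tau>}))
          \<le> (\<integral>t. (\<integral>x. J_fun l (u t x) * partial_deriv (1, 0) \<psi> (t, x)
                \<partial>(lebesgue_on \<Omega>)) \<partial>(lebesgue_on {0<..<\<tau>}))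
           - (\<integral>t. (\<integral>x. l (u t x) * (z t x \<bullet> grad (\<lambda>y. \<psi> (t, y)) x)
                \<partial>(lebesgue_on \<Omega>)) \<partial>(lebesgue_on {0<..<\<tau>}))))"

text \<open>The requirements shared by both problems, for a given vector field \<open>w\<close>; the class of test
  functions in the entropy inequality is a parameter.\<close>

definition entropy_sol_common :: "real \<Rightarrow> 'a::euclidean_space set \<Rightarrow> real \<Rightarrow>
    (real \<times> 'a \<Rightarrow> real) set \<Rightarrow> ('a \<Rightarrow> real) \<Rightarrow> (real \<Rightarrow> 'a \<Rightarrow> real) \<Rightarrow> (real \<Rightarrow> 'a \<Rightarrow> 'a) \<Rightarrow> bool" where
  "entropy_sol_common m \<Omega> \<tau> \<T> u0 u w \<longleftrightarrow>
     Linf_plus (lebesgue_on \<Omega>) u0 \<and>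
     in_C_L1 \<tau> \<Omega> u \<and>
     Linf (lebesgue_on ({0<..<\<tau>} \<times> \<Omega>)) (case_prod u) \<and>
     (\<forall>t\<in>{0..<\<tau>}. AE x in lebesgue_on \<Omega>. 0 \<le> u t x) \<and>
     (\<forall>l\<in>Lfun. in_L1_BV \<tau> \<Omega> (\<lambda>t x. l (u t x))) \<and>
     case_prod w \<in> borel_measurable (lebesgue_on ({0<..<\<tau>} \<times> \<Omega>)) \<and>
     (AE p in lebesgue_on ({0<..<\<tau>} \<times> \<Omega>). norm (w (fst p) (snd p)) \<le> 1) \<and>
     (\<exists>\<mu> \<mu>t. is_time_derivative \<tau> \<Omega> u \<mu> \<and> in_Linf_loc_w \<tau> \<Omega> \<mu> \<mu>t \<and>
        (AE t in lebesgue_on {0<..<\<tau>}. has_divergence \<Omega> (flux m u w t) (\<mu>t t))) \<and>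
     entropy_ineq m \<Omega> \<tau> \<T> u (flux m u w) \<and>
     (AE x in lebesgue_on \<Omega>. u 0 x = u0 x)"

definition entropy_solution_D :: "real \<Rightarrow> 'a::euclidean_space set \<Rightarrow> real \<Rightarrow>
    ('a \<Rightarrow> real) \<Rightarrow> ('a \<Rightarrow> real) \<Rightarrow> (real \<Rightarrow> 'a \<Rightarrow> real) \<Rightarrow> bool" where
  "entropy_solution_D m \<Omega> \<tau> u0 g u \<longleftrightarrow> Linf_plus (surface \<Omega>) g \<and>
     (\<exists>w. entropy_sol_common m \<Omega> \<tau> (Cc_inf ({0<..<\<tau>} \<times> \<Omega>)) u0 u w \<and>
       (AE t in lebesgue_on {0<..<\<tau>}. \<exists>\<theta> \<kappa>.
          TBV_trace \<Omega> (u t) \<theta> \<and> normal_trace \<Omega> (flux m u w t) \<kappa> \<and>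
          (AE x in surface \<Omega>. g x \<le> \<theta> x) \<and>
          (AE x in surface \<Omega>. g x < \<theta> x \<longrightarrow> \<kappa> x = - phi m (\<theta> x))))"

definition entropy_solution_N :: "real \<Rightarrow> 'a::euclidean_space set \<Rightarrow> real \<Rightarrow>
    ('a \<Rightarrow> real) \<Rightarrow> (real \<Rightarrow> 'a \<Rightarrow> real) \<Rightarrow> bool" where
  "entropy_solution_N m \<Omega> \<tau> u0 u \<longleftrightarrow>
     (\<exists>w. entropy_sol_common m \<Omega> \<tau> (Cc_inf_upto \<tau> \<Omega>) u0 u w \<and>
       (AE t in lebesgue_on {0<..<\<tau>}. \<exists>\<kappa>.
          normal_trace \<Omega> (flux m u w t) \<kappa> \<and> (AE x in surface \<Omega>. \<kappa> x = 0)))"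

end

theory Submission
  imports Defs
begin

text \<open>Inside the ball \<open>B\<^sub>t\<close> take \<open>w = - (x - x\<^sub>0) / R(t)\<close>. Then \<open>div z\<close> has density \<open>- N u\<^sup>m / R\<close> in
    \<open>B\<^sub>t\<close> and
  a jump part \<open>u\<^sup>m\<close> times surface measure on the sphere. Since \<open>u R\<^sup>N\<close> is constant
      and \<open>R' = u\<^sup>m\<^sup>-\<^sup>1\<close>, this is
  \<open>u\<^sub>t\<close> (Rankine--Hugoniot). In the entropy inequality everything cancels except a surface term, and
  the inequality becomes \<open>\<Phi>\<^sub>l(u) \<le> u\<^sup>m\<^sup>-\<^sup>1 (u l(u) - J\<^sub>l(u))\<close>, which follows
    by integrating \<open>l'(s) s\<^sup>m \<le> u\<^sup>m\<^sup>-\<^sup>1 l'(s) s\<close>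
  over \<open>[0, u]\<close>; this needs that Lipschitz functions are differentiable almost everywhere.
  The closed ball stays inside \<open>\<Omega>\<close>, so both boundary conditions hold trivially.

  Surface measure on a sphere is the image of Lebesgue measure on the unit ball under \<open>sgn y = y / |y|\<close>,
  up to the factor \<open>N R\<^sup>N\<^sup>-\<^sup>1\<close>; the Hausdorff measure itself plays no role.\<close>

section \<open>Lipschitz functions of one variable\<close>

text \<open>The exponent comes from the two laws that govern the ball. Conservation of mass makes
  the height \<open>M / R^N\<close>, and the speed law then reads
  \<open>R' = (M / R^N)^(m-1)\<close>; hence \<open>R^(N(m-1)+1)\<close> is affine in time, which
  gives \<open>\<alpha>\<close>. The field \<open>w\<close> has two duties: to be the inner unit
  normal on the sphere, where it stands for \<open>Du/|Du|\<close>, and to have constant divergence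
  inside, where \<open>u\<close> decreases uniformly although \<open>Du = 0\<close>. The linear
  field does both. The definitions speak of distributions, of variations over Borel partitions and
  of a \<open>deriv\<close> that says nothing where \<open>l\<close> is not differentiable, so all
  measures have to be exhibited and their variations computed. Pulling back to the unit ball makes
  the domain fixed and every measure an image of Lebesgue measure. Differentiation under the
  integral is avoided: the order of integration is exchanged and the fundamental theorem is used
  along the curves \<open>t \<mapsto> x0 + R(t) y\<close>. The entropy inequality is proved for test
  functions that need not vanish on the lateral boundary, which covers both problems.\<close>

lemma Vitali_open_intervals:
  fixes E :: "real set"
  assumes "open U" "E \<subseteq> U"
    and P: "\<And>x d. x \<in> E \<Longrightarrow> 0 < d \<Longrightarrow> \<exists>u v. u < x \<and> x < v \<and> v - u < d \<and> P u v"
  shows "\<exists>C. countable C \<and> (\<forall>u v. (u, v) \<in> C \<longrightarrow> u < v \<and> P u v \<and> {u<..<v} \<subseteq> U) \<and>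
    disjoint_family_on (\<lambda>(u, v). {u<..<v}) C \<and> negligible (E - (\<Union>(u, v)\<in>C. {u<..<v}))"
proof -
  define K where "K = {(u, v). u < v \<and> P u v \<and> {u<..<v} \<subseteq> U}"
  \<comment> \<open>The covering theorem speaks of balls: an open interval is the ball around its
    midpoint with half its length as radius.\<close>
  let ?a = "\<lambda>(u, v). (u + v) / 2 :: real" and ?r = "\<lambda>(u, v). (v - u) / 2 :: real"
  have ball: "ball (?a i) (?r i) = (case i of (u, v) \<Rightarrow> {u<..<v})" for i
    by (cases i) (auto simp: ball_eq_greaterThanLessThan field_simps)
  show ?thesis
  proof (rule Vitali_covering_theorem_balls[of E K ?a ?r])
    fix x d assume x: "x \<in> E" and d: "0 < (d :: real)"
    obtain e where e: "0 < e" "ball x e \<subseteq> U"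
      using assms x by (meson openE subset_iff)
    \<comment> \<open>Shorter than \<open>e\<close>, an interval around \<open>x\<close> stays in
      \<open>U\<close>; shorter than \<open>d\<close>, it makes the cover fine.\<close>
    obtain u v where uv: "u < x" "x < v" "v - u < min d e" "P u v"
      using P[OF x, of "min d e"] d e by auto
    have "{u<..<v} \<subseteq> ball x e"
      using uv by (auto simp: dist_real_def)
    then have "(u, v) \<in> K" using uv e by (auto simp: K_def)
    moreover have "x \<in> ball ((u + v) / 2) ((v - u) / 2)"
      using ball[of "(u, v)"] uv by (simp del: mem_ball)
    ultimately show "\<exists>i. i \<in> K \<and> x \<in> ball (?a i) (?r i) \<and> ?r i < d"
      using uv by (intro exI[of _ "(u, v)"]) auto
  next
    fix C assume C: "countable C" "C \<subseteq> K"
      "pairwise (\<lambda>i j. disjnt (ball (?a i) (?r i)) (ball (?a j) (?r j))) C"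
      "negligible (E - (\<Union>i \<in> C. ball (?a i) (?r i)))"
    show ?thesis
    proof (intro exI conjI)
      show "disjoint_family_on (\<lambda>(u, v). {u<..<v}) C"
        using C(3) unfolding ball disjoint_family_on_def pairwise_def disjnt_def by blast
      show "negligible (E - (\<Union>(u, v)\<in>C. {u<..<v}))" using C(4) unfolding ball .
    qed (use C in \<open>auto simp: K_def\<close>)
  qed
qed

text \<open>Chords are taken over intervals with \<open>x\<close> in the interior rather than at an
  end. Such intervals form a Vitali cover directly, and their union at a given scale is open, so
  measurability of upper and lower derivates is never an issue.\<close>

definition fine_slopes :: "(real \<Rightarrow> real) \<Rightarrow> (real \<Rightarrow> bool) \<Rightarrow> real set" where
  "fine_slopes L S =
     {x. \<forall>d>0. \<exists>u v. u < x \<and> x < v \<and> v - u < d \<and> S ((L v - L u) / (v - u))}"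

text \<open>The set is a G-delta: at each scale \<open>inverse (Suc n)\<close> the admissible open
  intervals have an open union.\<close>

lemma fine_slopes_borel: "fine_slopes L S \<in> sets borel"
proof -
  define W where "W n = \<Union>{{u<..<v} |u v. u < v \<and> v - u < inverse (Suc n) \<and> S ((L v - L u) / (v - u))}"
      for n
  have "fine_slopes L S = (\<Inter>n. W n)"
  proof (intro equalityI subsetI)
    fix x assume x: "x \<in> fine_slopes L S"
    then show "x \<in> (\<Inter>n. W n)"
    proof -
      have "x \<in> W n" for n
      proof -
        obtain u v where "u < x" "x < v" "v - u < inverse (Suc n)" "S ((L v - L u) / (v - u))"
          using x unfolding fine_slopes_def by (auto dest!: spec[of _ "inverse (Suc n)"])
        then have "x \<in> {u<..<v}" "{u<..<v} \<in> {{u<..<v} |u v. u < v \<and> v - u < inverse (Suc n) \<and>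
            S ((L v - L u) / (v - u))}"
          by force+
        then show ?thesis unfolding W_def by blast
      qed
      then show ?thesis by blast
    qed
  next
    fix x assume x: "x \<in> (\<Inter>n. W n)"
    show "x \<in> fine_slopes L S"
      unfolding fine_slopes_def
    proof (clarify)
      fix d :: real assume "0 < d"
      then obtain n where n: "inverse (Suc n) < d" using reals_Archimedean by blast
      have "x \<in> W n" using x by auto
      then show "\<exists>u v. u < x \<and> x < v \<and> v - u < d \<and> S ((L v - L u) / (v - u))"
        using n unfolding W_def by fastforce
    qed
  qed
  moreover have "open (W n)" for n unfolding W_def by (auto intro!: open_Union)
  ultimately show ?thesis by (auto intro!: sets.countable_INT' borel_open)
qed

lemma emeasure_interval_measure_Ioo:
  assumes "a \<le> b" "mono F" "continuous_on UNIV F"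
  shows "emeasure (interval_measure F) {a<..<b} = ennreal (F b - F a)"
proof -
  have F: "\<And>x y. x \<le> y \<Longrightarrow> F x \<le> F y" using assms(2) by (auto dest: monoD)
  have null: "emeasure (interval_measure F) {b} = 0"
    using emeasure_interval_measure_Icc[of b b F] F assms by auto
  have "emeasure (interval_measure F) {a<..b} = ennreal (F b - F a)"
    using assms F by (intro emeasure_interval_measure_Ioc)
      (auto simp: continuous_on_eq_continuous_within continuous_at_imp_continuous_at_within)
  moreover have "emeasure (interval_measure F) ({a<..b} - {b}) = emeasure (interval_measure F) {a<..b}"
    using null by (intro emeasure_Diff_null_set) auto
  moreover have "{a<..b} - {b} = {a<..<b}" by auto
  ultimately show ?thesis by simp
qed

lemma emeasure_disjoint_intervals:
  fixes C :: "(real \<times> real) set"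
  assumes "countable C" "disjoint_family_on (\<lambda>(u, v). {u<..<v}) C" "sets M = sets borel"
  shows "emeasure M (\<Union>(u, v)\<in>C. {u<..<v}) =
      (\<integral>\<^sup>+i. emeasure M (case i of (u, v) \<Rightarrow> {u<..<v}) \<partial>count_space C)"
  using assms by (intro emeasure_UN_countable) (auto split: prod.split)

text \<open>Comparing the Stieltjes measure of \<open>L\<close> with Lebesgue measure on two nested Vitali covers gives
  \<open>q |E| \<le> p |E|\<close> for the set \<open>E\<close> of points admitting both small and large slopes.\<close>

lemma fine_slopes_null:
  assumes "mono L" "continuous_on UNIV L" "0 < p" "p < q"
  shows "negligible (fine_slopes L (\<lambda>s. s < p) \<inter> fine_slopes L (\<lambda>s. q < s))"
proof -
  let ?E0 = "fine_slopes L (\<lambda>s. s < p) \<inter> fine_slopes L (\<lambda>s. q < s)"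
  \<comment> \<open>Cutting to bounded pieces makes the measure finite, so that it can be cancelled
    at the end.\<close>
  have "negligible (?E0 \<inter> {-real n..real n})" for n
  proof -
    define E where "E = ?E0 \<inter> {-real n..real n}"
    have Eb[measurable]: "E \<in> sets borel" unfolding E_def by (intro sets.Int fine_slopes_borel) auto
    have Efin: "emeasure lborel E < \<infinity>"
      by (rule le_less_trans[OF emeasure_mono[of _ "{-real n..real n}"]]) (auto simp: E_def)
    define \<mu> where "\<mu> = interval_measure L"
    have sets_mu[measurable_cong, simp]: "sets \<mu> = sets borel" by (simp add: \<mu>_def)
    have muI: "emeasure \<mu> {u<..<v} = ennreal (L v - L u)" if "u \<le> v" for u v
      unfolding \<mu>_def using that assms by (intro emeasure_interval_measure_Ioo)
    have key: "ennreal q * emeasure lborel E \<le> ennreal p * (emeasure lborel E + ennreal e)"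
        if e: "0 < e" for e
    proof -
      \<comment> \<open>The cover by flat chords is kept inside an open \<open>U\<close> that
        exceeds \<open>E\<close> by less than \<open>e\<close>; this bounds its total length by
        \<open>|E| + e\<close>.\<close>
      obtain U where U: "open U" "E \<subseteq> U" "emeasure lborel (U - E) < e"
        using outer_regular_lborel[OF Eb e] by blast
      have [measurable]: "U \<in> sets borel" using U by auto
      have mU: "emeasure lborel U \<le> emeasure lborel E + ennreal e"
      proof -
        have "emeasure lborel U = emeasure lborel (E \<union> (U - E))" using U by (simp add: Un_absorb1)
        also have "\<dots> \<le> emeasure lborel E + emeasure lborel (U - E)"
          by (intro emeasure_subadditive) auto
        also have "\<dots> \<le> emeasure lborel E + ennreal e" using U by (intro add_left_mono) auto
        finally show ?thesis .
      qed
      have lowE: "\<exists>u v. u < x \<and> x < v \<and> v - u < d \<and> (L v - L u) / (v - u) < p" if "x \<in> E" "0 < d" for x d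
        using that by (auto simp: E_def fine_slopes_def)
      obtain C where "countable C \<and>
        (\<forall>u v. (u, v) \<in> C \<longrightarrow> u < v \<and> (L v - L u) / (v - u) < p \<and> {u<..<v} \<subseteq> U) \<and>
        disjoint_family_on (\<lambda>(u, v). {u<..<v}) C \<and> negligible (E - (\<Union>(u, v)\<in>C. {u<..<v}))"
        using Vitali_open_intervals[where P="\<lambda>u v. (L v - L u) / (v - u) < p", OF U(1,2) lowE] ..
      then have C: "countable C"
        "\<And>u v. (u, v) \<in> C \<Longrightarrow> u < v \<and> (L v - L u) / (v - u) < p \<and> {u<..<v} \<subseteq> U"
        "disjoint_family_on (\<lambda>(u, v). {u<..<v}) C" "negligible (E - (\<Union>(u, v)\<in>C. {u<..<v}))"
        by auto
      define V where "V = (\<Union>(u, v)\<in>C. {u<..<v})"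
      have "open V" unfolding V_def by auto
      \<comment> \<open>The steep chords are sought inside \<open>V\<close>, not only inside
        \<open>U\<close>: the nesting of \<open>W\<close> in \<open>V\<close> allows the chain
        \<open>q |W| \<le> \<mu> W \<le> \<mu> V \<le> p |V|\<close>.\<close>
      have highE: "\<exists>u v. u < x \<and> x < v \<and> v - u < d \<and> q < (L v - L u) / (v - u)" if "x \<in> E \<inter> V" "0 < d"
          for x d
        using that by (auto simp: E_def fine_slopes_def)
      obtain D where "countable D \<and>
        (\<forall>u v. (u, v) \<in> D \<longrightarrow> u < v \<and> q < (L v - L u) / (v - u) \<and> {u<..<v} \<subseteq> V) \<and>
        disjoint_family_on (\<lambda>(u, v). {u<..<v}) D \<and> negligible (E \<inter> V - (\<Union>(u, v)\<in>D. {u<..<v}))"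
        using Vitali_open_intervals[where P="\<lambda>u v. q < (L v - L u) / (v - u)", OF \<open>open V\<close> Int_lower2
            highE] ..
      then have D: "countable D"
        "\<And>u v. (u, v) \<in> D \<Longrightarrow> u < v \<and> q < (L v - L u) / (v - u) \<and> {u<..<v} \<subseteq> V"
        "disjoint_family_on (\<lambda>(u, v). {u<..<v}) D" "negligible (E \<inter> V - (\<Union>(u, v)\<in>D. {u<..<v}))"
        by auto
      define W where "W = (\<Union>(u, v)\<in>D. {u<..<v})"
      have "open W" unfolding W_def by auto
      have "W \<subseteq> V" using D(2) unfolding W_def by auto
      have "V \<subseteq> U" using C(2) unfolding V_def by fastforce
      note [measurable] = borel_open[OF \<open>open V\<close>] borel_open[OF \<open>open W\<close>]
      \<comment> \<open>What escapes \<open>W\<close> has escaped either the first cover or, being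
        in \<open>V\<close>, the second one.\<close>
      have "negligible (E - W)"
        by (rule negligible_subset[OF negligible_Un[OF C(4) D(4)]]) (auto simp: V_def W_def)
      then have "emeasure lborel (E - W) = 0"
        by (intro null_setsD1) (simp add: null_sets_completion_iff negligible_iff_null_sets)
      then have EW: "emeasure lborel E \<le> emeasure lborel W"
      proof -
        have "emeasure lborel E \<le> emeasure lborel ((E - W) \<union> W)" by (intro emeasure_mono) auto
        also have "\<dots> \<le> emeasure lborel (E - W) + emeasure lborel W" by (intro emeasure_subadditive) auto
        finally show ?thesis using \<open>emeasure lborel (E - W) = 0\<close> by simp
      qed
      have "ennreal q * emeasure lborel W =
          (\<integral>\<^sup>+i. ennreal q * emeasure lborel (case i of (u, v) \<Rightarrow> {u<..<v}) \<partial>count_space D)"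
        unfolding W_def by (subst emeasure_disjoint_intervals[OF D(1,3)]) (auto simp: nn_integral_cmult)
      also have "\<dots> \<le> (\<integral>\<^sup>+i. emeasure \<mu> (case i of (u, v) \<Rightarrow> {u<..<v}) \<partial>count_space D)"
      proof (intro nn_integral_mono, clarsimp)
        fix u v assume uv: "(u, v) \<in> D"
        then have "u < v" "q < (L v - L u) / (v - u)" using D(2)[OF uv] by auto
        then have "q * (v - u) \<le> L v - L u" by (simp add: pos_less_divide_eq)
        then have "ennreal (q * (v - u)) \<le> ennreal (L v - L u)" by (rule ennreal_leI)
        then show "ennreal q * emeasure lborel {u<..<v} \<le> emeasure \<mu> {u<..<v}"
          using D(2)[OF uv] assms by (auto simp: muI ennreal_mult)
      qed
      also have "\<dots> = emeasure \<mu> W"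
        unfolding W_def by (subst emeasure_disjoint_intervals[OF D(1,3)]) auto
      also have "\<dots> \<le> emeasure \<mu> V" using \<open>W \<subseteq> V\<close> by (intro emeasure_mono) auto
      also have "\<dots> = (\<integral>\<^sup>+i. emeasure \<mu> (case i of (u, v) \<Rightarrow> {u<..<v}) \<partial>count_space C)"
        unfolding V_def by (subst emeasure_disjoint_intervals[OF C(1,3)]) auto
      also have "\<dots> \<le> (\<integral>\<^sup>+i. ennreal p * emeasure lborel (case i of (u, v) \<Rightarrow> {u<..<v}) \<partial>count_space C)"
      proof (intro nn_integral_mono, clarsimp)
        fix u v assume uv: "(u, v) \<in> C"
        then have "u < v" "(L v - L u) / (v - u) < p" using C(2)[OF uv] by auto
        then have "L v - L u \<le> p * (v - u)" by (simp add: pos_divide_less_eq)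
        then have "ennreal (L v - L u) \<le> ennreal (p * (v - u))" by (rule ennreal_leI)
        then show "emeasure \<mu> {u<..<v} \<le> ennreal p * emeasure lborel {u<..<v}"
          using C(2)[OF uv] assms by (auto simp: muI ennreal_mult)
      qed
      also have "\<dots> = ennreal p * emeasure lborel V"
        unfolding V_def by (subst emeasure_disjoint_intervals[OF C(1,3)]) (auto simp: nn_integral_cmult)
      also have "\<dots> \<le> ennreal p * (emeasure lborel E + ennreal e)"
        using mU emeasure_mono[of V U lborel] \<open>V \<subseteq> U\<close> by (intro mult_left_mono) auto
      finally have "ennreal q * emeasure lborel W \<le> ennreal p * (emeasure lborel E + ennreal e)" .
      moreover have "ennreal q * emeasure lborel E \<le> ennreal q * emeasure lborel W"
        using EW by (intro mult_left_mono) auto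
      ultimately show ?thesis by simp
    qed
    define M where "M = measure lborel E"
    have M: "emeasure lborel E = ennreal M"
      using Efin unfolding M_def by (intro emeasure_eq_ennreal_measure) auto
    have "q * M \<le> p * (M + e)" if "0 < e" for e
      using key[OF that] assms that unfolding M
      by (simp add: ennreal_mult[symmetric] ennreal_plus[symmetric] M_def del: ennreal_plus)
    note qp = this
    \<comment> \<open>Used with \<open>e / p\<close>, the error \<open>p * (e / p)\<close> is
      exactly \<open>e\<close>.\<close>
    have "(q - p) * M \<le> 0 + e" if "0 < e" for e
      using qp[of "e / p"] that assms by (simp add: algebra_simps)
    then have "(q - p) * M \<le> 0" by (rule field_le_epsilon)
    then have "M \<le> 0" using assms by (simp add: mult_le_0_iff)
    then have "emeasure lborel E = 0" using M by (simp add: ennreal_neg)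
    then have "E \<in> null_sets lborel" by auto
    then show ?thesis
      unfolding E_def[symmetric] using negligible_iff_null_sets null_sets_completionI by blast
  qed
  then have "negligible (\<Union>n. ?E0 \<inter> {-real n..real n})" by (intro negligible_countable_Union) auto
  moreover have "(\<Union>n. ?E0 \<inter> {-real n..real n}) = ?E0"
  proof -
    have "\<exists>n::nat. x \<in> {-real n..real n}" for x
    proof -
      obtain n :: nat where "\<bar>x\<bar> \<le> real n" using real_arch_simple by blast
      then show ?thesis by (intro exI[of _ n]) auto
    qed
    then show ?thesis by blast
  qed
  ultimately show ?thesis by simp
qed

text \<open>A difference quotient at \<open>x\<close> belongs to an interval that ends at
  \<open>x\<close>. By continuity the strict inequality between the two values survives when the end
  point \<open>x\<close> is pushed slightly to the other side, and then \<open>x\<close> is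
  interior.\<close>

lemma frequently_slope_neg:
  fixes f :: "real \<Rightarrow> real"
  assumes f: "continuous_on UNIV f" and fr: "frequently (\<lambda>h. (f (x + h) - f x) / h < 0) (at 0)"
      and d: "0 < d"
  shows "\<exists>u v. u < x \<and> x < v \<and> v - u < d \<and> f v < f u"
proof -
  have "eventually (\<lambda>h::real. h \<noteq> 0 \<and> \<bar>h\<bar> < d/2) (at 0)"
    using d by (auto simp: eventually_at intro!: exI[of _ "d/2"])
  then obtain h where h: "h \<noteq> 0" "\<bar>h\<bar> < d/2" "(f (x + h) - f x) / h < 0"
    using frequently_eventually_frequently[OF fr] frequently_ex by (smt (verit, best))
  have cont: "isCont f y" for y using f continuous_on_eq_continuous_at by blast
  show ?thesis
  proof (cases "0 < h")
    case True
    then have lt: "f (x + h) < f x" using h by (simp add: field_simps)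
    have "((\<lambda>e. f (x - e)) \<longlongrightarrow> f (x - 0)) (at_right 0)"
      by (intro isCont_tendsto_compose[OF cont] tendsto_intros)
    then have "eventually (\<lambda>e. f (x + h) < f (x - e)) (at_right 0)" using lt
      by (intro order_tendstoD) auto
    moreover have "eventually (\<lambda>e. 0 < e \<and> e < d/2) (at_right (0::real))"
      using d by (auto simp: eventually_at_right intro!: exI[of _ "d/2"])
    ultimately obtain e where "f (x + h) < f (x - e)" "0 < e" "e < d/2"
      using eventually_happens'[OF _ eventually_conj]
        by (metis (no_types, lifting) trivial_limit_at_right_real)
    then show ?thesis using True h by (intro exI[of _ "x - e"] exI[of _ "x + h"]) auto
  next
    case False
    then have lt: "f (x + h) > f x" using h by (simp add: field_simps)
    have "((\<lambda>e. f (x + e)) \<longlongrightarrow> f (x + 0)) (at_right 0)"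
      by (intro isCont_tendsto_compose[OF cont] tendsto_intros)
    then have "eventually (\<lambda>e. f (x + e) < f (x + h)) (at_right 0)" using lt
      by (intro order_tendstoD) auto
    moreover have "eventually (\<lambda>e. 0 < e \<and> e < d/2) (at_right (0::real))"
      using d by (auto simp: eventually_at_right intro!: exI[of _ "d/2"])
    ultimately obtain e where "f (x + e) < f (x + h)" "0 < e" "e < d/2"
      using eventually_happens'[OF _ eventually_conj]
        by (metis (no_types, lifting) trivial_limit_at_right_real)
    then show ?thesis using False h by (intro exI[of _ "x + h"] exI[of _ "x + e"]) auto
  qed
qed

text \<open>Subtracting the line of slope \<open>p\<close> turns the threshold \<open>p\<close> into
  the threshold 0.\<close>

lemma fine_slopes_low:
  assumes L: "continuous_on UNIV L" and fr: "frequently (\<lambda>h. (L (x + h) - L x) / h < p) (at 0)"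
  shows "x \<in> fine_slopes L (\<lambda>s. s < p)"
  unfolding fine_slopes_def
proof clarify
  fix d :: real assume d: "0 < d"
  let ?f = "\<lambda>x. L x - p * x"
  have contf: "continuous_on UNIV ?f" by (intro continuous_intros L)
  have "frequently (\<lambda>h. (?f (x + h) - ?f x) / h < 0) (at 0)"
  proof (rule frequently_rev_mp[OF fr])
    have "(?f (x + h) - ?f x) / h = (L (x + h) - L x) / h - p" if "h \<noteq> 0" for h
      using that by (simp add: field_simps)
    then show "eventually (\<lambda>h. (L (x + h) - L x) / h < p \<longrightarrow> (?f (x + h) - ?f x) / h < 0) (at 0)"
      by (auto simp: eventually_at_filter intro!: always_eventually)
  qed
  then obtain u v where "u < x" "x < v" "v - u < d" "?f v < ?f u"
    using frequently_slope_neg[of ?f x d] d contf by blast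
  then show "\<exists>u v. u < x \<and> x < v \<and> v - u < d \<and> (L v - L u) / (v - u) < p"
    by (intro exI[of _ u] exI[of _ v]) (auto simp: field_simps)
qed

lemma fine_slopes_high:
  assumes L: "continuous_on UNIV L" and fr: "frequently (\<lambda>h. p < (L (x + h) - L x) / h) (at 0)"
  shows "x \<in> fine_slopes L (\<lambda>s. p < s)"
  unfolding fine_slopes_def
proof clarify
  fix d :: real assume d: "0 < d"
  let ?f = "\<lambda>x. p * x - L x"
  have contf: "continuous_on UNIV ?f" by (intro continuous_intros L)
  have "frequently (\<lambda>h. (?f (x + h) - ?f x) / h < 0) (at 0)"
  proof (rule frequently_rev_mp[OF fr])
    have "(?f (x + h) - ?f x) / h = p - (L (x + h) - L x) / h" if "h \<noteq> 0" for h
      using that by (simp add: field_simps)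
    then show "eventually (\<lambda>h. p < (L (x + h) - L x) / h \<longrightarrow> (?f (x + h) - ?f x) / h < 0) (at 0)"
      by (auto simp: eventually_at_filter intro!: always_eventually)
  qed
  then obtain u v where "u < x" "x < v" "v - u < d" "?f v < ?f u"
    using frequently_slope_neg[of ?f x d] d contf by blast
  then show "\<exists>u v. u < x \<and> x < v \<and> v - u < d \<and> p < (L v - L u) / (v - u)"
    by (intro exI[of _ u] exI[of _ v]) (auto simp: field_simps)
qed

text \<open>If the difference quotients have no limit, two rationals \<open>p < q\<close> separate
  their lower and upper limits, and the point admits arbitrarily short chords flatter than
  \<open>p\<close> and others steeper than \<open>q\<close>. Each pair of rationals accounts for a
  null set only.\<close>

theorem lipschitz_AE_differentiable:
  fixes l :: "real \<Rightarrow> real"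
  assumes l: "C-lipschitz_on UNIV l"
  shows "negligible {x. \<not> l differentiable (at x)}"
proof -
  \<comment> \<open>The added slope \<open>C + 1\<close> puts all chord slopes between 1 and
    \<open>2 * C + 1\<close>: \<open>L\<close> is increasing, as a Stieltjes measure requires, and
    the separating rationals are positive.\<close>
  define L where "L x = l x + (C + 1) * x" for x
  have C: "0 \<le> C" using l by (rule lipschitz_on_nonneg)
  have contl: "continuous_on UNIV l" using l by (rule lipschitz_on_continuous_on)
  then have contL: "continuous_on UNIV L" unfolding L_def by (intro continuous_intros)
  have lip: "\<bar>l y - l x\<bar> \<le> C * \<bar>y - x\<bar>" for x y
    using lipschitz_onD[OF l, of y x] by (simp add: dist_real_def)
  have slope: "1 \<le> (L (x + h) - L x) / h \<and> (L (x + h) - L x) / h \<le> 2 * C + 1" if "h \<noteq> 0" for x h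
  proof -
    have "\<bar>(l (x + h) - l x) / h\<bar> \<le> C"
      using lip[of "x + h" x] that by (simp add: abs_divide field_simps)
    moreover have "(L (x + h) - L x) / h = (l (x + h) - l x) / h + (C + 1)"
      using that by (simp add: L_def field_simps)
    ultimately show ?thesis by linarith
  qed
  have "mono L"
  proof (rule monoI)
    fix x y :: real assume "x \<le> y"
    then show "L x \<le> L y"
      using slope[of "y - x" x] by (cases "x = y") (auto simp: field_simps)
  qed
  let ?N = "\<Union>p\<in>{p\<in>\<rat>. 0 < p}. \<Union>q\<in>{q\<in>\<rat>. p < q}. fine_slopes L (\<lambda>s. s < p) \<inter> fine_slopes L (\<lambda>s. q < s)"
  have "negligible ?N"
  proof (intro negligible_countable_Union countable_image countable_subset[OF _ countable_rat]; clarify)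
    fix p assume "0 < (p::real)"
    then show "negligible (\<Union>q\<in>{q\<in>\<rat>. p < q}. fine_slopes L (\<lambda>s. s < p) \<inter> fine_slopes L (\<lambda>s. q < s))"
      by (intro negligible_countable_Union countable_image countable_subset[OF _ countable_rat])
        (auto intro!: fine_slopes_null \<open>mono L\<close> contL)
  qed
  moreover have diff: "l differentiable (at x)" if x: "x \<notin> ?N" for x
  proof -
    define Q where "Q h = (L (x + h) - L x) / h" for h
    define a where "a = Liminf (at 0) (\<lambda>h. ereal (Q h))"
    define b where "b = Limsup (at 0) (\<lambda>h. ereal (Q h))"
    have ne: "eventually (\<lambda>h::real. h \<noteq> 0) (at 0)" by (auto simp: eventually_at_filter)
    have a1: "ereal 1 \<le> a" unfolding a_def
      by (intro Liminf_bounded eventually_mono[OF ne]) (use slope in \<open>auto simp: Q_def\<close>)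
    have b1: "b \<le> ereal (2 * C + 1)" unfolding b_def
      by (intro Limsup_bounded eventually_mono[OF ne]) (use slope in \<open>auto simp: Q_def\<close>)
    have "a \<le> b" unfolding a_def b_def by (intro Liminf_le_Limsup) auto
    have "\<not> a < b"
    proof
      assume "a < b"
      then obtain p where p: "a < ereal (of_rat p)" "ereal (of_rat p) < b" using ereal_dense3 by blast
      then obtain q where q: "ereal (of_rat p) < ereal (of_rat q)" "ereal (of_rat q) < b"
        using ereal_dense3 by blast
      have "1 < (of_rat p :: real)" using le_less_trans[OF a1 p(1)] by simp
      have "frequently (\<lambda>h. Q h < of_rat p) (at 0)"
      proof (rule ccontr)
        assume "\<not> ?thesis"
        then have "eventually (\<lambda>h. ereal (of_rat p) \<le> ereal (Q h)) (at 0)"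
          by (auto simp: frequently_def not_less)
        from Liminf_bounded[OF this] p show False unfolding a_def by simp
      qed
      moreover have "frequently (\<lambda>h. of_rat q < Q h) (at 0)"
      proof (rule ccontr)
        assume "\<not> ?thesis"
        then have "eventually (\<lambda>h. ereal (Q h) \<le> ereal (of_rat q)) (at 0)"
          by (auto simp: frequently_def not_less)
        from Limsup_bounded[OF this] q show False unfolding b_def by simp
      qed
      ultimately have "x \<in> fine_slopes L (\<lambda>s. s < of_rat p) \<inter> fine_slopes L (\<lambda>s. of_rat q < s)"
        using fine_slopes_low[OF contL] fine_slopes_high[OF contL] unfolding Q_def by blast
      then show False using x q(1) \<open>1 < (of_rat p :: real)\<close> by force
    qed
    then have "a = b" using \<open>a \<le> b\<close> by simp
    \<comment> \<open>The two bounds on the slopes exclude an infinite derivative.\<close>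
    have "\<bar>a\<bar> \<noteq> \<infinity>" using a1 b1 \<open>a = b\<close> by auto
    then obtain D where D: "a = ereal D" by auto
    have "((\<lambda>h. ereal (Q h)) \<longlongrightarrow> ereal D) (at 0)"
      using D \<open>a = b\<close> unfolding a_def b_def by (intro Liminf_eq_Limsup) auto
    then have "(Q \<longlongrightarrow> D) (at 0)" by simp
    then have "DERIV L x :> D" unfolding DERIV_def Q_def .
    then have "DERIV (\<lambda>x. L x - (C + 1) * x) x :> D - (C + 1)"
      by (auto intro!: derivative_eq_intros)
    then show ?thesis by (auto simp: L_def real_differentiable_def)
  qed
  ultimately show ?thesis by (blast intro: negligible_subset)
qed

text \<open>Clamping the argument extends a function from an interval to the line without enlarging
  its Lipschitz constant, which brings functions known only on an interval under the theorem
  above.\<close>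

lemma lipschitz_clamp:
  fixes f :: "real \<Rightarrow> real"
  assumes "C-lipschitz_on {a..b} f" "a \<le> b"
  shows "C-lipschitz_on UNIV (\<lambda>x. f (max a (min b x)))"
proof (rule lipschitz_onI)
  fix x y :: real
  have "dist (f (max a (min b x))) (f (max a (min b y))) \<le> C * dist (max a (min b x)) (max a (min b y))"
    using assms by (intro lipschitz_onD[OF assms(1)]) auto
  also have "\<dots> \<le> C * dist x y"
    using lipschitz_on_nonneg[OF assms(1)] by (intro mult_left_mono) (auto simp: dist_real_def)
  finally show "dist (f (max a (min b x))) (f (max a (min b y))) \<le> C * dist x y" .
qed (use assms lipschitz_on_nonneg in blast)

lemma lipschitz_interval_AE_differentiable:
  fixes f :: "real \<Rightarrow> real"
  assumes f: "C-lipschitz_on {a..b} f" and ab: "a \<le> b"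
  shows "AE x in lebesgue. x \<in> {a<..<b} \<longrightarrow> f differentiable (at x)"
proof -
  let ?g = "\<lambda>x. f (max a (min b x))"
  have "negligible {x. \<not> ?g differentiable (at x)}"
    by (rule lipschitz_AE_differentiable[OF lipschitz_clamp[OF f ab]])
  then have "AE x in lebesgue. ?g differentiable (at x)"
    by (intro AE_I'[of "{x. \<not> ?g differentiable (at x)}"]) (auto simp: negligible_iff_null_sets)
  then show ?thesis
  proof (rule AE_mp, intro AE_I2 impI)
    fix x assume g: "?g differentiable (at x)" and x: "x \<in> {a<..<b}"
    from g obtain D where "DERIV ?g x :> D" by (auto simp: real_differentiable_def)
    then have "DERIV f x :> D"
      using x by (rule_tac has_field_derivative_transform_within_open[of ?g D x "{a<..<b}"]) auto
    then show "f differentiable (at x)" by (auto simp: real_differentiable_def)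
  qed
qed

text \<open>The difference quotients of \<open>f\<close> are dominated by the Lipschitz constant, and their integrals
  telescope.\<close>

lemma lipschitz_FTC:
  fixes f :: "real \<Rightarrow> real"
  assumes f: "C-lipschitz_on {a..b} f" and ab: "a \<le> b"
  shows "integrable (lebesgue_on {a..b}) (deriv f)"
    and "(\<integral>x. deriv f x \<partial>(lebesgue_on {a..b})) = f b - f a"
proof -
  \<comment> \<open>The quotient at a point near \<open>b\<close> looks beyond \<open>b\<close>; the
    clamped extension provides values there under the same Lipschitz bound.\<close>
  define g where "g x = f (max a (min b x))" for x
  have g: "C-lipschitz_on UNIV g" unfolding g_def by (rule lipschitz_clamp[OF f ab])
  have contg: "continuous_on A g" for A
    using lipschitz_on_continuous_on[OF g] continuous_on_subset by blast
  define Q where "Q n x = (g (x + inverse (Suc n)) - g x) / inverse (real (Suc n))" for n x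
  have Qcont: "continuous_on {a..b} (Q n)" for n
    unfolding Q_def by (intro continuous_intros continuous_on_compose2[OF contg[of UNIV]]) auto
  have Qint: "integrable (lebesgue_on {a..b}) (Q n)" for n
    by (intro continuous_imp_integrable_real Qcont)
  have inv0: "(\<lambda>n. inverse (real (Suc n))) \<longlonglongrightarrow> 0" by (rule LIMSEQ_inverse_real_of_nat)
  have fl: "filterlim (\<lambda>n. inverse (real (Suc n))) (at 0) sequentially"
    using inv0 by (auto simp: filterlim_at)
  have AElim: "AE x in lebesgue_on {a..b}. (\<lambda>n. Q n x) \<longlonglongrightarrow> deriv f x"
  proof -
    have "AE x in lebesgue. x \<in> {a..b} \<longrightarrow> (\<lambda>n. Q n x) \<longlonglongrightarrow> deriv f x"
    proof -
      have ne: "AE x in lebesgue. x \<noteq> c" for c :: real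
        by (intro AE_I'[of "{c}"]) auto
      from ne[of a] ne[of b] lipschitz_interval_AE_differentiable[OF f ab]
      show ?thesis
      proof eventually_elim
        case (elim x)
        show ?case
        proof
          assume "x \<in> {a..b}"
          then have x: "x \<in> {a<..<b}" using elim by auto
          then have "DERIV f x :> deriv f x"
            using elim by (simp add: DERIV_deriv_iff_real_differentiable)
          then have "DERIV g x :> deriv f x"
            using x by (rule_tac has_field_derivative_transform_within_open[of f _ x "{a<..<b}"])
                (auto simp: g_def)
          then show "(\<lambda>n. Q n x) \<longlonglongrightarrow> deriv f x"
            unfolding DERIV_def Q_def by (rule filterlim_compose[OF _ fl])
        qed
      qed
    qed
    then show ?thesis by (simp add: AE_restrict_space_iff)
  qed
  have Qbound: "norm (Q n x) \<le> C" for n x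
  proof -
    have "\<bar>g (x + h) - g x\<bar> / h \<le> C" if "0 < h" for h
      using lipschitz_onD[OF g, of "x + h" x] that by (simp add: dist_real_def pos_divide_le_eq)
    then show ?thesis by (simp add: Q_def abs_divide)
  qed
  \<comment> \<open>Only almost everywhere is \<open>deriv f\<close> a limit of measurable
    quotients. It inherits measurability from the total function \<open>lim\<close> because Lebesgue
    measure is complete.\<close>
  have meas: "deriv f \<in> borel_measurable (lebesgue_on {a..b})"
  proof -
    define D where "D x = lim (\<lambda>n. Q n x)" for x
    have "(\<lambda>x. indicator {a..b} x * D x) \<in> borel_measurable lebesgue"
    proof -
      have "g \<in> borel_measurable borel" by (intro borel_measurable_continuous_onI contg)
      then have "Q n \<in> borel_measurable borel" for n unfolding Q_def by measurable
      then have "D \<in> borel_measurable borel" unfolding D_def by measurable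
      then have "(\<lambda>x. indicator {a..b} x * D x) \<in> borel_measurable borel" by measurable
      then show ?thesis by (simp add: measurable_completion)
    qed
    moreover have "AE x in lebesgue. indicator {a..b} x * D x = indicator {a..b} x * deriv f x"
    proof -
      from AElim have "AE x in lebesgue. x \<in> {a..b} \<longrightarrow> (\<lambda>n. Q n x) \<longlonglongrightarrow> deriv f x"
        by (simp add: AE_restrict_space_iff)
      then show ?thesis
      proof eventually_elim
        case (elim x)
        then show ?case by (cases "x \<in> {a..b}") (auto simp: D_def limI)
      qed
    qed
    ultimately have "(\<lambda>x. indicator {a..b} x * deriv f x) \<in> borel_measurable lebesgue"
      by (rule borel_measurable_AE)
    then show ?thesis by (subst borel_measurable_restrict_space_iff) auto
  qed
  have dom: "integrable (lebesgue_on {a..b}) (\<lambda>x. C)"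
    by (intro continuous_imp_integrable_real continuous_intros)
  show "integrable (lebesgue_on {a..b}) (deriv f)"
    by (rule integrable_dominated_convergence[OF meas _ dom AElim])
      (use Qint Qbound in auto)
  have lim1: "(\<lambda>n. \<integral>x. Q n x \<partial>(lebesgue_on {a..b})) \<longlonglongrightarrow> (\<integral>x. deriv f x \<partial>(lebesgue_on {a..b}))"
    by (rule integral_dominated_convergence[OF meas _ dom AElim])
      (use Qint Qbound in auto)
  \<comment> \<open>The primitive starts at \<open>a - 1\<close>, so that \<open>a\<close> is an
    interior point and the derivative there is two-sided.\<close>
  define G where "G x = integral {a - 1..x} g" for x
  have G: "DERIV G x :> g x" if "x \<in> {a..b}" for x
  proof -
    have "(G has_real_derivative g x) (at x within {a - 1..b + 1})"
      unfolding G_def using that by (intro integral_has_real_derivative contg) auto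
    moreover have "at x within {a - 1..b + 1} = at x" using that by (intro at_within_Icc_at) auto
    ultimately show ?thesis by simp
  qed
  \<comment> \<open>Integrating \<open>g (x + h) - g x\<close> leaves two short integrals at the
    ends, which are increments of \<open>G\<close>.\<close>
  have intQ: "(\<integral>x. Q n x \<partial>(lebesgue_on {a..b})) =
      (G (b + inverse (real (Suc n))) - G b) / inverse (real (Suc n))
      - (G (a + inverse (real (Suc n))) - G a) / inverse (real (Suc n))" for n
  proof -
    let ?h = "inverse (real (Suc n))"
    have gi: "g integrable_on {c..d}" for c d by (intro integrable_continuous_real contg)
    have hpos: "?h > 0" by simp
    have Gdiff: "integral {c..d} g = G d - G c" if "a \<le> c" "c \<le> d" for c d
    proof -
      have "integral {a - 1..c} g + integral {c..d} g = integral {a - 1..d} g"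
        by (rule Henstock_Kurzweil_Integration.integral_combine[OF _ _ gi]) (use that in auto)
      then show ?thesis by (simp add: G_def)
    qed
    have "(\<integral>x. Q n x \<partial>(lebesgue_on {a..b})) = integral {a..b} (Q n)"
      by (intro lebesgue_integral_eq_integral Qint) auto
    also have "\<dots> = integral {a..b} (\<lambda>x. g (x + ?h) - g x) / ?h"
      unfolding Q_def by (rule integral_divide)
    also have "integral {a..b} (\<lambda>x. g (x + ?h) - g x) = integral {a..b} (\<lambda>x. g (x + ?h)) -
        integral {a..b} g"
      by (intro Henstock_Kurzweil_Integration.integral_diff gi integrable_continuous_real
         continuous_on_compose2[OF contg[of UNIV]] continuous_intros) auto
    also have "integral {a..b} (\<lambda>x. g (x + ?h)) = integral {a + ?h..b + ?h} g"
      using integral_shift_Icc_real[of a b g ?h] by (simp add: o_def add.commute)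
    also have "\<dots> = G (b + ?h) - G (a + ?h)"
      by (rule Gdiff) (use ab hpos in linarith)+
    also have "integral {a..b} g = G b - G a"
      by (rule Gdiff) (use ab in auto)
    finally show ?thesis by (simp add: diff_divide_distrib)
  qed
  have "(\<lambda>n. \<integral>x. Q n x \<partial>(lebesgue_on {a..b})) \<longlonglongrightarrow> g b - g a"
    unfolding intQ
    by (intro tendsto_diff filterlim_compose[OF _ fl] G[unfolded DERIV_def]) (use ab in auto)
  then show "(\<integral>x. deriv f x \<partial>(lebesgue_on {a..b})) = f b - f a"
    using LIMSEQ_unique[OF lim1] ab by (simp add: g_def)
qed

section \<open>Truncations and their primitives\<close>

lemma AE_lebesgue_on_Icc:
  fixes a b :: real
  assumes "AE x in lebesgue. x \<in> {a<..<b} \<longrightarrow> P x"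
  shows "AE x in lebesgue_on {a..b}. P x"
proof -
  have ne: "AE x in lebesgue. x \<noteq> c" for c :: real
    by (intro AE_I'[of "{c}"]) auto
  have "AE x in lebesgue. x \<in> {a..b} \<longrightarrow> P x"
    using ne[of a] ne[of b] assms by eventually_elim auto
  then show ?thesis by (simp add: AE_restrict_space_iff)
qed

lemma LfunD:
  assumes "l \<in> Lfun"
  shows "\<And>s. 0 \<le> s \<Longrightarrow> 0 \<le> l s" "l 0 = 0"
    and "\<exists>C. C-lipschitz_on {0..} l" "AE s in lebesgue. 0 < s \<longrightarrow> 0 \<le> deriv l s"
  using assms by (auto simp: Lfun_def AE_restrict_space_iff)

lemma Lfun_continuous: "l \<in> Lfun \<Longrightarrow> continuous_on {0..} l"
  using LfunD(3) lipschitz_on_continuous_on by blast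

lemma Lfun_lipschitz_Icc:
  assumes "l \<in> Lfun" obtains C where "\<And>c. C-lipschitz_on {0..c} l"
proof -
  obtain C where "C-lipschitz_on {0..} l" using LfunD(3)[OF assms] by blast
  then show thesis by (intro that) (auto intro: lipschitz_on_subset)
qed

lemma Lfun_deriv_nonneg:
  assumes "l \<in> Lfun" shows "AE s in lebesgue_on {0..c}. 0 \<le> deriv l s"
  by (rule AE_lebesgue_on_Icc, rule AE_mp[OF LfunD(4)[OF assms]]) auto

lemma Phi_integrand_integrable:
  assumes l: "l \<in> Lfun" and m: "1 < m" and c: "0 \<le> c"
  shows "integrable (lebesgue_on {0..c}) (\<lambda>s. deriv l s * phi m s)"
proof -
  obtain C where C: "\<And>c. C-lipschitz_on {0..c} l" using Lfun_lipschitz_Icc[OF l] by blast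
  have i: "integrable (lebesgue_on {0..c}) (deriv l)" by (rule lipschitz_FTC(1)[OF C c])
  show ?thesis
  proof (rule Bochner_Integration.integrable_bound)
    show "integrable (lebesgue_on {0..c}) (\<lambda>s. c powr m * deriv l s)" using i by simp
    have "(\<lambda>s. s powr m) \<in> borel_measurable (lebesgue_on {0..c})"
      by (simp add: measurable_completion measurable_restrict_space1)
    then show "(\<lambda>s. deriv l s * phi m s) \<in> borel_measurable (lebesgue_on {0..c})"
      using borel_measurable_integrable[OF i] by (auto simp: phi_def)
    show "AE x in lebesgue_on {0..c}. norm (deriv l x * phi m x) \<le> norm (c powr m * deriv l x)"
    proof (rule AE_I2)
      fix x assume "x \<in> space (lebesgue_on {0..c})"
      then have "0 \<le> x" "x \<le> c" by auto
      then have "x powr m \<le> c powr m" using m by (intro powr_mono2) auto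
      then show "norm (deriv l x * phi m x) \<le> norm (c powr m * deriv l x)"
        by (simp add: phi_def abs_mult mult.commute mult_right_mono)
    qed
  qed
qed

text \<open>Monotonicity serves three times: it gives \<open>Phi_nonneg\<close>, and later both the
  measurability of \<open>Phi_fun m l (c t)\<close> in time and its bound.\<close>

lemma Phi_mono:
  assumes l: "l \<in> Lfun" and m: "1 < m"
  shows "mono (Phi_fun m l)"
proof (rule monoI)
  fix a b :: real assume ab: "a \<le> b"
  have nn: "AE s in lebesgue_on {0..c}. 0 \<le> deriv l s * phi m s" for c
    using Lfun_deriv_nonneg[OF l, of c] by eventually_elim (auto simp: phi_def)
  have nn': "AE s in lebesgue. s \<in> {0..c} \<longrightarrow> 0 \<le> deriv l s * phi m s" for c
    using nn[of c] by (simp add: AE_restrict_space_iff)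
  show "Phi_fun m l a \<le> Phi_fun m l b"
  proof (cases "0 \<le> a")
    \<comment> \<open>For negative \<open>a\<close> the interval of integration is empty, so
      \<open>Phi_fun\<close> is 0 there and monotonicity extends to the whole line.\<close>
    case False
    then have "{0..a} = {}" by auto
    then have "Phi_fun m l a = 0" unfolding Phi_fun_def by (simp add: integral_restrict_space)
    moreover have "0 \<le> Phi_fun m l b" unfolding Phi_fun_def by (rule integral_nonneg_AE[OF nn])
    ultimately show ?thesis by simp
  next
    case True
    have *: "integrable lebesgue (\<lambda>s. indicator {0..c} s *\<^sub>R (deriv l s * phi m s))" if "0 \<le> c" for c
      using Phi_integrand_integrable[OF l m that] by (subst (asm) integrable_restrict_space) auto
    show ?thesis
      unfolding Phi_fun_def
    proof (subst (1 2) integral_restrict_space, simp, simp, rule integral_mono_AE)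
      show "AE s in lebesgue. indicator {0..a} s *\<^sub>R (deriv l s * phi m s) \<le>
          indicator {0..b} s *\<^sub>R (deriv l s * phi m s)"
        using nn'[of b] by eventually_elim (use ab in \<open>auto simp: indicator_def\<close>)
    qed (use * True ab in auto)
  qed
qed

lemma Phi_zero: "Phi_fun m l 0 = 0"
proof -
  have "AE s in lebesgue_on {0..0::real}. deriv l s * phi m s = 0"
    by (rule AE_lebesgue_on_Icc) auto
  then show ?thesis unfolding Phi_fun_def by (rule integral_eq_zero_AE)
qed

lemma Phi_nonneg: "l \<in> Lfun \<Longrightarrow> 1 < m \<Longrightarrow> 0 \<le> c \<Longrightarrow> 0 \<le> Phi_fun m l c"
  using Phi_mono[of l m] Phi_zero[of m l] by (metis monoD)

lemma J_zero: "J_fun l 0 = 0"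
proof -
  have "AE s in lebesgue_on {0..0::real}. l s = 0"
    by (rule AE_lebesgue_on_Icc) auto
  then show ?thesis unfolding J_fun_def by (rule integral_eq_zero_AE)
qed

lemma J_eq_integral:
  assumes "l \<in> Lfun" shows "J_fun l c = integral {0..c} l"
  unfolding J_fun_def
  by (intro lebesgue_integral_eq_integral continuous_imp_integrable_real
     continuous_on_subset[OF Lfun_continuous[OF assms]]) auto

lemma J_deriv:
  assumes l: "l \<in> Lfun" and c: "0 < c"
  shows "(J_fun l has_real_derivative l c) (at c)"
proof -
  have "((\<lambda>c. integral {0..c} l) has_real_derivative l c) (at c within {0..c + 1})"
    using c by (intro integral_has_real_derivative continuous_on_subset[OF Lfun_continuous[OF l]]) auto
  moreover have "J_fun l = (\<lambda>c. integral {0..c} l)" using J_eq_integral[OF l] by auto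
  ultimately show ?thesis using c by (simp add: at_within_Icc_at)
qed

text \<open>Integration by parts turns \<open>c l(c) - J(c)\<close> into \<open>\<integral> l'(s) s ds\<close>, and
  \<open>s\<^sup>m \<le> c\<^sup>m\<^sup>-\<^sup>1 s\<close> on \<open>[0, c]\<close>.\<close>

lemma Phi_le:
  assumes l: "l \<in> Lfun" and m: "1 < m" and c: "0 < c"
  shows "Phi_fun m l c \<le> c powr (m - 1) * (c * l c - J_fun l c)"
proof -
  obtain C where C: "\<And>c. C-lipschitz_on {0..c} l" using Lfun_lipschitz_Icc[OF l] by blast
  have C0: "0 \<le> C" by (rule lipschitz_on_nonneg[OF C[of 1]])
  have contl: "continuous_on {0..c} l" using lipschitz_on_continuous_on[OF C] .
  have bound: "\<bar>l s\<bar> \<le> C * c" if "s \<in> {0..c}" for s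
  proof -
    have "\<bar>l s\<bar> \<le> C * s" using lipschitz_onD[OF C[of c], of s 0] that LfunD(2)[OF l]
      by (auto simp: dist_real_def)
    also have "\<dots> \<le> C * c" using that C0 by (intro mult_left_mono) auto
    finally show ?thesis .
  qed
  \<comment> \<open>The derivative of this product is \<open>l s + s * l' s\<close>; applying the
    fundamental theorem to it is the integration by parts.\<close>
  define q where "q s = s * l s" for s
  \<comment> \<open>On \<open>[0, c]\<close> both \<open>s \<le> c\<close> and
    \<open>|l s| \<le> C * c\<close>, so each of the two terms of the product contributes
    \<open>C * c\<close>.\<close>
  have q: "(2 * C * c)-lipschitz_on {0..c} q"
  proof (rule lipschitz_onI)
    fix x y assume xy: "x \<in> {0..c}" "y \<in> {0..c}"
    have "\<bar>q x - q y\<bar> = \<bar>x * (l x - l y) + (x - y) * l y\<bar>" by (simp add: q_def algebra_simps)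
    also have "\<dots> \<le> \<bar>x\<bar> * \<bar>l x - l y\<bar> + \<bar>x - y\<bar> * \<bar>l y\<bar>"
      by (rule order_trans[OF abs_triangle_ineq]) (simp add: abs_mult)
    also have "\<dots> \<le> c * (C * \<bar>x - y\<bar>) + \<bar>x - y\<bar> * (C * c)"
      using xy c lipschitz_onD[OF C[of c], of x y] bound
      by (intro add_mono mult_mono) (auto simp: dist_real_def)
    finally show "dist (q x) (q y) \<le> 2 * C * c * dist x y" by (simp add: dist_real_def algebra_simps)
  qed (use C0 c in auto)
  have iq: "integrable (lebesgue_on {0..c}) (deriv q)"
      and eq: "(\<integral>s. deriv q s \<partial>(lebesgue_on {0..c})) = c * l c"
    using lipschitz_FTC[OF q] c by (auto simp: q_def)
  have il: "integrable (lebesgue_on {0..c}) l" by (rule continuous_imp_integrable_real[OF contl])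
  have dq: "AE s in lebesgue_on {0..c}. deriv q s - l s = s * deriv l s"
  proof (rule AE_lebesgue_on_Icc, rule AE_mp[OF lipschitz_interval_AE_differentiable[OF C[of c]]], use c
      in simp, intro AE_I2 impI)
    fix s assume "s \<in> {0<..<c} \<longrightarrow> l differentiable at s" "s \<in> {0<..<c}"
    then have "DERIV l s :> deriv l s" by (simp add: DERIV_deriv_iff_real_differentiable)
    then have "DERIV q s :> l s + s * deriv l s"
      unfolding q_def[abs_def] by (auto intro!: derivative_eq_intros)
    then show "deriv q s - l s = s * deriv l s" by (simp add: DERIV_imp_deriv)
  qed
  have "Phi_fun m l c \<le> (\<integral>s. c powr (m - 1) * (deriv q s - l s) \<partial>(lebesgue_on {0..c}))"
    unfolding Phi_fun_def
  proof (rule integral_mono_AE)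
    show "integrable (lebesgue_on {0..c}) (\<lambda>s. deriv l s * phi m s)"
      using Phi_integrand_integrable[OF l m] c by simp
    show "integrable (lebesgue_on {0..c}) (\<lambda>s. c powr (m - 1) * (deriv q s - l s))"
      using iq il by simp
    have "AE s in lebesgue_on {0..c}. s \<in> {0..c}" by (rule AE_I2) auto
    then show "AE s in lebesgue_on {0..c}. deriv l s * phi m s \<le> c powr (m - 1) * (deriv q s - l s)"
      using dq Lfun_deriv_nonneg[OF l, of c]
    proof eventually_elim
      case (elim s)
      have "phi m s \<le> c powr (m - 1) * s"
      proof (cases "s = 0")
        case False
        then have "s powr m = s powr (m - 1) * s" using elim(1) powr_add[of s "m - 1" 1] by simp
        also have "\<dots> \<le> c powr (m - 1) * s" using elim(1) m by (intro mult_right_mono powr_mono2) auto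
        finally show ?thesis by (simp add: phi_def)
      qed (simp add: phi_def)
      then have "deriv l s * phi m s \<le> deriv l s * (c powr (m - 1) * s)"
        using elim(3) by (intro mult_left_mono)
      then show ?case unfolding elim(2) by (simp add: algebra_simps)
    qed
  qed
  also have "\<dots> = c powr (m - 1) * (c * l c - J_fun l c)"
    using iq il by (simp add: eq J_fun_def)
  finally show ?thesis .
qed

section \<open>The divergence theorem on the unit ball\<close>

lemma integral_lborel_affine:
  fixes f :: "'a::euclidean_space \<Rightarrow> real"
  assumes c: "0 < c" and f: "f \<in> borel_measurable borel"
  shows "(\<integral>x. f (t + c *\<^sub>R x) \<partial>lborel) = (\<integral>x. f x \<partial>lborel) / c ^ DIM('a)"
proof -
  have "(\<integral>x. f x \<partial>lborel) = (\<integral>x. f x \<partial>density (distr lborel borel (\<lambda>x. t + c *\<^sub>R x)) (\<lambda>_. \<bar>c\<bar> ^ DIM('a)))"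
    using lborel_affine[of c t] c by simp
  also have "\<dots> = (\<integral>x. \<bar>c\<bar> ^ DIM('a) *\<^sub>R f x \<partial>distr lborel borel (\<lambda>x. t + c *\<^sub>R x))"
    using f by (subst integral_density[symmetric]) auto
  also have "\<dots> = (\<integral>x. \<bar>c\<bar> ^ DIM('a) *\<^sub>R f (t + c *\<^sub>R x) \<partial>lborel)"
    using f by (subst integral_distr) auto
  finally show ?thesis using c by simp
qed

lemma ball_borel[measurable]: "ball (z :: 'a::metric_space) r \<in> sets borel"
  by simp

lemma integrable_indicator_ball:
  fixes f :: "'a::euclidean_space \<Rightarrow> real"
  assumes "(\<lambda>x. indicator (ball z r) x * f x) \<in> borel_measurable borel" "\<And>x. x \<in> ball z r \<Longrightarrow> \<bar>f x\<bar> \<le> K"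
  shows "integrable lborel (\<lambda>x. indicator (ball z r) x * f x)"
proof (rule Bochner_Integration.integrable_bound)
  show "integrable lborel (\<lambda>x. indicator (ball z r) x * \<bar>K\<bar>)"
    using emeasure_lborel_ball_finite[of z r] by (simp add: integrable_indicator_iff)
  show "AE x in lborel. norm (indicator (ball z r) x * f x) \<le> norm (indicator (ball z r) x * \<bar>K\<bar>)"
    using assms(2) by (intro AE_I2) (force simp: indicator_def)
qed (use assms in simp)

lemma measurable_indicator_mult:
  fixes f :: "'a::topological_space \<Rightarrow> real"
  assumes "A \<in> sets borel" "continuous_on A f"
  shows "(\<lambda>x. indicator A x * f x) \<in> borel_measurable borel"
  using borel_measurable_continuous_on_indicator[OF assms] by simp

text \<open>The integral is the derivative at \<open>0\<close> of the constant function \<open>t \<mapsto> \<integral> F(x + t e) dx\<close>.\<close>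

lemma integral_directional_derivative_zero:
  fixes F :: "'a::euclidean_space \<Rightarrow> real"
  assumes F: "L-lipschitz_on UNIV F" and F0: "\<And>x. 1 \<le> norm x \<Longrightarrow> F x = 0"
    and e: "norm e = 1"
    and h: "h \<in> borel_measurable borel"
    and lim: "AE x in lborel. ((\<lambda>t. (F (x + t *\<^sub>R e) - F x) / t) \<longlongrightarrow> h x) (at 0)"
  shows "integrable lborel h" "(\<integral>x. h x \<partial>lborel) = 0"
proof -
  have contF: "continuous_on UNIV F" using F by (rule lipschitz_on_continuous_on)
  have L0: "0 \<le> L" by (rule lipschitz_on_nonneg[OF F])
  have Fm[measurable]: "F \<in> borel_measurable borel" using contF by (rule borel_measurable_continuous_onI)
  define Q where "Q n x = (F (x + inverse (real (Suc n)) *\<^sub>R e) - F x) / inverse (real (Suc n))" for n x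
  have Fi: "integrable lborel F"
  proof (rule Bochner_Integration.integrable_bound)
    have "\<bar>F x\<bar> \<le> indicator (ball 0 1) x * (L * 2)" for x
    proof (cases "norm x < 1")
      case True
      \<comment> \<open>The point \<open>e\<close> lies on the unit sphere, where \<open>F\<close>
        vanishes, at distance at most 2 from \<open>x\<close>.\<close>
      have "\<bar>F x - F e\<bar> \<le> L * norm (x - e)" using lipschitz_onD[OF F, of x e] by (simp add: dist_norm)
      also have "norm (x - e) \<le> 2" using norm_triangle_ineq4[of x e] True e by simp
      finally show ?thesis using True F0[of e] e L0 by (simp add: mult_left_mono)
    qed (use F0 in auto)
    then show "AE x in lborel. norm (F x) \<le> norm (indicator (ball 0 1) x * (L * 2))"
      using L0 by (intro AE_I2) auto
    show "integrable lborel (\<lambda>x::'a. indicator (ball 0 1) x * (L * 2))"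
      using emeasure_lborel_ball_finite[of "0::'a" 1] by (simp add: integrable_indicator_iff)
  qed simp
  have shift: "(\<integral>x. F (x + c) \<partial>lborel) = (\<integral>x. F x \<partial>lborel)" "integrable lborel (\<lambda>x. F (x + c))" for c
  proof -
    have "(\<integral>x. F x \<partial>lborel) = (\<integral>x. F x \<partial>distr lborel borel ((+) c))"
      by (simp add: lborel_distr_plus)
    also have "\<dots> = (\<integral>x. F (c + x) \<partial>lborel)" by (subst integral_distr) auto
    finally show "(\<integral>x. F (x + c) \<partial>lborel) = (\<integral>x. F x \<partial>lborel)" by (simp add: add.commute)
    have "integrable (distr lborel borel ((+) c)) F" using Fi by (simp add: lborel_distr_plus)
    then show "integrable lborel (\<lambda>x. F (x + c))"
      by (subst (asm) integrable_distr_eq) (auto simp: add.commute)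
  qed
  have Q0: "(\<integral>x. Q n x \<partial>lborel) = 0" for n
    unfolding Q_def using shift Fi by simp
  have fl: "filterlim (\<lambda>n. inverse (real (Suc n))) (at 0) sequentially"
    using LIMSEQ_inverse_real_of_nat by (auto simp: filterlim_at)
  have AElim: "AE x in lborel. (\<lambda>n. Q n x) \<longlonglongrightarrow> h x"
    using lim
  proof eventually_elim
    case (elim x)
    then show ?case unfolding Q_def by (rule filterlim_compose[OF _ fl])
  qed
  \<comment> \<open>A shift has length at most 1 and \<open>F\<close> lives in the unit ball, so all
    quotients vanish outside radius 3 and one integrable function dominates them.\<close>
  have bound: "norm (Q n x) \<le> indicator (ball 0 3) x * L" for n x
  proof (cases "norm x < 3")
    case True
    have "\<bar>F (x + t *\<^sub>R e) - F x\<bar> / t \<le> L" if "0 < t" for t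
      using lipschitz_onD[OF F, of "x + t *\<^sub>R e" x] that e by (simp add: dist_norm pos_divide_le_eq)
    then show ?thesis using True by (simp add: Q_def abs_divide)
  next
    case False
    have "inverse (real (Suc n)) \<le> 1" using inverse_le_1_iff[of "real (Suc n)"] by simp
    moreover have "norm x \<le> norm (x + inverse (real (Suc n)) *\<^sub>R e) + norm (inverse (real (Suc n)) *\<^sub>R e)"
      by (metis add_diff_cancel norm_triangle_ineq4)
    ultimately have "1 \<le> norm (x + inverse (real (Suc n)) *\<^sub>R e)" using False e by simp
    then show ?thesis using False F0 by (simp add: Q_def)
  qed
  have dom: "integrable lborel (\<lambda>x::'a. indicator (ball 0 3) x * L)"
    using emeasure_lborel_ball_finite[of "0::'a" 3] by (simp add: integrable_indicator_iff)
  have Qm: "Q n \<in> borel_measurable lborel" for n unfolding Q_def by measurable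
  have hm: "h \<in> borel_measurable lborel" using h by simp
  show "integrable lborel h"
    by (rule integrable_dominated_convergence[OF hm Qm dom AElim]) (use bound in auto)
  have "(\<lambda>n. \<integral>x. Q n x \<partial>lborel) \<longlonglongrightarrow> (\<integral>x. h x \<partial>lborel)"
    by (rule integral_dominated_convergence[OF hm Qm dom AElim]) (use bound in auto)
  then show "(\<integral>x. h x \<partial>lborel) = 0"
    unfolding Q0 by (simp add: LIMSEQ_const_iff)
qed

lemma AE_lborel_sphere: "AE x in lborel. norm (x :: 'a::euclidean_space) \<noteq> s"
proof -
  have "negligible (sphere (0::'a) s)" by (rule negligible_sphere)
  then have "sphere (0::'a) s \<in> null_sets lborel"
    by (simp add: negligible_iff_null_sets null_sets_completion_iff)
  then show ?thesis by (rule AE_I') auto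
qed

lemma AE_lborel_neq: "AE x in lborel. (x :: 'a::euclidean_space) \<noteq> a"
  by (rule AE_I'[of "{a}"]) auto

text \<open>Differentiability is asked at the points of the unit sphere as well: test functions are
  given on an open set around the closed ball. This gives the Lipschitz bound up to the sphere that
  the shell estimate uses.\<close>

locale c1_unit_ball =
  fixes f :: "'a::euclidean_space \<Rightarrow> real" and G :: "'a \<Rightarrow> 'a"
  assumes deriv: "\<And>x. x \<in> cball 0 1 \<Longrightarrow> (f has_derivative (\<lambda>h. G x \<bullet> h)) (at x)"
    and cont_grad: "continuous_on (cball 0 1) G"
begin

lemma cont: "continuous_on (cball 0 1) f"
  using deriv by (meson continuous_at_imp_continuous_on has_derivative_continuous)

text \<open>Extension by zero gives functions that are Borel on the whole space, so that all
  integrals can be taken over \<open>lborel\<close>.\<close>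

definition fh where "fh x = indicator (cball 0 1) x * f x"
definition Gh where "Gh e x = indicator (cball 0 1) x * (G x \<bullet> e)"

lemma fh_measurable[measurable]: "fh \<in> borel_measurable borel"
  unfolding fh_def[abs_def] by (intro measurable_indicator_mult cont) auto

lemma Gh_measurable[measurable]: "Gh e \<in> borel_measurable borel"
  unfolding Gh_def[abs_def] by (intro measurable_indicator_mult continuous_intros cont_grad) auto

lemma bounds:
  "\<exists>M>0. (\<forall>x. \<bar>fh x\<bar> \<le> M) \<and> (\<forall>e x. norm e = 1 \<longrightarrow> \<bar>Gh e x\<bar> \<le> M) \<and>
    (\<forall>x\<in>cball 0 1. \<forall>y\<in>cball 0 1. \<bar>fh x - fh y\<bar> \<le> M * norm (x - y))"
proof -
  have "bounded (f ` cball 0 1)" "bounded (G ` cball 0 1)"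
    by (auto intro!: compact_imp_bounded compact_continuous_image cont cont_grad)
  then obtain M1 M2 where M1: "\<And>x. x \<in> cball 0 1 \<Longrightarrow> \<bar>f x\<bar> \<le> M1"
      and M2: "\<And>x. x \<in> cball 0 1 \<Longrightarrow> norm (G x) \<le> M2"
    unfolding bounded_iff by (metis image_eqI real_norm_def)
  define M where "M = max 1 (max M1 M2)"
  show ?thesis
  proof (intro exI[of _ M] conjI allI ballI impI)
    show "0 < M" by (simp add: M_def)
    show "\<bar>fh x\<bar> \<le> M" for x using M1[of x] by (auto simp: fh_def indicator_def M_def)
    show "\<bar>Gh e x\<bar> \<le> M" if "norm e = 1" for e x
    proof (cases "x \<in> cball 0 1")
      case True
      have "\<bar>G x \<bullet> e\<bar> \<le> norm (G x)" using Cauchy_Schwarz_ineq2[of "G x" e] that by simp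
      then show ?thesis using True M2[of x] by (auto simp: Gh_def M_def)
    qed (auto simp: Gh_def M_def)
    show "\<bar>fh x - fh y\<bar> \<le> M * norm (x - y)" if "x \<in> cball 0 1" "y \<in> cball 0 1" for x y
    proof -
      have "norm (f x - f y) \<le> M * norm (x - y)"
      proof (rule differentiable_bound[OF convex_cball[of 0 1] _ _ that])
        fix z :: 'a assume z: "z \<in> cball 0 1"
        show "(f has_derivative (\<lambda>h. G z \<bullet> h)) (at z within cball 0 1)"
          using deriv[OF z] has_derivative_at_withinI by blast
        show "onorm (\<lambda>h. G z \<bullet> h) \<le> M"
        proof (rule onorm_bound)
          fix h
          have "norm (G z \<bullet> h) \<le> norm (G z) * norm h" by (simp add: Cauchy_Schwarz_ineq2)
          also have "\<dots> \<le> M * norm h" using M2[OF z] by (intro mult_right_mono) (auto simp: M_def)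
          finally show "norm (G z \<bullet> h) \<le> M * norm h" .
        qed (simp add: M_def)
      qed
      then show ?thesis using that by (simp add: fh_def)
    qed
  qed
qed

lemma fh_deriv:
  assumes "norm x < 1" shows "(fh has_derivative (\<lambda>h. G x \<bullet> h)) (at x)"
  by (rule has_derivative_transform_within_open[OF deriv, of x "ball 0 1"])
    (use assms in \<open>auto simp: fh_def\<close>)

text \<open>The cutoff \<open>max 0 (s - norm x)\<close> turns \<open>f\<close> into a Lipschitz
  function that vanishes outside the unit ball, so its directional derivative integrates to zero.
  The product rule gives one term with the gradient of \<open>f\<close> and one with the gradient of
  the cutoff, which is \<open>- sgn x\<close> inside radius \<open>s\<close> and 0 outside.\<close>

lemma cutoff_identity:
  assumes e: "norm e = 1" and s: "0 < s" "s \<le> 1"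
  shows "(\<integral>x. max 0 (s - norm x) * Gh e x \<partial>lborel) =
      (\<integral>x. indicator (ball 0 s) x * (fh x * (sgn x \<bullet> e)) \<partial>lborel)"
proof -
  obtain M where M: "0 < M" "\<And>x. \<bar>fh x\<bar> \<le> M" "\<And>e x. norm e = 1 \<Longrightarrow> \<bar>Gh e x\<bar> \<le> M"
    "\<And>x y. x \<in> cball 0 1 \<Longrightarrow> y \<in> cball 0 1 \<Longrightarrow> \<bar>fh x - fh y\<bar> \<le> M * norm (x - y)"
    using bounds by blast
  define F where "F x = max 0 (s - norm x) * fh x" for x
  define h where "h x = max 0 (s - norm x) * Gh e x - indicator (ball 0 s) x * (fh x * (sgn x \<bullet> e))" for x
  have lip1: "\<bar>F x - F y\<bar> \<le> 2 * M * norm (x - y)" if xy: "norm x \<le> 1" for x y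
  proof (cases "norm y \<le> 1")
    case True
    have "F x - F y = max 0 (s - norm x) * (fh x - fh y) +
        (max 0 (s - norm x) - max 0 (s - norm y)) * fh y"
      by (simp add: F_def algebra_simps)
    then have "\<bar>F x - F y\<bar> \<le> \<bar>max 0 (s - norm x)\<bar> * \<bar>fh x - fh y\<bar> + \<bar>max 0 (s - norm x) -
        max 0 (s - norm y)\<bar> * \<bar>fh y\<bar>"
      by (simp only: abs_mult[symmetric] abs_triangle_ineq)
    also have "\<dots> \<le> 1 * (M * norm (x - y)) + norm (x - y) * M"
    proof (intro add_mono mult_mono)
      have "\<bar>norm x - norm y\<bar> \<le> norm (x - y)" by (rule norm_triangle_ineq3)
      then show "\<bar>max 0 (s - norm x) - max 0 (s - norm y)\<bar> \<le> norm (x - y)" by linarith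
      show "\<bar>max 0 (s - norm x)\<bar> \<le> 1" using s norm_ge_zero[of x] by linarith
    qed (use M True xy s in auto)
    finally show ?thesis by (simp add: algebra_simps)
  next
    case False
    have "\<bar>F x - F y\<bar> = max 0 (s - norm x) * \<bar>fh x\<bar>" using False s by (simp add: F_def abs_mult)
    also have "\<dots> \<le> norm (x - y) * M"
    proof (intro mult_mono)
      have "norm y - norm x \<le> norm (x - y)" by (metis norm_minus_commute norm_triangle_ineq2)
      then show "max 0 (s - norm x) \<le> norm (x - y)" using False s by (simp add: max_def)
    qed (use M in auto)
    also have "\<dots> \<le> 2 * M * norm (x - y)" using M by simp
    finally show ?thesis .
  qed
  have F_out: "F x = 0" if "1 \<le> norm x" for x using that s by (simp add: F_def)
  have lipF: "(2 * M)-lipschitz_on UNIV F"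
  proof (rule lipschitz_onI)
    fix x y :: 'a
    show "dist (F x) (F y) \<le> 2 * M * dist x y"
    proof (cases "norm x \<le> 1")
      case True then show ?thesis using lip1[OF True, of y] by (simp add: dist_norm)
    next
      case False
      show ?thesis
      proof (cases "norm y \<le> 1")
        case True then show ?thesis using lip1[OF True, of x] by (simp add: dist_norm norm_minus_commute)
      next
        case False then show ?thesis using \<open>\<not> norm x \<le> 1\<close> F_out[of x] F_out[of y] M by simp
      qed
    qed
  qed (use M in simp)
  have h_meas: "h \<in> borel_measurable borel" unfolding h_def[abs_def] by measurable
  \<comment> \<open>The norm is not differentiable at the origin, nor the cutoff on the sphere of
    radius \<open>s\<close>; both are null sets.\<close>
  have lim: "AE x in lborel. ((\<lambda>t. (F (x + t *\<^sub>R e) - F x) / t) \<longlongrightarrow> h x) (at 0)"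
    using AE_lborel_sphere[of s] AE_lborel_neq[of 0]
  proof eventually_elim
    case (elim x)
    have "(F has_derivative (\<lambda>v. if norm x < s then (s - norm x) * (G x \<bullet> v) +
        (0 - v \<bullet> sgn x) * fh x else 0)) (at x)"
    proof (cases "norm x < s")
      case True
      have "((\<lambda>x. (s - norm x) * fh x) has_derivative (\<lambda>v. (s - norm x) * (G x \<bullet> v) +
          (0 - v \<bullet> sgn x) * fh x)) (at x)"
        using elim True s
        by (intro has_derivative_mult has_derivative_diff has_derivative_const has_derivative_norm
            fh_deriv) auto
      then have "(F has_derivative (\<lambda>v. (s - norm x) * (G x \<bullet> v) + (0 - v \<bullet> sgn x) * fh x)) (at x)"
        by (rule has_derivative_transform_within_open[where s="ball 0 s"])
            (use True in \<open>auto simp: F_def\<close>)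
      then show ?thesis using True by simp
    next
      case False
      have "((\<lambda>x. 0) has_derivative (\<lambda>v. 0)) (at x)" by simp
      then have "(F has_derivative (\<lambda>v. 0)) (at x)"
        by (rule has_derivative_transform_within_open[where s="- cball 0 s"])
            (use False elim in \<open>auto simp: F_def\<close>)
      then show ?thesis using False by simp
    qed
    then have D: "(F has_derivative (\<lambda>v. if norm x < s then (s - norm x) * (G x \<bullet> v) +
        (0 - v \<bullet> sgn x) * fh x else 0)) (at (x + 0 *\<^sub>R e))"
      by simp
    have "((\<lambda>t. F (x + t *\<^sub>R e)) has_derivative
        (\<lambda>t. (if norm x < s then (s - norm x) * (G x \<bullet> (t *\<^sub>R e)) + (0 - (t *\<^sub>R e) \<bullet> sgn x) * fh x else
            0))) (at 0)"
      by (rule has_derivative_compose[where g=F and f="\<lambda>t. x + t *\<^sub>R e" and x=0 and s=UNIV, OF _ D])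
          (auto intro!: derivative_eq_intros)
    then have "((\<lambda>t. F (x + t *\<^sub>R e)) has_real_derivative h x) (at 0)"
      unfolding has_field_derivative_def
    proof (rule has_derivative_eq_rhs)
      show "(\<lambda>t. (if norm x < s then (s - norm x) * (G x \<bullet> (t *\<^sub>R e)) +
          (0 - (t *\<^sub>R e) \<bullet> sgn x) * fh x else 0)) = (*) (h x)"
        using s by (auto simp: fun_eq_iff h_def Gh_def inner_commute algebra_simps)
    qed
    then show ?case by (simp add: DERIV_def)
  qed
  have int2: "integrable lborel (\<lambda>x. indicator (ball 0 s) x * (fh x * (sgn x \<bullet> e)))"
  proof (rule integrable_indicator_ball[where K=M])
    fix x :: 'a
    have "\<bar>sgn x \<bullet> e\<bar> \<le> norm (sgn x) * norm e" by (rule Cauchy_Schwarz_ineq2)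
    also have "\<dots> \<le> 1" using e by (simp add: norm_sgn)
    finally have "\<bar>fh x\<bar> * \<bar>sgn x \<bullet> e\<bar> \<le> M * 1" using M by (intro mult_mono) auto
    then show "\<bar>fh x * (sgn x \<bullet> e)\<bar> \<le> M" by (simp add: abs_mult)
  qed measurable
  have "integrable lborel h" "(\<integral>x. h x \<partial>lborel) = 0"
    using integral_directional_derivative_zero[OF lipF F_out e h_meas lim] by auto
  moreover from this int2 have
      "integrable lborel (\<lambda>x. h x + indicator (ball 0 s) x * (fh x * (sgn x \<bullet> e)))" by simp
  then have "integrable lborel (\<lambda>x. max 0 (s - norm x) * Gh e x)" by (simp add: h_def)
  ultimately show ?thesis using int2 unfolding h_def by simp
qed

text \<open>Over a thin shell \<open>f\<close> may be replaced by its value at the radial projection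
  \<open>sgn x\<close>, with an error of order thickness times shell volume. The new integrand does
  not depend on the radius, so its integral over the ball of radius \<open>s\<close> is
  \<open>s ^ DIM('a)\<close> times that over the unit ball; the derivative of this power at 1 is the
  factor \<open>DIM('a)\<close>.\<close>

lemma shell_limit:
  assumes e: "norm e = 1"
  shows "(\<lambda>n. ((\<integral>x. indicator (ball 0 1) x * (fh x * (sgn x \<bullet> e)) \<partial>lborel) -
      (\<integral>x. indicator (ball 0 (1 - inverse (real (Suc (Suc n))))) x * (fh x * (sgn x \<bullet> e)) \<partial>lborel))
      / inverse (real (Suc (Suc n))))
    \<longlonglongrightarrow> real DIM('a) * (\<integral>x. indicator (ball 0 1) x * (fh (sgn x) * (sgn x \<bullet> e)) \<partial>lborel)"
proof -
  obtain M where M: "0 < M" "\<And>x. \<bar>fh x\<bar> \<le> M" "\<And>e x. norm e = 1 \<Longrightarrow> \<bar>Gh e x\<bar> \<le> M"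
    "\<And>x y. x \<in> cball 0 1 \<Longrightarrow> y \<in> cball 0 1 \<Longrightarrow> \<bar>fh x - fh y\<bar> \<le> M * norm (x - y)"
    using bounds by blast
  let ?N = "DIM('a)"
  define H where "H s = (\<integral>x. indicator (ball 0 s) x * (fh x * (sgn x \<bullet> e)) \<partial>lborel)" for s
  define K where "K s = (\<integral>x. indicator (ball 0 s) x * (fh (sgn x) * (sgn x \<bullet> e)) \<partial>lborel)" for s
  define V where "V s = (\<integral>(x::'a). indicator (ball 0 s) x * (1::real) \<partial>lborel)" for s :: real
  have inner1: "\<bar>sgn x \<bullet> e\<bar> \<le> 1" for x
  proof -
    have "\<bar>sgn x \<bullet> e\<bar> \<le> norm (sgn x) * norm e" by (rule Cauchy_Schwarz_ineq2)
    also have "\<dots> \<le> 1" using e by (simp add: norm_sgn)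
    finally show ?thesis .
  qed
  have le_M: "\<bar>fh y * (sgn x \<bullet> e)\<bar> \<le> M" for x y
  proof -
    have "\<bar>fh y\<bar> * \<bar>sgn x \<bullet> e\<bar> \<le> M * 1" using M inner1 by (intro mult_mono) auto
    then show ?thesis by (simp add: abs_mult)
  qed
  have iH: "integrable lborel (\<lambda>x. indicator (ball 0 s) x * (fh x * (sgn x \<bullet> e)))" for s
    by (rule integrable_indicator_ball[where K=M], measurable) (rule le_M)
  have iK: "integrable lborel (\<lambda>x. indicator (ball 0 s) x * (fh (sgn x) * (sgn x \<bullet> e)))" for s
    by (rule integrable_indicator_ball[where K=M], measurable) (rule le_M)
  have iV: "integrable lborel (\<lambda>x::'a. indicator (ball 0 s) x * (1::real))" for s
    by (rule integrable_indicator_ball[where K=1]) auto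
  have scale_ind: "indicator (ball 0 s) (0 + s *\<^sub>R x) = (indicator (ball 0 1) x :: real)" if "0 < s"
      for s and x :: 'a
    using that by (auto simp: indicator_def)
  have Ks: "K s = s ^ ?N * K 1" if s: "0 < s" for s
  proof -
    have "(\<integral>x. indicator (ball 0 s) (0 + s *\<^sub>R x) * (fh (sgn (0 + s *\<^sub>R x)) * (sgn (0 + s *\<^sub>R x) \<bullet> e))
        \<partial>lborel) = K s / s ^ ?N"
      unfolding K_def using s by (intro integral_lborel_affine) auto
    moreover have "sgn (0 + s *\<^sub>R x) = sgn x" for x :: 'a using s by (simp add: sgn_scaleR)
    ultimately have "(\<integral>x. indicator (ball 0 1) x * (fh (sgn x) * (sgn x \<bullet> e)) \<partial>lborel) = K s / s ^ ?N"
      using s by (simp only: scale_ind)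
    then show ?thesis using s by (simp add: K_def[of 1])
  qed
  have Vs: "V s = s ^ ?N * V 1" if s: "0 < s" for s
  proof -
    have "(\<integral>(x::'a). indicator (ball 0 s) (0 + s *\<^sub>R x) * (1::real) \<partial>lborel) = V s / s ^ ?N"
      unfolding V_def using s by (intro integral_lborel_affine) auto
    then have "V 1 = V s / s ^ ?N" using s by (simp only: scale_ind V_def[of 1])
    then show ?thesis using s by simp
  qed
  \<comment> \<open>On the shell the distance from \<open>x\<close> to \<open>sgn x\<close> is
    \<open>1 - norm x\<close>, at most \<open>1 - s\<close>; hence the product of two small factors
    on the right.\<close>
  have diff: "\<bar>(H 1 - H s) - (1 - s ^ ?N) * K 1\<bar> \<le> M * (1 - s) * ((1 - s ^ ?N) * V 1)"
      if s: "0 < s" "s < 1" for s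
  proof -
    let ?d = "\<lambda>x::'a. (indicator (ball 0 1) x - indicator (ball 0 s) x) *
        ((fh x - fh (sgn x)) * (sgn x \<bullet> e))"
    have eq: "?d x = (indicator (ball 0 1) x * (fh x * (sgn x \<bullet> e)) -
        indicator (ball 0 s) x * (fh x * (sgn x \<bullet> e)))
       - (indicator (ball 0 1) x * (fh (sgn x) * (sgn x \<bullet> e)) - indicator (ball 0 s) x *
           (fh (sgn x) * (sgn x \<bullet> e)))" for x
      by (simp add: algebra_simps)
    have "(H 1 - H s) - (1 - s ^ ?N) * K 1 = (H 1 - H s) - (K 1 - K s)"
      using Ks[OF s(1)] by (simp add: algebra_simps)
    also have "\<dots> = (\<integral>x. ?d x \<partial>lborel)"
      unfolding eq H_def K_def using iH iK by simp
    also have "\<bar>\<dots>\<bar> \<le> (\<integral>(x::'a). M * (1 - s) * (indicator (ball 0 1) x * 1 - indicator (ball 0 s) x * 1)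
        \<partial>lborel)"
    proof (rule integral_abs_bound_integral)
      show "integrable lborel ?d" unfolding eq using iH iK by auto
      show "integrable lborel (\<lambda>x::'a. M * (1 - s) * (indicator (ball 0 1) x * 1 -
          indicator (ball 0 s) x * 1))"
        using iV by auto
      fix x :: 'a
      show "\<bar>?d x\<bar> \<le> M * (1 - s) * (indicator (ball 0 1) x * 1 - indicator (ball 0 s) x * 1)"
      proof (cases "s \<le> norm x \<and> norm x < 1")
        case True
        then have "x \<noteq> 0" using s by auto
        have "x - sgn x = (norm x - 1) *\<^sub>R sgn x" using \<open>x \<noteq> 0\<close> by (simp add: sgn_div_norm algebra_simps)
        then have "norm (x - sgn x) = 1 - norm x" using True \<open>x \<noteq> 0\<close> by (simp add: norm_sgn)
        moreover have "\<bar>fh x - fh (sgn x)\<bar> \<le> M * norm (x - sgn x)"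
          using True \<open>x \<noteq> 0\<close> by (intro M(4)) (auto simp: norm_sgn)
        ultimately have "\<bar>fh x - fh (sgn x)\<bar> \<le> M * (1 - s)"
          using True M(1) by (smt (verit) mult_left_mono)
        then have "\<bar>fh x - fh (sgn x)\<bar> * \<bar>sgn x \<bullet> e\<bar> \<le> M * (1 - s) * 1"
          using inner1 M s by (intro mult_mono) auto
        then show ?thesis using True s by (simp add: abs_mult)
      next
        case False
        then show ?thesis using s by (auto simp: indicator_def)
      qed
    qed
    also have "\<dots> = M * (1 - s) * (V 1 - V s)"
      unfolding V_def using iV by simp
    also have "V 1 - V s = (1 - s ^ ?N) * V 1" using Vs[OF s(1)] by (simp add: algebra_simps)
    finally show ?thesis .
  qed
  \<comment> \<open>The sequence starts at 1/2, so that \<open>1 - d n\<close> is a positive radius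
    from the first term on.\<close>
  define d where "d n = inverse (real (Suc (Suc n)))" for n
  have d: "0 < d n" "d n < 1" for n unfolding d_def by (auto simp: field_simps)
  have d0: "d \<longlonglongrightarrow> 0"
    using LIMSEQ_Suc[OF LIMSEQ_inverse_real_of_nat] unfolding d_def .
  have quot: "(\<lambda>n. (1 - (1 - d n) ^ ?N) / d n) \<longlonglongrightarrow> real ?N"
  proof -
    have "((\<lambda>s. s ^ ?N) has_real_derivative real ?N) (at (1::real))"
      by (auto intro!: derivative_eq_intros)
    then have D: "((\<lambda>h. ((1 + h) ^ ?N - 1 ^ ?N) / h) \<longlongrightarrow> real ?N) (at (0::real))"
      by (simp only: DERIV_def)
    have "filterlim (\<lambda>n. - d n) (at 0) sequentially"
      using tendsto_minus[OF d0] d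
        by (auto simp: filterlim_at less_imp_neq[symmetric] intro!: always_eventually)
    from filterlim_compose[OF D this]
    have "(\<lambda>n. ((1 + - d n) ^ ?N - 1 ^ ?N) / - d n) \<longlonglongrightarrow> real ?N" .
    moreover have "((1 + - d n) ^ ?N - 1 ^ ?N) / - d n = (1 - (1 - d n) ^ ?N) / d n" for n
      using d(1)[of n] by (simp add: field_simps)
    ultimately show ?thesis by simp
  qed
  have "(\<lambda>n. (H 1 - H (1 - d n)) / d n - (1 - (1 - d n) ^ ?N) / d n * K 1) \<longlonglongrightarrow> 0"
  proof (rule Lim_null_comparison)
    show "\<forall>\<^sub>F n in sequentially. norm ((H 1 - H (1 - d n)) / d n - (1 - (1 - d n) ^ ?N) / d n * K 1)
        \<le> M * ((1 - (1 - d n) ^ ?N) * V 1)"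
    proof (rule always_eventually, rule allI)
      fix n
      have "\<bar>(H 1 - H (1 - d n)) - (1 - (1 - d n) ^ ?N) * K 1\<bar> \<le> d n * (M * ((1 - (1 - d n) ^ ?N) * V 1))"
        using diff[of "1 - d n"] d[of n] by (simp add: algebra_simps)
      then have "\<bar>(H 1 - H (1 - d n)) - (1 - (1 - d n) ^ ?N) * K 1\<bar> / d n \<le>
          M * ((1 - (1 - d n) ^ ?N) * V 1)"
        using d(1)[of n] by (simp add: pos_divide_le_eq mult.commute)
      moreover have "(H 1 - H (1 - d n)) / d n - (1 - (1 - d n) ^ ?N) / d n * K 1 =
          ((H 1 - H (1 - d n)) - (1 - (1 - d n) ^ ?N) * K 1) / d n"
        by (simp add: divide_simps)
      ultimately show "norm ((H 1 - H (1 - d n)) / d n - (1 - (1 - d n) ^ ?N) / d n * K 1)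
          \<le> M * ((1 - (1 - d n) ^ ?N) * V 1)" using d(1)[of n] by (simp add: abs_divide)
    qed
    have "(\<lambda>n. M * ((1 - (1 - d n) ^ ?N) * V 1)) \<longlonglongrightarrow> M * ((1 - (1 - 0) ^ ?N) * V 1)"
      by (intro tendsto_intros d0)
    then show "(\<lambda>n. M * ((1 - (1 - d n) ^ ?N) * V 1)) \<longlonglongrightarrow> 0" by simp
  qed
  from tendsto_add[OF this tendsto_mult_right[OF quot, of "K 1"]]
  have "(\<lambda>n. (H 1 - H (1 - d n)) / d n) \<longlonglongrightarrow> real ?N * K 1" by simp
  then show ?thesis unfolding H_def K_def d_def .
qed

text \<open>The difference of two cutoffs, divided by the difference of their radii, is 1 on the
  smaller ball, falls to 0 across the shell and lies below the indicator of the unit ball. Dominated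
  convergence applies.\<close>

lemma cutoff_limit:
  assumes e: "norm e = 1"
  shows "(\<lambda>n. ((\<integral>x. max 0 (1 - norm x) * Gh e x \<partial>lborel) -
      (\<integral>x. max 0 ((1 - inverse (real (Suc (Suc n)))) - norm x) * Gh e x \<partial>lborel))
      / inverse (real (Suc (Suc n))))
    \<longlonglongrightarrow> (\<integral>x. indicator (ball 0 1) x * Gh e x \<partial>lborel)"
proof -
  obtain M where M: "0 < M" "\<And>e x. norm e = 1 \<Longrightarrow> \<bar>Gh e x\<bar> \<le> M"
    using bounds by blast
  define d where "d n = inverse (real (Suc (Suc n)))" for n
  have d: "0 < d n" "d n < 1" for n unfolding d_def by (auto simp: field_simps)
  have d0: "d \<longlonglongrightarrow> 0"
    using LIMSEQ_Suc[OF LIMSEQ_inverse_real_of_nat] unfolding d_def .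
  define c where "c n x = (max 0 (1 - norm x) - max 0 ((1 - d n) - norm x)) / d n" for n and x :: 'a
  have c01: "0 \<le> c n x" "c n x \<le> indicator (ball 0 1) x" for n x
    using d[of n] by (auto simp: c_def indicator_def divide_simps)
  have i: "integrable lborel (\<lambda>x. max 0 (s - norm x) * Gh e x)" if "s \<le> 1" for s
  proof -
    have eq: "max 0 (s - norm x) * Gh e x = indicator (ball 0 1) x * (max 0 (s - norm x) * Gh e x)" for x
      using that by (auto simp: indicator_def)
    have "integrable lborel (\<lambda>x. indicator (ball 0 1) x * (max 0 (s - norm x) * Gh e x))"
    proof (rule integrable_indicator_ball[where K="1 * M"])
      fix x :: 'a
      have "s - norm x \<le> 1" using that norm_ge_zero[of x] by linarith
      then have "\<bar>max 0 (s - norm x)\<bar> * \<bar>Gh e x\<bar> \<le> 1 * M"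
        using M(1) M(2)[OF e] that by (intro mult_mono) auto
      then show "\<bar>max 0 (s - norm x) * Gh e x\<bar> \<le> 1 * M" by (simp add: abs_mult)
    qed measurable
    then show ?thesis by (subst eq)
  qed
  have eq: "((\<integral>x. max 0 (1 - norm x) * Gh e x \<partial>lborel) -
      (\<integral>x. max 0 ((1 - d n) - norm x) * Gh e x \<partial>lborel)) / d n
      = (\<integral>x. c n x * Gh e x \<partial>lborel)" for n
  proof -
    have "(\<integral>x. c n x * Gh e x \<partial>lborel) =
        (\<integral>x. (max 0 (1 - norm x) * Gh e x - max 0 ((1 - d n) - norm x) * Gh e x) / d n \<partial>lborel)"
      by (simp add: c_def diff_divide_distrib left_diff_distrib)
    also have "\<dots> = ((\<integral>x. max 0 (1 - norm x) * Gh e x \<partial>lborel) -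
        (\<integral>x. max 0 ((1 - d n) - norm x) * Gh e x \<partial>lborel)) / d n"
      using i[of 1] i[of "1 - d n"] d[of n] by simp
    finally show ?thesis ..
  qed
  have "(\<lambda>n. \<integral>x. c n x * Gh e x \<partial>lborel) \<longlonglongrightarrow> (\<integral>x. indicator (ball 0 1) x * Gh e x \<partial>lborel)"
  proof (rule integral_dominated_convergence[where w="\<lambda>x. indicator (ball 0 1) x * M"])
    show "integrable lborel (\<lambda>x::'a. indicator (ball 0 1) x * M)"
      using emeasure_lborel_ball_finite[of "0::'a" 1] by (simp add: integrable_indicator_iff)
    show "AE x in lborel. (\<lambda>n. c n x * Gh e x) \<longlonglongrightarrow> indicator (ball 0 1) x * Gh e x"
    proof (rule AE_I2)
      fix x :: 'a
      have "(\<lambda>n. c n x) \<longlonglongrightarrow> indicator (ball 0 1) x"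
      proof (cases "norm x < 1")
        case True
        then have "\<forall>\<^sub>F n in sequentially. d n < 1 - norm x" using d0 by (intro order_tendstoD) auto
        then have "\<forall>\<^sub>F n in sequentially. indicator (ball 0 1) x = c n x"
          by (rule eventually_mono) (use True d in \<open>auto simp: c_def less_imp_neq[symmetric]\<close>)
        then show ?thesis by (rule Lim_transform_eventually[OF tendsto_const])
      next
        case False
        then have "c n x = 0" for n using c01[of n x] by (simp add: order_antisym)
        then show ?thesis using False by simp
      qed
      then show "(\<lambda>n. c n x * Gh e x) \<longlonglongrightarrow> indicator (ball 0 1) x * Gh e x" by (rule tendsto_mult_right)
    qed
    show "AE x in lborel. norm (c n x * Gh e x) \<le> indicator (ball 0 1) x * M" for n
    proof (rule AE_I2)
      fix x :: 'a
      have "\<bar>c n x\<bar> * \<bar>Gh e x\<bar> \<le> indicator (ball 0 1) x * M"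
        using M(1) M(2)[OF e] c01[of n x] by (intro mult_mono) auto
      then show "norm (c n x * Gh e x) \<le> indicator (ball 0 1) x * M" by (simp add: abs_mult)
    qed
  qed (unfold c_def, measurable)
  then show ?thesis unfolding eq[symmetric] unfolding d_def .
qed

text \<open>This is \<open>cutoff_identity\<close> differentiated in the radius at
  \<open>s = 1\<close>: one side becomes the integral of the gradient over the ball, the other the
  flux through the sphere, written as an integral of values at \<open>sgn x\<close>.\<close>

theorem gauss_unit_ball:
  assumes e: "norm e = 1"
  shows "(\<integral>x. indicator (ball 0 1) x * (G x \<bullet> e) \<partial>lborel) =
    real DIM('a) * (\<integral>x. indicator (ball 0 1) x * (f (sgn x) * (sgn x \<bullet> e)) \<partial>lborel)"
proof -
  have s: "0 < 1 - inverse (real (Suc (Suc n)))" for n by (simp add: field_simps)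
  have "(\<integral>x. indicator (ball 0 1) x * Gh e x \<partial>lborel) =
    real DIM('a) * (\<integral>x. indicator (ball 0 1) x * (fh (sgn x) * (sgn x \<bullet> e)) \<partial>lborel)"
  proof (rule LIMSEQ_unique[OF cutoff_limit[OF e]])
    show "(\<lambda>n. ((\<integral>x. max 0 (1 - norm x) * Gh e x \<partial>lborel) -
      (\<integral>x. max 0 ((1 - inverse (real (Suc (Suc n)))) - norm x) * Gh e x \<partial>lborel))
      / inverse (real (Suc (Suc n)))) \<longlonglongrightarrow>
      real DIM('a) * (\<integral>x. indicator (ball 0 1) x * (fh (sgn x) * (sgn x \<bullet> e)) \<partial>lborel)"
      using shell_limit[OF e] cutoff_identity[OF e, of 1] cutoff_identity[OF e s] by simp
  qed
  moreover have "indicator (ball 0 1) x * Gh e x = indicator (ball 0 1) x * (G x \<bullet> e)" for x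
    by (auto simp: Gh_def indicator_def)
  moreover have "fh (sgn x) = f (sgn x)" for x by (simp add: fh_def norm_sgn)
  ultimately show ?thesis by simp
qed

lemma bounded_on_ball:
  "\<exists>M. \<forall>x\<in>cball 0 1. \<bar>f x\<bar> \<le> M \<and> norm (G x) \<le> M"
proof -
  have "bounded (f ` cball 0 1)" "bounded (G ` cball 0 1)"
    by (auto intro!: compact_imp_bounded compact_continuous_image cont cont_grad)
  then obtain M1 M2 where "\<And>x. x \<in> cball 0 1 \<Longrightarrow> \<bar>f x\<bar> \<le> M1" "\<And>x. x \<in> cball 0 1 \<Longrightarrow> norm (G x) \<le> M2"
    unfolding bounded_iff by (metis image_eqI real_norm_def)
  then show ?thesis by (intro exI[of _ "max M1 M2"]) (auto simp: le_max_iff_disj)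
qed

lemma integrable_ball:
  "integrable lborel (\<lambda>x. indicator (ball 0 1) x * f x)"
  "integrable lborel (\<lambda>x. indicator (ball 0 1) x * (G x \<bullet> e))"
  "integrable lborel (\<lambda>x. indicator (ball 0 1) x * (x \<bullet> G x))"
  "integrable lborel (\<lambda>x. indicator (ball 0 1) x * f (sgn x))"
proof -
  obtain M where M: "\<And>x. x \<in> cball 0 1 \<Longrightarrow> \<bar>f x\<bar> \<le> M" "\<And>x. x \<in> cball 0 1 \<Longrightarrow> norm (G x) \<le> M"
    using bounded_on_ball by blast
  have sub: "continuous_on (ball 0 1) G" "continuous_on (ball 0 1) f"
    using cont cont_grad by (auto intro: continuous_on_subset)
  show "integrable lborel (\<lambda>x. indicator (ball 0 1) x * f x)"
    by (rule integrable_indicator_ball[where K=M]) (use M in \<open>auto intro!: measurable_indicator_mult sub\<close>)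
  have inner_le: "\<bar>G x \<bullet> v\<bar> \<le> M * norm v" if "x \<in> ball 0 1" for x v
  proof -
    have "\<bar>G x \<bullet> v\<bar> \<le> norm (G x) * norm v" by (rule Cauchy_Schwarz_ineq2)
    also have "\<dots> \<le> M * norm v" using M(2)[of x] that by (intro mult_right_mono) auto
    finally show ?thesis .
  qed
  show "integrable lborel (\<lambda>x. indicator (ball 0 1) x * (G x \<bullet> e))"
    by (rule integrable_indicator_ball[where K="M * norm e"])
      (use inner_le in \<open>auto intro!: measurable_indicator_mult continuous_intros sub\<close>)
  show "integrable lborel (\<lambda>x. indicator (ball 0 1) x * (x \<bullet> G x))"
  proof (rule integrable_indicator_ball[where K="M * 1"])
    fix x :: 'a assume x: "x \<in> ball 0 1"
    have "0 \<le> M" using order_trans[OF norm_ge_zero M(2)[of 0]] by simp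
    then have "M * norm x \<le> M * 1" using x by (intro mult_left_mono) auto
    then show "\<bar>x \<bullet> G x\<bar> \<le> M * 1" using inner_le[OF x, of x] by (simp add: inner_commute)
  qed (intro measurable_indicator_mult continuous_intros sub, simp)
  have "f (sgn x) = fh (sgn x)" for x by (simp add: fh_def norm_sgn)
  then have "(\<lambda>x. indicator (ball 0 1) x * f (sgn x)) \<in> borel_measurable borel" by simp
  moreover have "\<bar>f (sgn x)\<bar> \<le> M" for x by (rule M(1)) (simp add: norm_sgn)
  ultimately show "integrable lborel (\<lambda>x. indicator (ball 0 1) x * f (sgn x))"
    by (rule integrable_indicator_ball)
qed

text \<open>Apply the previous theorem to \<open>x\<^sub>e f\<close> in direction \<open>e\<close> and sum over the basis.\<close>

theorem gauss_radial:
  "real DIM('a) * (\<integral>x. indicator (ball 0 1) x * f x \<partial>lborel) +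
      (\<integral>x. indicator (ball 0 1) x * (x \<bullet> G x) \<partial>lborel)
    = real DIM('a) * (\<integral>x. indicator (ball 0 1) x * f (sgn x) \<partial>lborel)"
proof -
  have loc: "c1_unit_ball (\<lambda>x. (x \<bullet> e) * f x) (\<lambda>x. (x \<bullet> e) *\<^sub>R G x + f x *\<^sub>R e)" for e
  proof
    fix x :: 'a assume x: "x \<in> cball 0 1"
    show "((\<lambda>x. (x \<bullet> e) * f x) has_derivative (\<lambda>h. ((x \<bullet> e) *\<^sub>R G x + f x *\<^sub>R e) \<bullet> h)) (at x)"
      by (rule derivative_eq_intros deriv[OF x] refl)+
        (simp add: fun_eq_iff inner_add_left inner_add_right inner_commute mult.commute)
  qed (intro continuous_intros cont cont_grad)
  have e1: "(\<integral>x. indicator (ball 0 1) x * ((x \<bullet> e) * (G x \<bullet> e)) \<partial>lborel) +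
      (\<integral>x. indicator (ball 0 1) x * f x \<partial>lborel)
      = real DIM('a) * (\<integral>x. indicator (ball 0 1) x * (f (sgn x) * (sgn x \<bullet> e)\<^sup>2) \<partial>lborel)"
    "integrable lborel (\<lambda>x. indicator (ball 0 1) x * ((x \<bullet> e) * (G x \<bullet> e)))"
    if e: "e \<in> Basis" for e
  proof -
    interpret e: c1_unit_ball "\<lambda>x. (x \<bullet> e) * f x" "\<lambda>x. (x \<bullet> e) *\<^sub>R G x + f x *\<^sub>R e" by (rule loc)
    have eq: "indicator (ball 0 1) x * (((x \<bullet> e) *\<^sub>R G x + f x *\<^sub>R e) \<bullet> e)
      = indicator (ball 0 1) x * ((x \<bullet> e) * (G x \<bullet> e)) + indicator (ball 0 1) x * f x" for x
      using e by (simp add: inner_add_left algebra_simps)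
    have "integrable lborel (\<lambda>x. indicator (ball 0 1) x * ((x \<bullet> e) * (G x \<bullet> e)) +
        indicator (ball 0 1) x * f x)"
      using e.integrable_ball(2)[of e] unfolding eq .
    from Bochner_Integration.integrable_diff[OF this integrable_ball(1)]
    show i: "integrable lborel (\<lambda>x. indicator (ball 0 1) x * ((x \<bullet> e) * (G x \<bullet> e)))" by simp
    have "(\<integral>x. indicator (ball 0 1) x * ((x \<bullet> e) * (G x \<bullet> e)) + indicator (ball 0 1) x * f x \<partial>lborel)
      = real DIM('a) * (\<integral>x. indicator (ball 0 1) x * (((sgn x \<bullet> e) * f (sgn x)) * (sgn x \<bullet> e)) \<partial>lborel)"
      using e.gauss_unit_ball[of e] e unfolding eq by simp
    then show "(\<integral>x. indicator (ball 0 1) x * ((x \<bullet> e) * (G x \<bullet> e)) \<partial>lborel) +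
        (\<integral>x. indicator (ball 0 1) x * f x \<partial>lborel)
      = real DIM('a) * (\<integral>x. indicator (ball 0 1) x * (f (sgn x) * (sgn x \<bullet> e)\<^sup>2) \<partial>lborel)"
      using i integrable_ball(1) by (simp add: power2_eq_square mult_ac)
  qed
  have i2: "integrable lborel (\<lambda>x. indicator (ball 0 1) x * (f (sgn x) * (sgn x \<bullet> e)\<^sup>2))"
      if e: "e \<in> Basis" for e
  proof (rule Bochner_Integration.integrable_bound[OF integrable_ball(4)])
    have "f (sgn x) = fh (sgn x)" for x by (simp add: fh_def norm_sgn)
    then show "(\<lambda>x. indicator (ball 0 1) x * (f (sgn x) * (sgn x \<bullet> e)\<^sup>2)) \<in> borel_measurable lborel"
      by simp
    show "AE x in lborel. norm (indicator (ball 0 1) x * (f (sgn x) * (sgn x \<bullet> e)\<^sup>2)) \<le>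
        norm (indicator (ball 0 1) x * f (sgn x))"
    proof (rule AE_I2)
      fix x :: 'a
      have "\<bar>sgn x \<bullet> e\<bar> \<le> norm (sgn x)" using e by (rule Basis_le_norm)
      also have "\<dots> \<le> 1" by (simp add: norm_sgn)
      finally have "(sgn x \<bullet> e)\<^sup>2 \<le> 1" by (simp add: abs_square_le_1)
      then show "norm (indicator (ball 0 1) x * (f (sgn x) * (sgn x \<bullet> e)\<^sup>2)) \<le>
          norm (indicator (ball 0 1) x * f (sgn x))"
        by (simp add: abs_mult mult_left_le indicator_def)
    qed
  qed
  have "(\<Sum>e\<in>Basis. (\<integral>x. indicator (ball 0 1) x * ((x \<bullet> e) * (G x \<bullet> e)) \<partial>lborel) +
      (\<integral>x. indicator (ball 0 1) x * f x \<partial>lborel))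
     = (\<Sum>e\<in>Basis. real DIM('a) * (\<integral>x. indicator (ball 0 1) x * (f (sgn x) * (sgn x \<bullet> e)\<^sup>2) \<partial>lborel))"
    using e1(1) by simp
  also have "\<dots> = real DIM('a) * (\<integral>x. (\<Sum>e\<in>Basis. indicator (ball 0 1) x * (f (sgn x) * (sgn x \<bullet> e)\<^sup>2))
      \<partial>lborel)"
    using i2 by (subst Bochner_Integration.integral_sum) (auto simp: sum_distrib_left)
  also have "(\<integral>x. (\<Sum>e\<in>Basis. indicator (ball 0 1) x * (f (sgn x) * (sgn x \<bullet> e)\<^sup>2)) \<partial>lborel)
     = (\<integral>x. indicator (ball 0 1) x * f (sgn x) \<partial>lborel)"
  proof (rule integral_cong_AE)
    have "f (sgn x) = fh (sgn x)" for x by (simp add: fh_def norm_sgn)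
    then show "(\<lambda>x. \<Sum>e\<in>Basis. indicator (ball 0 1) x * (f (sgn x) * (sgn x \<bullet> e)\<^sup>2)) \<in> borel_measurable
        lborel"
      "(\<lambda>x. indicator (ball 0 1) x * f (sgn x)) \<in> borel_measurable lborel" by simp_all
    \<comment> \<open>Off the origin \<open>sgn x\<close> is a unit vector, so the squares of its
      components add up to 1.\<close>
    show "AE x in lborel. (\<Sum>e\<in>Basis. indicator (ball 0 1) x * (f (sgn x) * (sgn x \<bullet> e)\<^sup>2)) =
        indicator (ball 0 1) x * f (sgn x)"
      using AE_lborel_neq[of "0::'a"]
    proof eventually_elim
      case (elim x)
      have "(\<Sum>e\<in>Basis. (sgn x \<bullet> e)\<^sup>2) = sgn x \<bullet> sgn x"
        by (subst euclidean_inner) (simp add: power2_eq_square)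
      also have "\<dots> = 1" using elim by (simp add: dot_square_norm norm_sgn)
      finally show ?case by (simp add: sum_distrib_left[symmetric])
    qed
  qed
  finally have "(\<Sum>e\<in>Basis. \<integral>x. indicator (ball 0 1) x * ((x \<bullet> e) * (G x \<bullet> e)) \<partial>lborel) +
      real DIM('a) * (\<integral>x. indicator (ball 0 1) x * f x \<partial>lborel)
     = real DIM('a) * (\<integral>x. indicator (ball 0 1) x * f (sgn x) \<partial>lborel)"
    by (simp add: sum.distrib)
  moreover have "(\<Sum>e\<in>Basis. \<integral>x. indicator (ball 0 1) x * ((x \<bullet> e) * (G x \<bullet> e)) \<partial>lborel) =
      (\<integral>x. indicator (ball 0 1) x * (x \<bullet> G x) \<partial>lborel)"
  proof -
    have "(\<Sum>e\<in>Basis. \<integral>x. indicator (ball 0 1) x * ((x \<bullet> e) * (G x \<bullet> e)) \<partial>lborel)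
      = (\<integral>x. (\<Sum>e\<in>Basis. indicator (ball 0 1) x * ((x \<bullet> e) * (G x \<bullet> e))) \<partial>lborel)"
      using e1(2) by (subst Bochner_Integration.integral_sum) auto
    also have "\<dots> = (\<integral>x. indicator (ball 0 1) x * (x \<bullet> G x) \<partial>lborel)"
    proof (rule Bochner_Integration.integral_cong[OF refl])
      fix x
      show "(\<Sum>e\<in>Basis. indicator (ball 0 1) x * ((x \<bullet> e) * (G x \<bullet> e))) =
          indicator (ball 0 1) x * (x \<bullet> G x)"
        using euclidean_inner[of x "G x"] by (simp only: sum_distrib_left)
    qed
    finally show ?thesis .
  qed
  ultimately show ?thesis by simp
qed

end

section \<open>Surface measure, gradient and divergence on a ball\<close>

lemma partial_deriv_eq_grad: "e \<in> Basis \<Longrightarrow> partial_deriv e f x = grad f x \<bullet> e"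
  by (simp add: grad_def inner_sum_left inner_Basis if_distrib sum.delta cong: if_cong)

lemma differentiable_grad:
  assumes "f differentiable (at x)"
  shows "(f has_derivative (\<lambda>h. grad f x \<bullet> h)) (at x)"
proof -
  have D: "(f has_derivative frechet_derivative f (at x)) (at x)"
    using assms frechet_derivative_works by blast
  have lin: "linear (frechet_derivative f (at x))"
    using D by (rule has_derivative_linear)
  have "frechet_derivative f (at x) h = grad f x \<bullet> h" for h
  proof -
    have "frechet_derivative f (at x) h = (\<Sum>e\<in>Basis. (h \<bullet> e) *\<^sub>R frechet_derivative f (at x) e)"
      by (subst euclidean_representation[of h, symmetric], subst linear_sum[OF lin])
         (simp add: linear_scale[OF lin])
    also have "\<dots> = grad f x \<bullet> h"
      by (simp add: grad_def partial_deriv_def inner_sum_left inner_sum_right inner_commute mult.commute)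
    finally show ?thesis .
  qed
  then have "frechet_derivative f (at x) = (\<lambda>h. grad f x \<bullet> h)" by auto
  then show ?thesis using D by simp
qed

lemma grad_unique:
  assumes "(f has_derivative (\<lambda>h. G \<bullet> h)) (at x)"
  shows "grad f x = G"
proof -
  have "frechet_derivative f (at x) = (\<lambda>h. G \<bullet> h)"
    using frechet_derivative_at[OF assms] by simp
  then show ?thesis by (simp add: grad_def partial_deriv_def euclidean_representation)
qed

lemma smooth_has_derivative:
  assumes "smooth f"
  shows "(f has_derivative (\<lambda>h. grad f x \<bullet> h)) (at x)" "continuous_on UNIV (grad f)"
proof -
  have "f differentiable_on UNIV"
    using assms[unfolded smooth_def, rule_format, of "[]"] by simp
  then show "(f has_derivative (\<lambda>h. grad f x \<bullet> h)) (at x)"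
    by (intro differentiable_grad) (simp add: differentiable_on_def)
  have "continuous_on UNIV (partial_deriv e f)" if "e \<in> Basis" for e
    using assms[unfolded smooth_def, rule_format, of "[e]"] that
    by (intro differentiable_imp_continuous_on) simp
  then show "continuous_on UNIV (grad f)"
    unfolding grad_def[abs_def] by (intro continuous_intros)
qed

lemma smooth_continuous: "smooth f \<Longrightarrow> continuous_on UNIV f"
  using smooth_has_derivative(1) by (meson continuous_at_imp_continuous_on has_derivative_continuous)

text \<open>With \<open>p = sgn\<close> this measure lives on the sphere of radius \<open>R\<close>; a constant weight \<open>N R\<^sup>N\<^sup>-\<^sup>1\<close> gives
  surface measure. With \<open>p\<close> the identity it lives on the ball.\<close>

definition push :: "'a::euclidean_space set \<Rightarrow> 'a \<Rightarrow> real \<Rightarrow> ('a \<Rightarrow> real) \<Rightarrow> ('a \<Rightarrow> 'a) \<Rightarrow> 'a measure" where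
  "push \<Omega> x0 R k p = distr (density (restrict_space lborel (ball 0 1)) (\<lambda>y. ennreal (k y)))
     (restrict_space borel \<Omega>) (\<lambda>y. x0 + R *\<^sub>R p y)"

definition weight :: "('a::euclidean_space \<Rightarrow> real) \<Rightarrow> bool" where
  "weight k \<longleftrightarrow> k \<in> borel_measurable borel \<and> (\<exists>C. \<forall>y\<in>ball 0 1. 0 \<le> k y \<and> k y \<le> C)"

definition into_cball :: "('a::euclidean_space \<Rightarrow> 'a) \<Rightarrow> bool" where
  "into_cball p \<longleftrightarrow> p \<in> borel_measurable borel \<and> (\<forall>y\<in>ball 0 1. norm (p y) \<le> 1)"

lemma into_cball_sgn [simp]: "into_cball sgn" by (auto simp: into_cball_def norm_sgn)
lemma into_cball_ident [simp]: "into_cball (\<lambda>y. y)" by (auto simp: into_cball_def)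
lemma weight_const [simp]: "0 \<le> K \<Longrightarrow> weight (\<lambda>_. K)" by (auto simp: weight_def)

lemma sets_push [simp, measurable_cong]: "sets (push \<Omega> x0 R k p) = sets (restrict_space borel \<Omega>)"
  by (simp add: push_def)
lemma space_push [simp]: "space (push \<Omega> x0 R k p) = \<Omega>"
  by (simp add: push_def space_restrict_space)

locale ball_domain =
  fixes \<Omega> :: "'a::euclidean_space set" and x0 :: 'a and R :: real
  assumes open_domain: "open \<Omega>" and R_pos: "0 < R" and cball_sub: "cball x0 R \<subseteq> \<Omega>"
begin

lemma ball_sub: "ball x0 R \<subseteq> \<Omega>" using cball_sub ball_subset_cball by blast

lemma into_domain: "norm y \<le> 1 \<Longrightarrow> x0 + R *\<^sub>R y \<in> \<Omega>"
  using cball_sub R_pos by (auto simp: subset_iff dist_norm)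

lemma sets_domain: "A \<in> sets (restrict_space borel \<Omega>) \<longleftrightarrow> A \<in> sets borel \<and> A \<subseteq> \<Omega>"
  using open_domain by (subst sets_restrict_space_iff) auto

lemma map_measurable:
  assumes "into_cball p"
  shows "(\<lambda>y. x0 + R *\<^sub>R p y) \<in> restrict_space lborel (ball 0 1) \<rightarrow>\<^sub>M restrict_space borel \<Omega>"
proof (rule measurable_restrict_space2)
  have [measurable]: "p \<in> borel_measurable borel" using assms by (simp add: into_cball_def)
  have "(\<lambda>y. x0 + R *\<^sub>R p y) \<in> borel_measurable lborel" by measurable
  then show "(\<lambda>y. x0 + R *\<^sub>R p y) \<in> restrict_space lborel (ball 0 1) \<rightarrow>\<^sub>M borel"
    by (rule measurable_restrict_space1)
qed (use assms in \<open>auto simp: into_cball_def space_restrict_space intro!: into_domain\<close>)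

lemma push_base_measurable:
  assumes p: "into_cball p" and k: "weight k" and f: "f \<in> borel_measurable (restrict_space borel \<Omega>)"
  shows "(\<lambda>y. indicator (ball 0 1) y * (k y * f (x0 + R *\<^sub>R p y))) \<in> borel_measurable borel"
proof -
  have [measurable]: "k \<in> borel_measurable borel" using k by (simp add: weight_def)
  have "(\<lambda>y. f (x0 + R *\<^sub>R p y)) \<in> borel_measurable (restrict_space lborel (ball 0 1))"
    by (rule measurable_compose[OF map_measurable[OF p] f])
  then have [measurable]: "(\<lambda>y. indicator (ball 0 1) y *\<^sub>R f (x0 + R *\<^sub>R p y)) \<in> borel_measurable lborel"
    by (subst (asm) borel_measurable_restrict_space_iff) auto
  have "(\<lambda>y. k y * (indicator (ball 0 1) y *\<^sub>R f (x0 + R *\<^sub>R p y))) \<in> borel_measurable lborel"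
    by measurable
  then show ?thesis by (simp add: mult_ac)
qed

lemma integral_push:
  assumes p: "into_cball p" and k: "weight k" and f: "f \<in> borel_measurable (restrict_space borel \<Omega>)"
  shows "(\<integral>x. f x \<partial>push \<Omega> x0 R k p) = (\<integral>y. indicator (ball 0 1) y * (k y * f (x0 + R *\<^sub>R p y)) \<partial>lborel)"
proof -
  have km: "k \<in> borel_measurable (restrict_space lborel (ball 0 1))"
    using k by (auto simp: weight_def intro: measurable_restrict_space1)
  have "(\<integral>x. f x \<partial>push \<Omega> x0 R k p) =
      (\<integral>y. f (x0 + R *\<^sub>R p y) \<partial>density (restrict_space lborel (ball 0 1)) (\<lambda>y. ennreal (k y)))"
    unfolding push_def using map_measurable[OF p] f by (subst integral_distr) auto
  also have "\<dots> = (\<integral>y. k y *\<^sub>R f (x0 + R *\<^sub>R p y) \<partial>restrict_space lborel (ball 0 1))"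
    using measurable_compose[OF map_measurable[OF p] f] km k
    by (subst integral_density) (auto simp: weight_def space_restrict_space intro!: AE_I2)
  also have "\<dots> = (\<integral>y. indicator (ball 0 1) y * (k y * f (x0 + R *\<^sub>R p y)) \<partial>lborel)"
    by (subst integral_restrict_space) auto
  finally show ?thesis .
qed

lemma finite_push:
  assumes p: "into_cball p" and k: "weight k"
  shows "finite_measure (push \<Omega> x0 R k p)"
proof -
  let ?B = "restrict_space lborel (ball 0 1) :: 'a measure"
  obtain C where C: "\<And>y. y \<in> ball 0 1 \<Longrightarrow> 0 \<le> k y \<and> k y \<le> C" using k unfolding weight_def by blast
  have km: "k \<in> borel_measurable ?B"
    using k by (auto simp: weight_def intro: measurable_restrict_space1)
  have "finite_measure (density ?B (\<lambda>y. ennreal (k y)))"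
  proof
    have "emeasure (density ?B (\<lambda>y. ennreal (k y))) (space ?B) =
        (\<integral>\<^sup>+y. ennreal (k y) * indicator (space ?B) y \<partial>?B)"
      by (intro emeasure_density measurable_compose[OF km] measurable_ennreal sets.top)
    also have "\<dots> \<le> (\<integral>\<^sup>+y. ennreal C \<partial>?B)"
      using C by (intro nn_integral_mono) (auto simp: space_restrict_space indicator_def intro!:
          ennreal_leI)
    also have "\<dots> < \<infinity>"
      using emeasure_lborel_ball_finite[of "0::'a" 1]
      by (simp add: space_restrict_space emeasure_restrict_space ennreal_mult_less_top)
    finally show "emeasure (density ?B (\<lambda>y. ennreal (k y))) (space (density ?B (\<lambda>y. ennreal (k y)))) \<noteq>
        \<infinity>" by simp
  qed
  then show ?thesis
    unfolding push_def by (rule finite_measure.finite_measure_distr) (use map_measurable[OF p] in simp)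
qed

lemma measure_push:
  assumes p: "into_cball p" and k: "weight k" and A: "A \<in> sets (restrict_space borel \<Omega>)"
  shows "measure (push \<Omega> x0 R k p) A =
      (\<integral>y. indicator (ball 0 1) y * (k y * indicator A (x0 + R *\<^sub>R p y)) \<partial>lborel)"
proof -
  have "A \<subseteq> \<Omega>" using A sets_domain by auto
  have "measure (push \<Omega> x0 R k p) A = (\<integral>x. indicator A x \<partial>push \<Omega> x0 R k p)"
    using \<open>A \<subseteq> \<Omega>\<close> by (simp add: Int_absorb2)
  also have "\<dots> = (\<integral>y. indicator (ball 0 1) y * (k y * indicator A (x0 + R *\<^sub>R p y)) \<partial>lborel)"
    using A by (intro integral_push p k) (auto intro: borel_measurable_indicator)
  finally show ?thesis .
qed

lemma push_pos_radon: "into_cball p \<Longrightarrow> weight k \<Longrightarrow> pos_radon \<Omega> (push \<Omega> x0 R k p)"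
  using finite_measure.emeasure_finite[OF finite_push] by (auto simp: pos_radon_def less_top)

lemma push_finite_radon:
  "into_cball p \<Longrightarrow> weight k \<Longrightarrow> into_cball q \<Longrightarrow> weight l \<Longrightarrow>
    finite_radon \<Omega> (push \<Omega> x0 R k p, push \<Omega> x0 R l q)"
  by (simp add: finite_radon_def signed_radon_def push_pos_radon finite_push)

lemma integrable_push_base:
  assumes p: "into_cball p" and k: "weight k" and f: "f \<in> borel_measurable (restrict_space borel \<Omega>)"
    and M: "\<And>x. x \<in> cball x0 R \<Longrightarrow> \<bar>f x\<bar> \<le> M"
  shows "integrable lborel (\<lambda>y. indicator (ball 0 1) y * (k y * f (x0 + R *\<^sub>R p y)))"
proof -
  obtain C where C: "\<And>y. y \<in> ball 0 1 \<Longrightarrow> 0 \<le> k y \<and> k y \<le> C" using k unfolding weight_def by blast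
  show ?thesis
  proof (rule integrable_indicator_ball[where K="C * M"])
    fix y :: 'a assume y: "y \<in> ball 0 1"
    then have "x0 + R *\<^sub>R p y \<in> cball x0 R" using p R_pos by (auto simp: into_cball_def dist_norm)
    then have "\<bar>k y\<bar> * \<bar>f (x0 + R *\<^sub>R p y)\<bar> \<le> C * M" using C[OF y] M by (intro mult_mono) auto
    then show "\<bar>k y * f (x0 + R *\<^sub>R p y)\<bar> \<le> C * M" by (simp add: abs_mult)
  qed (rule push_base_measurable[OF p k f])
qed

lemma continuous_bounded:
  assumes "continuous_on \<Omega> f"
  shows "f \<in> borel_measurable (restrict_space borel \<Omega>)" "\<exists>M. \<forall>x\<in>cball x0 R. \<bar>f x :: real\<bar> \<le> M"
proof -
  show "f \<in> borel_measurable (restrict_space borel \<Omega>)" using assms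
    by (rule borel_measurable_continuous_on_restrict)
  have "bounded (f ` cball x0 R)"
    using assms cball_sub by (intro compact_imp_bounded compact_continuous_image)
        (auto intro: continuous_on_subset)
  then show "\<exists>M. \<forall>x\<in>cball x0 R. \<bar>f x\<bar> \<le> M" by (auto simp: bounded_iff)
qed

lemma integral_over_ball:
  assumes g: "continuous_on (cball x0 R) g"
  shows "(\<integral>x. indicator (ball x0 R) x * g x \<partial>lebesgue_on \<Omega>) =
      R ^ DIM('a) * (\<integral>y. indicator (ball 0 1) y * g (x0 + R *\<^sub>R y) \<partial>lborel)"
    and "integrable (lebesgue_on \<Omega>) (\<lambda>x. indicator (ball x0 R) x * g x)"
proof -
  have gb: "(\<lambda>x. indicator (ball x0 R) x * g x) \<in> borel_measurable borel"
    using g by (intro measurable_indicator_mult continuous_on_subset[OF g]) auto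
  have eq: "indicator \<Omega> x *\<^sub>R (indicator (ball x0 R) x * g x) = indicator (ball x0 R) x * g x" for x
    using ball_sub by (auto simp: indicator_def)
  have "(\<integral>x. indicator (ball x0 R) x * g x \<partial>lebesgue_on \<Omega>) =
      (\<integral>x. indicator (ball x0 R) x * g x \<partial>lebesgue)"
    using open_domain by (subst integral_restrict_space) (simp, simp only: eq)
  also have "\<dots> = (\<integral>x. indicator (ball x0 R) x * g x \<partial>lborel)"
    using gb by (intro integral_completion) simp
  also have "\<dots> = R ^ DIM('a) * (\<integral>y. indicator (ball x0 R) (x0 + R *\<^sub>R y) * g (x0 + R *\<^sub>R y) \<partial>lborel)"
    using integral_lborel_affine[OF R_pos gb, of x0] R_pos by simp
  also have "(\<lambda>y. indicator (ball x0 R) (x0 + R *\<^sub>R y) :: real) = indicator (ball 0 1)"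
    using R_pos by (auto simp: indicator_def dist_norm)
  then have "(\<integral>y. indicator (ball x0 R) (x0 + R *\<^sub>R y) * g (x0 + R *\<^sub>R y) \<partial>lborel) =
      (\<integral>y. indicator (ball 0 1) y * g (x0 + R *\<^sub>R y) \<partial>lborel)"
    by (metis (no_types, lifting))
  finally show "(\<integral>x. indicator (ball x0 R) x * g x \<partial>lebesgue_on \<Omega>) =
      R ^ DIM('a) * (\<integral>y. indicator (ball 0 1) y * g (x0 + R *\<^sub>R y) \<partial>lborel)" .
  have "bounded (g ` cball x0 R)" using g by (intro compact_imp_bounded compact_continuous_image) auto
  then obtain M where M: "\<And>x. x \<in> cball x0 R \<Longrightarrow> \<bar>g x\<bar> \<le> M" unfolding bounded_iff
    by (metis image_eqI real_norm_def)
  have "integrable lborel (\<lambda>x. indicator (ball x0 R) x * g x)"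
    by (rule integrable_indicator_ball[OF gb, of M]) (use M in auto)
  then have "integrable lebesgue (\<lambda>x. indicator (ball x0 R) x * g x)"
    using gb by (subst integrable_completion) auto
  then show "integrable (lebesgue_on \<Omega>) (\<lambda>x. indicator (ball x0 R) x * g x)"
    using open_domain by (subst integrable_restrict_space) (simp, simp only: eq)
qed

lemma c1_scaled:
  assumes "\<And>x. x \<in> cball x0 R \<Longrightarrow> (f has_derivative (\<lambda>h. G x \<bullet> h)) (at x)" "continuous_on (cball x0 R) G"
  shows "c1_unit_ball (\<lambda>y. f (x0 + R *\<^sub>R y)) (\<lambda>y. R *\<^sub>R G (x0 + R *\<^sub>R y))"
proof
  have m: "x0 + R *\<^sub>R y \<in> cball x0 R" if "y \<in> cball 0 1" for y
    using that R_pos by (auto simp: dist_norm)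
  show "((\<lambda>y. f (x0 + R *\<^sub>R y)) has_derivative (\<lambda>h. (R *\<^sub>R G (x0 + R *\<^sub>R y)) \<bullet> h)) (at y)"
      if "y \<in> cball 0 1" for y
  proof -
    have "((\<lambda>y. f (x0 + R *\<^sub>R y)) has_derivative (\<lambda>h. G (x0 + R *\<^sub>R y) \<bullet> (R *\<^sub>R h))) (at y)"
      by (rule has_derivative_compose[where g=f and f="\<lambda>y. x0 + R *\<^sub>R y", OF _ assms(1)[OF m[OF that]]])
        (auto intro!: derivative_eq_intros)
    then show ?thesis by simp
  qed
  show "continuous_on (cball 0 1) (\<lambda>y. R *\<^sub>R G (x0 + R *\<^sub>R y))"
    by (intro continuous_intros continuous_on_compose2[OF assms(2)]) (use m in auto)
qed

lemma gauss_ball: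
  assumes G: "\<And>x. x \<in> cball x0 R \<Longrightarrow> (f has_derivative (\<lambda>h. G x \<bullet> h)) (at x)" "continuous_on (cball x0 R) G"
    and e: "norm e = 1"
  shows "(\<integral>x. indicator (ball x0 R) x * (G x \<bullet> e) \<partial>lebesgue_on \<Omega>) =
    real DIM('a) * R ^ (DIM('a) - 1) *
        (\<integral>y. indicator (ball 0 1) y * (f (x0 + R *\<^sub>R sgn y) * (sgn y \<bullet> e)) \<partial>lborel)"
proof -
  interpret u: c1_unit_ball "\<lambda>y. f (x0 + R *\<^sub>R y)" "\<lambda>y. R *\<^sub>R G (x0 + R *\<^sub>R y)" by (rule c1_scaled[OF G])
  have "(\<integral>x. indicator (ball x0 R) x * (G x \<bullet> e) \<partial>lebesgue_on \<Omega>) =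
     R ^ DIM('a) * (\<integral>y. indicator (ball 0 1) y * (G (x0 + R *\<^sub>R y) \<bullet> e) \<partial>lborel)"
    by (intro integral_over_ball continuous_intros G)
  \<comment> \<open>One factor \<open>R\<close> of the volume scaling is used up by the gradient of
    the rescaled function, which leaves the power proper to surface measure.\<close>
  also have "\<dots> = R ^ (DIM('a) - 1) * (\<integral>y. indicator (ball 0 1) y * ((R *\<^sub>R G (x0 + R *\<^sub>R y)) \<bullet> e)
      \<partial>lborel)"
  proof -
    have "(\<integral>y. indicator (ball 0 1) y * ((R *\<^sub>R G (x0 + R *\<^sub>R y)) \<bullet> e) \<partial>lborel) =
        R * (\<integral>y. indicator (ball 0 1) y * (G (x0 + R *\<^sub>R y) \<bullet> e) \<partial>lborel)"
      by (subst integral_mult_right_zero[symmetric]) (simp add: mult_ac)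
    moreover have "R ^ DIM('a) = R ^ (DIM('a) - 1) * R" by (simp add: power_eq_if)
    ultimately show ?thesis by simp
  qed
  finally show ?thesis using u.gauss_unit_ball[OF e] by simp
qed

text \<open>Here \<open>x - x0 = R y\<close> supplies the factor \<open>R\<close> that the rescaled
  gradient needs, so the full power \<open>R ^ DIM('a)\<close> remains.\<close>

lemma radial_ball:
  assumes G: "\<And>x. x \<in> cball x0 R \<Longrightarrow> (f has_derivative (\<lambda>h. G x \<bullet> h)) (at x)" "continuous_on (cball x0 R) G"
  shows "(\<integral>x. indicator (ball x0 R) x * ((x - x0) \<bullet> G x) \<partial>lebesgue_on \<Omega>) =
    real DIM('a) * R ^ DIM('a) * ((\<integral>y. indicator (ball 0 1) y * f (x0 + R *\<^sub>R sgn y) \<partial>lborel)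
      - (\<integral>y. indicator (ball 0 1) y * f (x0 + R *\<^sub>R y) \<partial>lborel))"
proof -
  interpret u: c1_unit_ball "\<lambda>y. f (x0 + R *\<^sub>R y)" "\<lambda>y. R *\<^sub>R G (x0 + R *\<^sub>R y)" by (rule c1_scaled[OF G])
  have "(\<integral>x. indicator (ball x0 R) x * ((x - x0) \<bullet> G x) \<partial>lebesgue_on \<Omega>) =
     R ^ DIM('a) * (\<integral>y. indicator (ball 0 1) y * ((x0 + R *\<^sub>R y - x0) \<bullet> G (x0 + R *\<^sub>R y)) \<partial>lborel)"
    by (intro integral_over_ball continuous_intros G)
  also have "\<dots> = R ^ DIM('a) * (\<integral>y. indicator (ball 0 1) y * (y \<bullet> (R *\<^sub>R G (x0 + R *\<^sub>R y))) \<partial>lborel)"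
    by simp
  also have "(\<integral>y. indicator (ball 0 1) y * (y \<bullet> (R *\<^sub>R G (x0 + R *\<^sub>R y))) \<partial>lborel) =
      real DIM('a) * ((\<integral>y. indicator (ball 0 1) y * f (x0 + R *\<^sub>R sgn y) \<partial>lborel)
      - (\<integral>y. indicator (ball 0 1) y * f (x0 + R *\<^sub>R y) \<partial>lborel))"
    using u.gauss_radial by (simp only: right_diff_distrib)
  finally show ?thesis by (simp only: mult_ac)
qed

end

lemma grad_zero_off_supp:
  assumes "x \<notin> supp f" shows "grad f x = 0"
proof -
  have "((\<lambda>_. 0) has_derivative (\<lambda>h. 0 \<bullet> h)) (at x)" by simp
  then have "(f has_derivative (\<lambda>h. 0 \<bullet> h)) (at x)"
    by (rule has_derivative_transform_within_open[where s="- supp f"])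
      (use assms closure_subset[of "{x. f x \<noteq> 0}"] in \<open>auto simp: supp_def\<close>)
  then show ?thesis by (rule grad_unique)
qed

lemma zero_off_supp: "x \<notin> supp f \<Longrightarrow> f x = 0"
  using closure_subset[of "{x. f x \<noteq> 0}"] by (auto simp: supp_def)

text \<open>Apply the divergence theorem on a large ball around the support: the test function is
  zero on its sphere, so there is no flux.\<close>

lemma integral_partial_Cc_inf:
  fixes U :: "'a::euclidean_space set"
  assumes U: "open U" and f: "f \<in> Cc_inf U" and e: "e \<in> Basis"
  shows "integrable (lebesgue_on U) (partial_deriv e f)" "(\<integral>x. partial_deriv e f x \<partial>lebesgue_on U) = 0"
proof -
  have sm: "smooth f" and comp: "compact (supp f)" and sub: "supp f \<subseteq> U" using f
    by (auto simp: Cc_inf_def)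
  obtain r where r: "0 < r" "supp f \<subseteq> ball 0 r"
    using compact_imp_bounded[OF comp] bounded_subset_ballD[of "supp f" 0] by blast
  \<comment> \<open>The auxiliary domain is the whole space, since the large ball need not fit into
    \<open>U\<close>.\<close>
  interpret b: ball_domain "UNIV :: 'a set" 0 r by unfold_locales (use r in auto)
  let ?g = "\<lambda>x. indicator (ball 0 r) x * (grad f x \<bullet> e)"
  have eq: "indicator U x *\<^sub>R partial_deriv e f x = ?g x" for x
    using grad_zero_off_supp[of x f] r sub
      by (cases "x \<in> supp f") (auto simp: partial_deriv_eq_grad[OF e] subset_iff indicator_def)
  have cont: "continuous_on (cball 0 r) (grad f)"
    using smooth_has_derivative(2)[OF sm] continuous_on_subset by blast
  have "integrable (lebesgue_on UNIV) ?g"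
    by (intro b.integral_over_ball(2) continuous_intros cont)
  then show "integrable (lebesgue_on U) (partial_deriv e f)"
    using U by (subst integrable_restrict_space) (simp, simp only: eq lebesgue_on_UNIV_eq)
  have "(\<integral>x. partial_deriv e f x \<partial>lebesgue_on U) = (\<integral>x. ?g x \<partial>lebesgue)"
    using U by (subst integral_restrict_space) (simp, simp only: eq)
  also have "\<dots> = (\<integral>x. ?g x \<partial>lebesgue_on UNIV)" by (simp only: lebesgue_on_UNIV_eq)
  also have "\<dots> = real DIM('a) * r ^ (DIM('a) - 1) *
      (\<integral>y. indicator (ball 0 1) y * (f (0 + r *\<^sub>R sgn y) * (sgn y \<bullet> e)) \<partial>lborel)"
    by (rule b.gauss_ball[OF smooth_has_derivative(1)[OF sm] cont]) (use e in auto)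
  also have "(\<integral>y. indicator (ball 0 1) y * (f (0 + r *\<^sub>R sgn y) * (sgn y \<bullet> e)) \<partial>lborel) = 0"
  proof (rule integral_eq_zero_AE, rule AE_mp[OF AE_lborel_neq[of 0]], rule AE_I2, rule impI)
    fix y :: 'a assume "y \<noteq> 0"
    then have "r *\<^sub>R sgn y \<notin> supp f" using r by (auto simp: norm_sgn subset_iff)
    then show "indicator (ball 0 1) y * (f (0 + r *\<^sub>R sgn y) * (sgn y \<bullet> e)) = 0"
      by (simp add: zero_off_supp)
  qed
  finally show "(\<integral>x. partial_deriv e f x \<partial>lebesgue_on U) = 0" by simp
qed

context ball_domain begin

text \<open>Both parts carry the same constant. The field \<open>a (x - x0)\<close> has normal
  component \<open>a R\<close> on the sphere, whose area factor is \<open>N R^(N-1)\<close>, and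
  divergence \<open>a N\<close> on the ball, whose volume factor is \<open>R^N\<close>. That the two
  masses agree reflects conservation of mass.\<close>

lemma sm_int_radial:
  assumes G: "\<And>x. x \<in> cball x0 R \<Longrightarrow> (f has_derivative (\<lambda>h. G x \<bullet> h)) (at x)" "continuous_on (cball x0 R) G"
    and f: "f \<in> borel_measurable (restrict_space borel \<Omega>)" and a: "0 \<le> a"
  defines "\<kappa> \<equiv> a * real DIM('a) * R ^ DIM('a)"
  shows "sm_int (push \<Omega> x0 R (\<lambda>_. \<kappa>) sgn, push \<Omega> x0 R (\<lambda>_. \<kappa>) (\<lambda>y. y)) f =
    a * (\<integral>x. indicator (ball x0 R) x * ((x - x0) \<bullet> G x) \<partial>lebesgue_on \<Omega>)"
proof -
  have k: "0 \<le> \<kappa>" using a R_pos by (simp add: \<kappa>_def)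
  have *: "(\<integral>x. f x \<partial>push \<Omega> x0 R (\<lambda>_. \<kappa>) p) =
      \<kappa> * (\<integral>y. indicator (ball 0 1) y * f (x0 + R *\<^sub>R p y) \<partial>lborel)"
    if "into_cball p" for p
    using integral_push[OF that weight_const[OF k] f]
    by (simp only: integral_mult_right_zero[symmetric] mult.left_commute)
  have "sm_int (push \<Omega> x0 R (\<lambda>_. \<kappa>) sgn, push \<Omega> x0 R (\<lambda>_. \<kappa>) (\<lambda>y. y)) f =
    \<kappa> * ((\<integral>y. indicator (ball 0 1) y * f (x0 + R *\<^sub>R sgn y) \<partial>lborel)
      - (\<integral>y. indicator (ball 0 1) y * f (x0 + R *\<^sub>R y) \<partial>lborel))"
    by (simp only: sm_int_def fst_conv snd_conv *[OF into_cball_sgn] *[OF into_cball_ident]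
        right_diff_distrib)
  then show ?thesis by (simp only: radial_ball[OF G] \<kappa>_def mult.assoc)
qed

text \<open>Smoothness of the test function is asked on the closed ball only, and its behaviour at
  the boundary of \<open>\<Omega>\<close> is left free. So one identity serves the distributional
  divergence as well as the normal trace.\<close>

lemma divergence_radial:
  assumes z: "\<And>x. z x = indicator (ball x0 R) x *\<^sub>R (- (a *\<^sub>R (x - x0)))" and a: "0 \<le> a"
    and f: "continuous_on \<Omega> f" "\<And>x. x \<in> cball x0 R \<Longrightarrow> f differentiable (at x)"
        "continuous_on (cball x0 R) (grad f)"
  defines "\<kappa> \<equiv> a * real DIM('a) * R ^ DIM('a)"
  shows "sm_int (push \<Omega> x0 R (\<lambda>_. \<kappa>) sgn, push \<Omega> x0 R (\<lambda>_. \<kappa>) (\<lambda>y. y)) f =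
    - (\<integral>x. z x \<bullet> grad f x \<partial>lebesgue_on \<Omega>)"
proof -
  have "z x \<bullet> grad f x = (- a) * (indicator (ball x0 R) x * ((x - x0) \<bullet> grad f x))" for x
    by (simp add: z)
  then have "(\<integral>x. z x \<bullet> grad f x \<partial>lebesgue_on \<Omega>) =
      (- a) * (\<integral>x. indicator (ball x0 R) x * ((x - x0) \<bullet> grad f x) \<partial>lebesgue_on \<Omega>)"
    by (simp only: integral_mult_right_zero)
  moreover have "sm_int (push \<Omega> x0 R (\<lambda>_. \<kappa>) sgn, push \<Omega> x0 R (\<lambda>_. \<kappa>) (\<lambda>y. y)) f =
      a * (\<integral>x. indicator (ball x0 R) x * ((x - x0) \<bullet> grad f x) \<partial>lebesgue_on \<Omega>)"
    unfolding \<kappa>_def by (rule sm_int_radial[OF differentiable_grad[OF f(2)] f(3)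
        continuous_bounded(1)[OF f(1)] a])
  ultimately show ?thesis by simp
qed

lemma has_divergence_radial:
  assumes z: "\<And>x. z x = indicator (ball x0 R) x *\<^sub>R (- (a *\<^sub>R (x - x0)))" and a: "0 \<le> a"
  defines "\<kappa> \<equiv> a * real DIM('a) * R ^ DIM('a)"
  shows "has_divergence \<Omega> z (push \<Omega> x0 R (\<lambda>_. \<kappa>) sgn, push \<Omega> x0 R (\<lambda>_. \<kappa>) (\<lambda>y. y))"
  unfolding has_divergence_def
proof (intro conjI ballI)
  have k: "0 \<le> \<kappa>" using a R_pos by (simp add: \<kappa>_def)
  show "finite_radon \<Omega> (push \<Omega> x0 R (\<lambda>_. \<kappa>) sgn, push \<Omega> x0 R (\<lambda>_. \<kappa>) (\<lambda>y. y))"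
    using k by (intro push_finite_radon) auto
  fix \<phi> assume "\<phi> \<in> Cc_inf \<Omega>"
  then have sm: "smooth \<phi>" by (simp add: Cc_inf_def)
  show "sm_int (push \<Omega> x0 R (\<lambda>_. \<kappa>) sgn, push \<Omega> x0 R (\<lambda>_. \<kappa>) (\<lambda>y. y)) \<phi> =
      - (\<integral>x. z x \<bullet> grad \<phi> x \<partial>lebesgue_on \<Omega>)"
    unfolding \<kappa>_def
    using smooth_has_derivative[OF sm] smooth_continuous[OF sm]
    by (intro divergence_radial[OF z a]) (auto intro: continuous_on_subset differentiableI)
qed

text \<open>The closed ball misses the boundary of \<open>\<Omega>\<close>, so the divergence
  identity has no boundary term even for functions \<open>v\<close> that do not vanish there; this
  is what trace zero means.\<close>

lemma normal_trace_radial: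
  assumes z: "\<And>x. z x = indicator (ball x0 R) x *\<^sub>R (- (a *\<^sub>R (x - x0)))" and a: "0 \<le> a"
  shows "normal_trace \<Omega> z (\<lambda>_. 0)"
  unfolding normal_trace_def
proof (intro conjI exI ballI)
  show "has_divergence \<Omega> z (push \<Omega> x0 R (\<lambda>_. a * real DIM('a) * R ^ DIM('a)) sgn,
      push \<Omega> x0 R (\<lambda>_. a * real DIM('a) * R ^ DIM('a)) (\<lambda>y. y))"
    by (rule has_divergence_radial[OF z a])
  have "z \<in> borel_measurable borel" unfolding z[abs_def] by measurable
  then have "z \<in> borel_measurable (lebesgue_on \<Omega>)"
    by (simp add: measurable_completion measurable_restrict_space1)
  moreover have "norm (z x) \<le> a * R" for x
    using a R_pos by (cases "x \<in> ball x0 R") (auto simp: z dist_norm norm_minus_commute intro!: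
        mult_left_mono)
  ultimately show "Linf (lebesgue_on \<Omega>) z" by (auto simp: Linf_def intro!: exI[of _ "a * R"])
  show "Linf (surface \<Omega>) (\<lambda>_. 0::real)" by (auto simp: Linf_def intro!: exI[of _ 0])
  fix v assume v: "v \<in> C1_closure \<Omega>"
  then obtain G where G: "continuous_on (closure \<Omega>) G" "\<And>x. x \<in> \<Omega> \<Longrightarrow> G x = grad v x"
    unfolding C1_closure_def by blast
  have "continuous_on \<Omega> G" using G(1) closure_subset by (rule continuous_on_subset)
  then have cg: "continuous_on \<Omega> (grad v)" by (rule continuous_on_eq) (rule G(2))
  have cv: "continuous_on \<Omega> v"
    using v continuous_on_subset[OF _ closure_subset] by (auto simp: C1_closure_def)
  have dv: "v differentiable (at x)" if "x \<in> \<Omega>" for x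
  proof -
    have "v differentiable (at x within \<Omega>)"
      using v that unfolding C1_closure_def differentiable_on_def by blast
    then show ?thesis using at_within_open[OF that open_domain] by simp
  qed
  have "sm_int (push \<Omega> x0 R (\<lambda>_. a * real DIM('a) * R ^ DIM('a)) sgn,
      push \<Omega> x0 R (\<lambda>_. a * real DIM('a) * R ^ DIM('a)) (\<lambda>y. y)) v = - (\<integral>x. z x \<bullet> grad v x \<partial>lebesgue_on \<Omega>)"
    by (rule divergence_radial[OF z a cv _ continuous_on_subset[OF cg cball_sub]])
      (use cball_sub dv in blast)
  then show "sm_int (push \<Omega> x0 R (\<lambda>_. a * real DIM('a) * R ^ DIM('a)) sgn,
      push \<Omega> x0 R (\<lambda>_. a * real DIM('a) * R ^ DIM('a)) (\<lambda>y. y)) v +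
      (\<integral>x. z x \<bullet> grad v x \<partial>lebesgue_on \<Omega>) = (\<integral>x. 0 * v x \<partial>surface \<Omega>)" by simp
qed

text \<open>The difference of the two parts is \<open>- K (\<nu> \<bullet> e)\<close> times the image measure, \<open>\<nu>\<close> being the outer
    normal.\<close>

definition grad_ind :: "real \<Rightarrow> 'a \<Rightarrow> 'a smeasure" where
  "grad_ind K e = (push \<Omega> x0 R (\<lambda>y. K * (1 - sgn y \<bullet> e)) sgn, push \<Omega> x0 R (\<lambda>_. K) sgn)"

lemma inner_sgn_le:
  fixes y e :: 'a assumes "norm e = 1" shows "\<bar>sgn y \<bullet> e\<bar> \<le> 1"
  using Cauchy_Schwarz_ineq2[of "sgn y" e] assms by (auto simp: norm_sgn split: if_splits)

text \<open>The summand 1 makes the density nonnegative, at most \<open>2 K\<close>; the second part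
  of \<open>grad_ind\<close> takes it off again.\<close>

lemma weight_grad_ind:
  fixes e :: 'a
  assumes "e \<in> Basis" "0 \<le> K" shows "weight (\<lambda>y. K * (1 - sgn y \<bullet> e))"
  unfolding weight_def
proof (intro conjI exI ballI)
  fix y :: 'a
  have "\<bar>sgn y \<bullet> e\<bar> \<le> 1" using assms by (intro inner_sgn_le) auto
  then show "0 \<le> K * (1 - sgn y \<bullet> e)" "K * (1 - sgn y \<bullet> e) \<le> K * 2"
    using assms by (auto intro!: mult_left_mono mult_nonneg_nonneg)
qed measurable

lemma sm_int_grad_ind:
  assumes e: "e \<in> Basis" and K: "0 \<le> K" and f: "f \<in> borel_measurable (restrict_space borel \<Omega>)"
    and M: "\<And>x. x \<in> cball x0 R \<Longrightarrow> \<bar>f x\<bar> \<le> M"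
  shows "sm_int (grad_ind K e) f =
      - K * (\<integral>y. indicator (ball 0 1) y * (f (x0 + R *\<^sub>R sgn y) * (sgn y \<bullet> e)) \<partial>lborel)"
proof -
  note w = weight_grad_ind[OF e K] weight_const[OF K]
  have "sm_int (grad_ind K e) f =
    (\<integral>y. indicator (ball 0 1) y * (K * (1 - sgn y \<bullet> e) * f (x0 + R *\<^sub>R sgn y)) - indicator (ball 0 1) y
        * (K * f (x0 + R *\<^sub>R sgn y)) \<partial>lborel)"
    unfolding sm_int_def grad_ind_def fst_conv snd_conv integral_push[OF into_cball_sgn w(1) f]
        integral_push[OF into_cball_sgn w(2) f]
    using integrable_push_base[OF into_cball_sgn w(1) f M]
        integrable_push_base[OF into_cball_sgn w(2) f M]
    by simp
  also have "\<dots> = (\<integral>y. - K * (indicator (ball 0 1) y * (f (x0 + R *\<^sub>R sgn y) * (sgn y \<bullet> e))) \<partial>lborel)"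
    by (intro Bochner_Integration.integral_cong) (auto simp: algebra_simps)
  finally show ?thesis by (simp only: integral_mult_right_zero)
qed

text \<open>The weight is the jump height \<open>k\<close> times the factor \<open>N R^(N-1)\<close>
  of surface measure. The constant \<open>b\<close> has no gradient because partial derivatives of
  test functions integrate to zero; it is carried along for the truncations \<open>max u a\<close>,
  which do not vanish near the boundary.\<close>

lemma distr_gradient_ind:
  assumes k: "0 \<le> k"
  shows "distr_gradient \<Omega> (\<lambda>x. b + k * indicator (ball x0 R) x)
      (grad_ind (k * (real DIM('a) * R ^ (DIM('a) - 1))))"
  unfolding distr_gradient_def
proof (intro ballI conjI)
  let ?K = "k * (real DIM('a) * R ^ (DIM('a) - 1))"
  have K: "0 \<le> ?K" using k R_pos by simp
  fix e :: 'a assume e: "e \<in> Basis"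
  show "finite_radon \<Omega> (grad_ind ?K e)"
    unfolding grad_ind_def using e K by (intro push_finite_radon weight_grad_ind) auto
  fix \<phi> assume phi: "\<phi> \<in> Cc_inf \<Omega>"
  then have sm: "smooth \<phi>" by (simp add: Cc_inf_def)
  have contg: "continuous_on (cball x0 R) (grad \<phi>)" "continuous_on \<Omega> \<phi>"
    using smooth_has_derivative(2)[OF sm] smooth_continuous[OF sm] by (auto intro: continuous_on_subset)
  obtain M where M: "\<And>x. x \<in> cball x0 R \<Longrightarrow> \<bar>\<phi> x\<bar> \<le> M" using continuous_bounded(2)[OF contg(2)] by blast
  have i1: "integrable (lebesgue_on \<Omega>) (partial_deriv e \<phi>)" "(\<integral>x. partial_deriv e \<phi> x \<partial>lebesgue_on \<Omega>) = 0"
    using integral_partial_Cc_inf[OF open_domain phi e] by auto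
  have i2: "integrable (lebesgue_on \<Omega>) (\<lambda>x. indicator (ball x0 R) x * (grad \<phi> x \<bullet> e))"
    by (intro integral_over_ball(2) continuous_intros contg)
  have "(\<integral>x. (b + k * indicator (ball x0 R) x) * partial_deriv e \<phi> x \<partial>lebesgue_on \<Omega>) =
    (\<integral>x. b * partial_deriv e \<phi> x + k * (indicator (ball x0 R) x * (grad \<phi> x \<bullet> e)) \<partial>lebesgue_on \<Omega>)"
    by (intro Bochner_Integration.integral_cong) (auto simp: algebra_simps partial_deriv_eq_grad[OF e])
  also have "\<dots> = k * (\<integral>x. indicator (ball x0 R) x * (grad \<phi> x \<bullet> e) \<partial>lebesgue_on \<Omega>)"
    using i1 i2 by simp
  also have "\<dots> = - sm_int (grad_ind ?K e) \<phi>"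
    using e by (subst gauss_ball[OF smooth_has_derivative(1)[OF sm] contg(1)],
       simp, subst sm_int_grad_ind[OF e K continuous_bounded(1)[OF contg(2)] M]) simp_all
  finally show "(\<integral>x. (b + k * indicator (ball x0 R) x) * partial_deriv e \<phi> x \<partial>lebesgue_on \<Omega>) =
      - sm_int (grad_ind ?K e) \<phi>" .
qed


lemma integrable_indicator_sgn:
  fixes A :: "'a set"
  assumes A: "A \<in> sets borel"
  shows "integrable lborel (\<lambda>y. indicator (ball 0 1) y * (indicator A (x0 + R *\<^sub>R sgn y) * (sgn y \<bullet> v)))"
proof (rule integrable_indicator_ball[where K="norm v"])
  have [measurable]: "A \<in> sets borel" by (rule A)
  show "(\<lambda>y. indicator (ball 0 1) y * (indicator A (x0 + R *\<^sub>R sgn y) * (sgn y \<bullet> v))) \<in> borel_measurable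
      borel"
    by measurable
  fix y :: 'a
  have "\<bar>sgn y \<bullet> v\<bar> \<le> norm (sgn y) * norm v" by (rule Cauchy_Schwarz_ineq2)
  also have "\<dots> \<le> norm v" by (simp add: norm_sgn)
  finally show "\<bar>indicator A (x0 + R *\<^sub>R sgn y) * (sgn y \<bullet> v)\<bar> \<le> norm v" by (simp add: indicator_def)
qed

text \<open>As a vector measure this is \<open>- K\<close> times the outer normal times the image
  under \<open>sgn\<close> of Lebesgue measure, moved to the sphere of radius \<open>R\<close>: the
  gradient of a jump.\<close>

definition vec_grad :: "real \<Rightarrow> 'a set \<Rightarrow> 'a" where
  "vec_grad K A = (\<Sum>e\<in>Basis. sm_val (grad_ind K e) A *\<^sub>R e)"

lemma measure_eq_integral_indicator:
  "A \<subseteq> \<Omega> \<Longrightarrow> measure (push \<Omega> x0 R k p) A = (\<integral>x. indicator A x \<partial>push \<Omega> x0 R k p)"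
  by (simp add: Int_absorb2)

lemma inner_vec_grad:
  assumes A: "A \<in> sets borel" "A \<subseteq> \<Omega>" and K: "0 \<le> K"
  shows "vec_grad K A \<bullet> v = -
      K * (\<integral>y. indicator (ball 0 1) y * (indicator A (x0 + R *\<^sub>R sgn y) * (sgn y \<bullet> v)) \<partial>lborel)"
proof -
  let ?i = "\<lambda>v y. indicator (ball 0 1) y * (indicator A (x0 + R *\<^sub>R sgn y) * (sgn y \<bullet> v)) :: real"
  have ind: "(indicator A :: 'a \<Rightarrow> real) \<in> borel_measurable (restrict_space borel \<Omega>)"
    using A sets_domain by (intro borel_measurable_indicator) auto
  have val: "sm_val (grad_ind K e) A = - K * (\<integral>y. ?i e y \<partial>lborel)" if e: "e \<in> Basis" for e
  proof -
    have "sm_val (grad_ind K e) A = sm_int (grad_ind K e) (indicator A)"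
      by (simp only: sm_val_def sm_int_def grad_ind_def fst_conv snd_conv
          measure_eq_integral_indicator[OF A(2)])
    then show ?thesis using sm_int_grad_ind[OF e K ind, of 1] by simp
  qed
  have "vec_grad K A \<bullet> v = (\<Sum>e\<in>Basis. - K * (\<integral>y. ?i e y \<partial>lborel) * (e \<bullet> v))"
    by (simp add: vec_grad_def inner_sum_left val)
  also have "\<dots> = - K * (\<Sum>e\<in>Basis. (\<integral>y. ?i e y * (e \<bullet> v) \<partial>lborel))"
    by (simp add: sum_distrib_left mult_ac sum_negf)
  also have "(\<Sum>e\<in>Basis. (\<integral>y. ?i e y * (e \<bullet> v) \<partial>lborel)) = (\<integral>y. (\<Sum>e\<in>Basis. ?i e y * (e \<bullet> v)) \<partial>lborel)"
    using integrable_indicator_sgn[OF A(1)] by (subst Bochner_Integration.integral_sum) auto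
  also have "\<dots> = (\<integral>y. ?i v y \<partial>lborel)"
  proof (rule Bochner_Integration.integral_cong[OF refl])
    fix y
    have "(\<Sum>e\<in>Basis. ?i e y * (e \<bullet> v)) =
        indicator (ball 0 1) y * (indicator A (x0 + R *\<^sub>R sgn y) * (\<Sum>e\<in>Basis. (sgn y \<bullet> e) * (v \<bullet> e)))"
      by (simp add: sum_distrib_left mult_ac inner_commute)
    then show "(\<Sum>e\<in>Basis. ?i e y * (e \<bullet> v)) = ?i v y" by (simp only: euclidean_inner[symmetric])
  qed
  finally show ?thesis .
qed

lemma measure_sphere_push:
  assumes A: "A \<in> sets borel" "A \<subseteq> \<Omega>" and K: "0 \<le> K"
  shows "measure (push \<Omega> x0 R (\<lambda>_. K) sgn) A =
      K * (\<integral>y. indicator (ball 0 1) y * indicator A (x0 + R *\<^sub>R sgn y) \<partial>lborel)"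
    and "integrable lborel (\<lambda>y. indicator (ball 0 1) y * indicator A (x0 + R *\<^sub>R sgn y) :: real)"
proof -
  have "measure (push \<Omega> x0 R (\<lambda>_. K) sgn) A =
      (\<integral>y. indicator (ball 0 1) y * (K * indicator A (x0 + R *\<^sub>R sgn y)) \<partial>lborel)"
    using A K sets_domain by (intro measure_push) auto
  also have "\<dots> = (\<integral>y. K * (indicator (ball 0 1) y * indicator A (x0 + R *\<^sub>R sgn y)) \<partial>lborel)"
    by (simp only: mult.left_commute)
  finally show "measure (push \<Omega> x0 R (\<lambda>_. K) sgn) A =
      K * (\<integral>y. indicator (ball 0 1) y * indicator A (x0 + R *\<^sub>R sgn y) \<partial>lborel)"
    by (simp only: integral_mult_right_zero)
  have [measurable]: "A \<in> sets borel" by (rule A(1))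
  show "integrable lborel (\<lambda>y. indicator (ball 0 1) y * indicator A (x0 + R *\<^sub>R sgn y) :: real)"
  proof (rule integrable_indicator_ball[where K=1])
    show "(\<lambda>y. indicator (ball 0 1) y * indicator A (x0 + R *\<^sub>R sgn y) :: real) \<in> borel_measurable borel"
      by measurable
  qed (simp add: indicator_def)
qed

text \<open>Pair the vector with its own direction: a unit vector has inner product at most 1 with
  every normal.\<close>

lemma norm_vec_grad_le:
  assumes A: "A \<in> sets borel" "A \<subseteq> \<Omega>" and K: "0 \<le> K"
  shows "norm (vec_grad K A) \<le> measure (push \<Omega> x0 R (\<lambda>_. K) sgn) A"
proof -
  let ?u = "sgn (vec_grad K A)"
  have "norm (vec_grad K A) = vec_grad K A \<bullet> ?u"
    by (cases "vec_grad K A = 0") (simp_all add: sgn_div_norm dot_square_norm power2_eq_square)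
  also have "\<dots> = K * (\<integral>y. indicator (ball 0 1) y * (indicator A (x0 + R *\<^sub>R sgn y) * (sgn y \<bullet> - ?u))
      \<partial>lborel)"
    unfolding inner_vec_grad[OF A K] by simp
  also have "\<dots> \<le> K * (\<integral>y. indicator (ball 0 1) y * indicator A (x0 + R *\<^sub>R sgn y) \<partial>lborel)"
  proof (rule mult_left_mono[OF Bochner_Integration.integral_mono[OF integrable_indicator_sgn[OF A(1)]
      measure_sphere_push(2)[OF A K]] K])
    fix y :: 'a
    have "\<bar>sgn y \<bullet> - ?u\<bar> \<le> norm (sgn y) * norm (- ?u)" by (rule Cauchy_Schwarz_ineq2)
    also have "\<dots> \<le> 1" by (simp add: norm_sgn)
    finally show "indicator (ball 0 1) y * (indicator A (x0 + R *\<^sub>R sgn y) * (sgn y \<bullet> - ?u)) \<le>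
        indicator (ball 0 1) y * indicator A (x0 + R *\<^sub>R sgn y)"
      by (auto simp: indicator_def)
  qed
  finally show ?thesis using measure_sphere_push(1)[OF A K] by simp
qed

text \<open>Pair with \<open>- p\<close>: where the normals differ from \<open>p\<close> by at most
  \<open>\<delta>\<close>, their inner product with \<open>p\<close> is at least
  \<open>1 - \<delta>\<close>.\<close>

lemma norm_vec_grad_ge:
  assumes A: "A \<in> sets borel" "A \<subseteq> \<Omega>" and K: "0 \<le> K" and p: "norm p = 1"
    and near: "\<And>y. y \<noteq> 0 \<Longrightarrow> x0 + R *\<^sub>R sgn y \<in> A \<Longrightarrow> norm (sgn y - p) \<le> \<delta>"
  shows "(1 - \<delta>) * measure (push \<Omega> x0 R (\<lambda>_. K) sgn) A \<le> norm (vec_grad K A)"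
proof -
  have "(1 - \<delta>) * measure (push \<Omega> x0 R (\<lambda>_. K) sgn) A =
      K * (\<integral>y. (1 - \<delta>) * (indicator (ball 0 1) y * indicator A (x0 + R *\<^sub>R sgn y)) \<partial>lborel)"
    using measure_sphere_push(1)[OF A K] by simp
  also have "\<dots> \<le> K * (\<integral>y. indicator (ball 0 1) y * (indicator A (x0 + R *\<^sub>R sgn y) * (sgn y \<bullet> p))
      \<partial>lborel)"
  proof (intro mult_left_mono integral_mono_AE integrable_indicator_sgn A K)
    show "integrable lborel (\<lambda>y. (1 - \<delta>) * (indicator (ball 0 1) y * indicator A (x0 + R *\<^sub>R sgn y)))"
      using measure_sphere_push(2)[OF A K] by simp
    show "AE y in lborel. (1 - \<delta>) * (indicator (ball 0 1) y * indicator A (x0 + R *\<^sub>R sgn y))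
        \<le> indicator (ball 0 1) y * (indicator A (x0 + R *\<^sub>R sgn y) * (sgn y \<bullet> p))"
      using AE_lborel_neq[of "0::'a"]
    proof eventually_elim
      case (elim y)
      show ?case
      proof (cases "x0 + R *\<^sub>R sgn y \<in> A")
        case True
        have "\<bar>(sgn y - p) \<bullet> p\<bar> \<le> norm (sgn y - p) * norm p" by (rule Cauchy_Schwarz_ineq2)
        also have "\<dots> \<le> \<delta>" using near[OF elim True] p by simp
        finally have "1 - \<delta> \<le> sgn y \<bullet> p" using p by (simp add: inner_diff_left dot_square_norm)
        then show ?thesis using True by (auto simp: indicator_def)
      qed simp
    qed
  qed
  also have "\<dots> = - (vec_grad K A \<bullet> p)" unfolding inner_vec_grad[OF A K] by simp
  also have "\<dots> \<le> norm (vec_grad K A)"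
    using Cauchy_Schwarz_ineq2[of "vec_grad K A" p] p by simp
  finally show ?thesis .
qed

text \<open>On a piece of the sphere where the normal is nearly constant the vector measure has almost the
  full mass; cut the sphere into finitely many such pieces.\<close>

lemma tot_var_vec_grad:
  assumes A: "A \<in> sets borel" "A \<subseteq> \<Omega>" and K: "0 \<le> K"
  shows "tot_var (vec_grad K) A = emeasure (push \<Omega> x0 R (\<lambda>_. K) sgn) A"
proof -
  let ?M = "push \<Omega> x0 R (\<lambda>_. K) sgn"
  interpret M: finite_measure ?M using K by (intro finite_push) auto
  show ?thesis
  proof (rule antisym)
    show "tot_var (vec_grad K) A \<le> emeasure ?M A"
      unfolding tot_var_def
    proof (rule SUP_least, clarify)
      fix P assume P: "finite P" "disjoint P" "P \<subseteq> sets borel" "\<Union>P \<subseteq> A"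
      have sub: "B \<in> sets borel \<and> B \<subseteq> \<Omega>" if "B \<in> P" for B using that P A by blast
      have "(\<Sum>B\<in>P. norm (vec_grad K B)) \<le> (\<Sum>B\<in>P. measure ?M B)"
        using sub K by (intro sum_mono norm_vec_grad_le) auto
      also have "\<dots> = measure ?M (\<Union>B\<in>P. B)"
        using P sub by (intro M.finite_measure_finite_Union[symmetric])
          (auto simp: sets_domain disjoint_family_on_def disjoint_def)
      also have "\<dots> \<le> measure ?M A"
        using P A by (intro M.finite_measure_mono) (auto simp: sets_domain)
      finally have "ennreal (\<Sum>B\<in>P. norm (vec_grad K B)) \<le> ennreal (measure ?M A)" by (rule ennreal_leI)
      then show "(\<Sum>B\<in>P. ennreal (norm (vec_grad K B))) \<le> emeasure ?M A"
        by (simp add: M.emeasure_eq_measure)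
    qed
  next
    have key: "ennreal ((1 - \<delta>) * measure ?M A) \<le> tot_var (vec_grad K) A" if d: "0 < \<delta>" for \<delta>
    proof -
      have "seq_compact (sphere 0 1 :: 'a set)" by (intro compact_imp_seq_compact) simp
      from seq_compact_imp_totally_bounded[OF this, rule_format, OF d]
      obtain k where k: "finite k" "k \<subseteq> sphere 0 1" "sphere 0 (1::real) \<subseteq> (\<Union>x::'a\<in>k. ball x \<delta>)"
        by (elim exE conjE)
      obtain n and p :: "nat \<Rightarrow> 'a" where p: "k = p ` {i. i < n}"
        using finite_imp_nat_seg_image_inj_on[OF k(1)] by blast
      \<comment> \<open>The cap around \<open>p i\<close> is taken as an open set of space, a small
        ball around \<open>x0 + R p i\<close>, so that the pieces are Borel.\<close>
      define C where "C i = {x. inverse R *\<^sub>R (x - x0) \<in> ball (p i) \<delta>}" for i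
      have "open (C i)" for i
      proof -
        have "C i = (\<lambda>x. inverse R *\<^sub>R (x - x0)) -` ball (p i) \<delta>" by (auto simp: C_def)
        then show ?thesis by (auto intro!: open_vimage continuous_intros)
      qed
      define D where "D i = A \<inter> disjointed C i" for i
      have disjD: "disjoint_family D"
        using disjoint_family_disjointed[of C] unfolding D_def disjoint_family_on_def by blast
      have "range (disjointed C) \<subseteq> sets borel"
        using \<open>\<And>i. open (C i)\<close> by (intro sets.range_disjointed_sets) auto
      then have dC: "disjointed C i \<in> sets borel" for i by blast
      have Dsets: "D i \<in> sets borel" "D i \<subseteq> \<Omega>" "D i \<subseteq> A" for i
        using A dC[of i] by (auto simp: D_def)
      have pn: "norm (p i) = 1" if "i < n" for i using k(2) p that by auto
      have Dnear: "norm (sgn y - p i) \<le> \<delta>" if "x0 + R *\<^sub>R sgn y \<in> D i" for y i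
        using that disjointed_subset[of C i] R_pos
          by (auto simp: D_def C_def dist_norm norm_minus_commute)
      have cover: "measure ?M A = (\<Sum>i<n. measure ?M (D i))"
      proof -
        have "measure ?M (\<Union>i<n. D i) = (\<Sum>i<n. measure ?M (D i))"
          using Dsets disjD by (intro M.finite_measure_finite_Union)
              (auto simp: sets_domain disjoint_family_on_def)
        moreover have "measure ?M (\<Union>i<n. D i) = measure ?M A"
        proof -
          have U: "(\<Union>i<n. D i) \<in> sets borel" "(\<Union>i<n. D i) \<subseteq> \<Omega>" using Dsets by auto
          have "(\<integral>y. indicator (ball 0 1) y * indicator (\<Union>i<n. D i) (x0 + R *\<^sub>R sgn y) \<partial>lborel) =
              (\<integral>y. indicator (ball 0 1) y * indicator A (x0 + R *\<^sub>R sgn y) \<partial>lborel :: real)"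
          proof (rule integral_cong_AE)
            show "AE y in lborel. indicator (ball 0 1) y * indicator (\<Union>i<n. D i) (x0 + R *\<^sub>R sgn y) =
                (indicator (ball 0 1) y * indicator A (x0 + R *\<^sub>R sgn y) :: real)"
              using AE_lborel_neq[of "0::'a"]
            proof eventually_elim
              case (elim y)
              then have "sgn y \<in> sphere 0 1" by (simp add: norm_sgn)
              then obtain i where i: "i < n" "sgn y \<in> ball (p i) \<delta>" using k(3) unfolding p by blast
              then have "x0 + R *\<^sub>R sgn y \<in> (\<Union>i\<in>{0..<n}. C i)" using R_pos by (auto simp: C_def)
              then have "x0 + R *\<^sub>R sgn y \<in> (\<Union>i\<in>{0..<n}. disjointed C i)"
                using finite_UN_disjointed_eq[of C n] by blast
              then have "x0 + R *\<^sub>R sgn y \<in> (\<Union>i<n. D i) \<longleftrightarrow> x0 + R *\<^sub>R sgn y \<in> A"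
                by (auto simp: D_def)
              then show ?case by (simp add: indicator_def)
            qed
          qed (use measure_sphere_push(2)[OF U K] measure_sphere_push(2)[OF A K] in auto)
          then show ?thesis using measure_sphere_push(1)[OF U K] measure_sphere_push(1)[OF A K] by simp
        qed
        ultimately show ?thesis by simp
      qed
      have "(1 - \<delta>) * measure ?M A = (\<Sum>i<n. (1 - \<delta>) * measure ?M (D i))"
        unfolding cover by (simp add: sum_distrib_left)
      also have "\<dots> \<le> (\<Sum>i<n. norm (vec_grad K (D i)))"
        using Dsets K pn Dnear by (intro sum_mono norm_vec_grad_ge) auto
      \<comment> \<open>The variation is a supremum over sets of sets, not over indexed families.
        Two indices with the same piece share the empty piece, which contributes 0.\<close>
      also have "\<dots> = (\<Sum>B\<in>D ` {..<n}. norm (vec_grad K B))"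
      proof (rule sum.reindex_nontrivial[symmetric, unfolded o_def])
        fix i j assume ij: "i \<in> {..<n}" "j \<in> {..<n}" "i \<noteq> j" "D i = D j"
        then have "D i = {}" using disjD unfolding disjoint_family_on_def by (metis Int_absorb UNIV_I)
        moreover have "vec_grad K {} = 0" by (simp add: vec_grad_def sm_val_def)
        ultimately show "norm (vec_grad K (D i)) = 0" by simp
      qed simp
      finally have "ennreal ((1 - \<delta>) * measure ?M A) \<le> ennreal (\<Sum>B\<in>D ` {..<n}. norm (vec_grad K B))"
        by (rule ennreal_leI)
      also have "\<dots> = (\<Sum>B\<in>D ` {..<n}. ennreal (norm (vec_grad K B)))" by simp
      also have "\<dots> \<le> tot_var (vec_grad K) A"
        unfolding tot_var_def
      proof (rule SUP_upper, clarify, intro conjI)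
        show "disjoint (D ` {..<n})"
          using disjD unfolding disjoint_def disjoint_family_on_def by (metis UNIV_I imageE)
        show "\<Union> (D ` {..<n}) \<subseteq> A" using Dsets(3) by blast
      qed (use Dsets in auto)
      finally show ?thesis .
    qed
    show "emeasure ?M A \<le> tot_var (vec_grad K) A"
    proof (cases "tot_var (vec_grad K) A = \<infinity>")
      case False
      then obtain t where t: "tot_var (vec_grad K) A = ennreal t" "0 \<le> t"
        by (cases "tot_var (vec_grad K) A") auto
      have "measure ?M A \<le> t + e" if e: "0 < e" for e
      proof -
        define m where "m = measure ?M A"
        have m: "0 \<le> m" by (simp add: m_def)
        \<comment> \<open>With \<open>\<delta> = e / (m + 1)\<close> the loss
          \<open>\<delta> * m\<close> is at most \<open>e\<close>, also when the mass
          \<open>m\<close> is 0.\<close>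
        have "(1 - e / (m + 1)) * m \<le> t"
          using key[of "e / (m + 1)"] e m t unfolding m_def[symmetric] by (simp add: ennreal_le_iff)
        moreover have "e / (m + 1) * m \<le> e" using e m by (simp add: divide_simps)
        ultimately show ?thesis unfolding m_def[symmetric] by (simp add: algebra_simps)
      qed
      then have "measure ?M A \<le> t" by (rule field_le_epsilon)
      then show ?thesis using t by (simp add: M.emeasure_eq_measure)
    qed simp
  qed
qed

lemma tot_var_measure_vec_grad:
  assumes K: "0 \<le> K"
  shows "tot_var_measure \<Omega> (vec_grad K) = push \<Omega> x0 R (\<lambda>_. K) sgn"
proof -
  have "tot_var_measure \<Omega> (vec_grad K) =
      measure_of \<Omega> (sets (restrict_space borel \<Omega>)) (emeasure (push \<Omega> x0 R (\<lambda>_. K) sgn))"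
    unfolding tot_var_measure_def
  proof (rule measure_of_eq)
    show "sets (restrict_space borel \<Omega>) \<subseteq> Pow \<Omega>" using sets_domain by auto
    fix A assume "A \<in> sigma_sets \<Omega> (sets (restrict_space borel \<Omega>))"
    then have "A \<in> sets (restrict_space borel \<Omega>)"
      using sets.sigma_sets_eq[of "restrict_space borel \<Omega>"] by (simp add: space_restrict_space)
    then show "tot_var (vec_grad K) A = emeasure (push \<Omega> x0 R (\<lambda>_. K) sgn) A"
      using K sets_domain by (intro tot_var_vec_grad) auto
  qed
  also have "\<dots> = push \<Omega> x0 R (\<lambda>_. K) sgn"
    using measure_of_of_measure[of "push \<Omega> x0 R (\<lambda>_. K) sgn"] by simp
  finally show ?thesis .
qed

lemma is_abs_gradient_ind:
  assumes bd: "bounded \<Omega>" and k: "0 \<le> k"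
  shows "is_abs_gradient \<Omega> (\<lambda>x. b + k * indicator (ball x0 R) x)
      (push \<Omega> x0 R (\<lambda>_. k * (real DIM('a) * R ^ (DIM('a) - 1))) sgn)"
proof -
  have fin: "finite_measure (lebesgue_on \<Omega>)"
    using bounded_set_imp_lmeasurable[OF bd] open_domain by (intro finite_measure_lebesgue_on) auto
  have "integrable (lebesgue_on \<Omega>) (\<lambda>x. b + k * indicator (ball x0 R) x)"
  proof (rule finite_measure.integrable_const_bound[OF fin])
    show "AE x in lebesgue_on \<Omega>. norm (b + k * indicator (ball x0 R) x) \<le> \<bar>b\<bar> + k"
      using k by (intro AE_I2) (auto simp: indicator_def)
    have "(\<lambda>x. b + k * indicator (ball x0 R) x) \<in> borel_measurable borel" by measurable
    then show "(\<lambda>x. b + k * indicator (ball x0 R) x) \<in> borel_measurable (lebesgue_on \<Omega>)"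
      by (simp add: measurable_completion measurable_restrict_space1)
  qed
  moreover note distr_gradient_ind[OF k, of b]
  moreover have "push \<Omega> x0 R (\<lambda>_. k * (real DIM('a) * R ^ (DIM('a) - 1))) sgn =
      tot_var_measure \<Omega> (vec_grad (k * (real DIM('a) * R ^ (DIM('a) - 1))))"
    using k R_pos by (intro tot_var_measure_vec_grad[symmetric]) auto
  ultimately show ?thesis
    unfolding is_abs_gradient_def BV_def vec_grad_def[abs_def] by blast
qed


text \<open>The positive part lives on the sphere and the negative part on the open ball. These sets
  are disjoint, so nothing cancels: the variation is the sum of the two masses, attained by the
  partition into ball and sphere.\<close>

lemma tot_var_divergence:
  assumes k: "0 \<le> \<kappa>"
  shows "tot_var (sm_val (push \<Omega> x0 R (\<lambda>_. \<kappa>) sgn, push \<Omega> x0 R (\<lambda>_. \<kappa>) (\<lambda>y. y))) \<Omega> =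
    ennreal (2 * \<kappa> * measure lborel (ball (0::'a) 1))"
proof -
  let ?V = "measure lborel (ball (0::'a) 1)"
  let ?M = "\<lambda>p. push \<Omega> x0 R (\<lambda>_. \<kappa>) p"
  let ?\<nu> = "sm_val (?M sgn, ?M (\<lambda>y. y))"
  interpret S: finite_measure "?M sgn" using k by (intro finite_push) auto
  interpret I: finite_measure "?M (\<lambda>y. y)" using k by (intro finite_push) auto
  have full: "measure (?M p) A = \<kappa> * ?V" if p: "into_cball p" and A: "A \<in> sets borel" "A \<subseteq> \<Omega>"
    and "\<And>y. y \<noteq> 0 \<Longrightarrow> y \<in> ball 0 1 \<Longrightarrow> x0 + R *\<^sub>R p y \<in> A" for p A
  proof -
    have "measure (?M p) A = (\<integral>y. indicator (ball 0 1) y * (\<kappa> * indicator A (x0 + R *\<^sub>R p y)) \<partial>lborel)"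
      using that k sets_domain by (intro measure_push) auto
    also have "\<dots> = (\<integral>y. \<kappa> * indicator (ball 0 1) y \<partial>(lborel :: 'a measure))"
    proof (rule integral_cong_AE)
      have [measurable]: "p \<in> borel_measurable borel" "A \<in> sets borel" using that
        by (auto simp: into_cball_def)
      show "(\<lambda>y. indicator (ball 0 1) y * (\<kappa> * indicator A (x0 + R *\<^sub>R p y))) \<in> borel_measurable lborel"
        by measurable
      show "AE y in lborel. indicator (ball 0 1) y * (\<kappa> * indicator A (x0 + R *\<^sub>R p y)) =
          \<kappa> * indicator (ball 0 1) y"
        using AE_lborel_neq[of "0::'a"] by eventually_elim (use that in \<open>auto simp: indicator_def\<close>)
    qed measurable
    finally show ?thesis by simp
  qed
  have masses: "measure (?M sgn) \<Omega> = \<kappa> * ?V" "measure (?M (\<lambda>y. y)) \<Omega> = \<kappa> * ?V"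
    "measure (?M sgn) (sphere x0 R) = \<kappa> * ?V" "measure (?M (\<lambda>y. y)) (ball x0 R) = \<kappa> * ?V"
  proof -
    have sph: "sphere x0 R \<subseteq> \<Omega>" using cball_sub sphere_cball by blast
    have "x0 + R *\<^sub>R sgn y \<in> sphere x0 R" if "y \<noteq> 0" for y using that R_pos
      by (simp add: dist_norm norm_sgn)
    then show "measure (?M sgn) (sphere x0 R) = \<kappa> * ?V" "measure (?M sgn) \<Omega> = \<kappa> * ?V"
      using sph open_domain by (auto intro!: full)
    have "x0 + R *\<^sub>R y \<in> ball x0 R" if "y \<in> ball 0 1" for y using that R_pos by (simp add: dist_norm)
    then show "measure (?M (\<lambda>y. y)) (ball x0 R) = \<kappa> * ?V" "measure (?M (\<lambda>y. y)) \<Omega> = \<kappa> * ?V"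
      using ball_sub open_domain by (auto intro!: full)
  qed
  \<comment> \<open>If \<open>B\<close> already carries the full mass, a set disjoint from
    \<open>B\<close> carries none.\<close>
  have disj: "measure (?M p) A = 0"
    if "finite_measure (?M p)" "A \<in> sets borel" "B \<in> sets borel" "A \<subseteq> \<Omega>" "B \<subseteq> \<Omega>" "A \<inter> B = {}"
      "measure (?M p) B = \<kappa> * ?V" "measure (?M p) \<Omega> = \<kappa> * ?V" for p A B
  proof -
    have "measure (?M p) (A \<union> B) = measure (?M p) A + measure (?M p) B"
      using that sets_domain by (intro finite_measure.finite_measure_Union) auto
    moreover have "measure (?M p) (A \<union> B) \<le> measure (?M p) \<Omega>"
      using that open_domain sets_domain by (intro finite_measure.finite_measure_mono) auto
    ultimately show ?thesis using that measure_nonneg[of "?M p" A] by linarith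
  qed
  have sb: "ball x0 R \<inter> sphere x0 R = {}" "sphere x0 R \<subseteq> \<Omega>" "sphere x0 R \<inter> ball x0 R = {}"
    using cball_sub sphere_cball by auto
  have zero: "measure (?M sgn) (ball x0 R) = 0" "measure (?M (\<lambda>y. y)) (sphere x0 R) = 0"
    by (rule disj[where B="sphere x0 R"]; use sb ball_sub masses S.finite_measure_axioms in simp)
       (rule disj[where B="ball x0 R"]; use sb ball_sub masses I.finite_measure_axioms in simp)
  show ?thesis
  proof (rule antisym)
    show "tot_var ?\<nu> \<Omega> \<le> ennreal (2 * \<kappa> * ?V)"
      unfolding tot_var_def
    proof (rule SUP_least, clarify)
      fix P assume P: "finite P" "disjoint P" "P \<subseteq> sets borel" "\<Union>P \<subseteq> \<Omega>"
      have sub: "B \<in> sets borel \<and> B \<subseteq> \<Omega>" if "B \<in> P" for B using that P by blast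
      have "norm (?\<nu> B) \<le> measure (?M sgn) B + measure (?M (\<lambda>y. y)) B" for B
        using measure_nonneg[of "?M sgn" B] measure_nonneg[of "?M (\<lambda>y. y)" B]
        by (simp add: sm_val_def abs_le_iff)
      then have "(\<Sum>B\<in>P. norm (?\<nu> B)) \<le> (\<Sum>B\<in>P. measure (?M sgn) B) + (\<Sum>B\<in>P. measure (?M (\<lambda>y. y)) B)"
        by (simp only: sum.distrib[symmetric] sum_mono)
      also have "(\<Sum>B\<in>P. measure (?M sgn) B) = measure (?M sgn) (\<Union>B\<in>P. B)"
        using P sub by (intro S.finite_measure_finite_Union[symmetric])
          (auto simp: sets_domain disjoint_family_on_def disjoint_def)
      also have "\<dots> \<le> \<kappa> * ?V"
        unfolding masses(1)[symmetric] using P open_domain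
          by (intro S.finite_measure_mono) (auto simp: sets_domain)
      also have "(\<Sum>B\<in>P. measure (?M (\<lambda>y. y)) B) = measure (?M (\<lambda>y. y)) (\<Union>B\<in>P. B)"
        using P sub by (intro I.finite_measure_finite_Union[symmetric])
          (auto simp: sets_domain disjoint_family_on_def disjoint_def)
      also have "\<dots> \<le> \<kappa> * ?V"
        unfolding masses(2)[symmetric] using P open_domain
          by (intro I.finite_measure_mono) (auto simp: sets_domain)
      finally have "ennreal (\<Sum>B\<in>P. norm (?\<nu> B)) \<le> ennreal (2 * \<kappa> * ?V)" by (intro ennreal_leI) simp
      then show "(\<Sum>B\<in>P. ennreal (norm (?\<nu> B))) \<le> ennreal (2 * \<kappa> * ?V)" by simp
    qed
    let ?P = "{ball x0 R, sphere x0 R}"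
    have "x0 \<in> ball x0 R" "x0 \<notin> sphere x0 R" using R_pos by auto
    then have ne: "ball x0 R \<noteq> sphere x0 R" by metis
    have "ennreal (2 * \<kappa> * ?V) = ennreal (\<kappa> * ?V) + ennreal (\<kappa> * ?V)"
      using k by (simp add: ennreal_plus[symmetric] del: ennreal_plus)
    also have "\<dots> = (\<Sum>B\<in>?P. ennreal (norm (?\<nu> B)))"
      by (subst sum.insert) (use ne k masses zero in \<open>auto simp: sm_val_def\<close>)
    also have "\<dots> \<le> tot_var ?\<nu> \<Omega>"
      unfolding tot_var_def using ball_sub sb by (intro SUP_upper) (auto simp: disjoint_def)
    finally show "ennreal (2 * \<kappa> * ?V) \<le> tot_var ?\<nu> \<Omega>" .
  qed
qed

text \<open>Truncating at \<open>a\<close> leaves the constant \<open>a\<close> plus a jump inside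
  \<open>\<Omega>\<close>. Near the boundary the truncation equals \<open>a\<close>, so its trace is
  \<open>a\<close>, which tends to 0.\<close>

lemma TBV_trace_ind:
  assumes bd: "bounded \<Omega>" and c: "0 \<le> c" and u: "\<And>x. u x = c * indicator (ball x0 R) x"
  shows "TBV_trace \<Omega> u (\<lambda>_. 0)"
proof -
  have max_eq: "(\<lambda>x. max (u x) a) = (\<lambda>x. a + max 0 (c - a) * indicator (ball x0 R) x)" if "0 < a" for a
  proof
    fix x show "max (u x) a = a + max 0 (c - a) * indicator (ball x0 R) x"
      using that c by (cases "x \<in> ball x0 R") (auto simp: u max_def)
  qed
  have BV: "(\<lambda>x. max (u x) a) \<in> BV \<Omega>" if "0 < a" for a
    unfolding max_eq[OF that] using is_abs_gradient_ind[OF bd, of "max 0 (c - a)" a]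
      by (simp add: is_abs_gradient_def)
  have "u = (\<lambda>x. 0 + c * indicator (ball x0 R) x)" by (auto simp: u)
  then have "u \<in> BV \<Omega>" using is_abs_gradient_ind[OF bd c, of 0] by (simp add: is_abs_gradient_def)
  then have "integrable (lebesgue_on \<Omega>) u" by (simp add: BV_def)
  then have TBV: "u \<in> TBV_plus \<Omega>" using BV c by (auto simp: TBV_plus_def u)
  have tr: "BV_trace \<Omega> (\<lambda>x. max (u x) a) (\<lambda>_. a)" if a: "0 < a" for a
    unfolding BV_trace_def
  proof (intro conjI BV[OF a] AE_I2)
    fix x assume "x \<in> space (surface \<Omega>)"
    then have "x \<in> frontier \<Omega>" by (simp add: surface_def space_restrict_space)
    then have "x \<notin> \<Omega>" using open_domain by (simp add: frontier_def interior_open)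
    then have "x \<in> - cball x0 R" using cball_sub by blast
    \<comment> \<open>The boundary point has positive distance from the closed ball; for radii below
      \<open>d\<close> the integrand is identically 0.\<close>
    then obtain d where d: "0 < d" "ball x d \<subseteq> - cball x0 R" by (metis open_Compl closed_cball openE)
    have "\<forall>\<^sub>F \<rho> in at_right 0. 0 = (\<integral>y. \<bar>max (u y) a - a\<bar> \<partial>lebesgue_on (\<Omega> \<inter> ball x \<rho>)) / \<rho> ^ DIM('a)"
      unfolding eventually_at_right_field
    proof (intro exI[of _ d] conjI allI impI d)
      fix \<rho> :: real assume "0 < \<rho>" "\<rho> < d"
      have "(\<integral>y. \<bar>max (u y) a - a\<bar> \<partial>lebesgue_on (\<Omega> \<inter> ball x \<rho>)) = 0"
      proof (rule integral_eq_zero_AE, rule AE_I2)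
        fix y assume "y \<in> space (lebesgue_on (\<Omega> \<inter> ball x \<rho>))"
        then have "y \<in> ball x d" using \<open>\<rho> < d\<close> by (simp add: space_restrict_space)
        then have "y \<notin> ball x0 R" using d by auto
        then show "\<bar>max (u y) a - a\<bar> = 0" using a by (simp add: u)
      qed
      then show "0 = (\<integral>y. \<bar>max (u y) a - a\<bar> \<partial>lebesgue_on (\<Omega> \<inter> ball x \<rho>)) / \<rho> ^ DIM('a)" by simp
    qed
    then show "((\<lambda>\<rho>. (\<integral>y. \<bar>max (u y) a - a\<bar> \<partial>lebesgue_on (\<Omega> \<inter> ball x \<rho>)) / \<rho> ^ DIM('a)) \<longlongrightarrow> 0) (at_right 0)"
      by (rule Lim_transform_eventually[OF tendsto_const])
  qed
  show ?thesis
    unfolding TBV_trace_def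
    by (intro conjI TBV exI[of _ "\<lambda>a _. a"] allI impI tr AE_I2 tendsto_ident_at)
qed

end

section \<open>A moving ball\<close>

text \<open>This isolates what matters of the explicit solution: the speed law
  \<open>R' = c^(m-1)\<close> and the mass law \<open>c = M / R^N\<close>. Both hold on the closed
  time interval, while the closed ball is asked to lie in \<open>\<Omega>\<close> only at interior
  times, since at the final time it may touch the boundary.\<close>

locale moving_ball =
  fixes \<Omega> :: "'a::euclidean_space set" and x0 :: 'a and m \<tau> M :: real and R c :: "real \<Rightarrow> real"
  assumes open_domain: "open \<Omega>" and bounded_domain: "bounded \<Omega>" and m: "1 < m" and \<tau>: "0 \<le> \<tau>"
      and M: "0 < M"
    and R_pos: "\<And>t. t \<in> {0..\<tau>} \<Longrightarrow> 0 < R t"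
    and R_deriv: "\<And>t. t \<in> {0..\<tau>} \<Longrightarrow> (R has_real_derivative c t powr (m - 1)) (at t)"
    and c_eq: "\<And>t. t \<in> {0..\<tau>} \<Longrightarrow> c t = M / R t ^ DIM('a)"
    and R_measurable [measurable]: "R \<in> borel_measurable borel"
    and c_measurable [measurable]: "c \<in> borel_measurable borel"
    and cball_sub: "\<And>t. t \<in> {0<..<\<tau>} \<Longrightarrow> cball x0 (R t) \<subseteq> \<Omega>"
begin

definition R' :: "real \<Rightarrow> real" where "R' t = c t powr (m - 1)"

lemma c_pos: "t \<in> {0..\<tau>} \<Longrightarrow> 0 < c t" using R_pos M by (simp add: c_eq)

lemma R_cont: "continuous_on {0..\<tau>} R"
  using R_deriv by (intro DERIV_continuous_on[where D=R'])
      (auto simp: R'_def intro: has_field_derivative_at_within)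

lemma c_cont: "continuous_on {0..\<tau>} c"
proof -
  have "continuous_on {0..\<tau>} (\<lambda>t. M / R t ^ DIM('a))"
    using R_pos by (intro continuous_intros R_cont) (auto simp: less_imp_neq[symmetric])
  then show ?thesis by (rule continuous_on_eq) (simp add: c_eq)
qed

lemma R'_cont: "continuous_on {0..\<tau>} R'"
  unfolding R'_def[abs_def] using c_pos
    by (intro continuous_intros c_cont) (auto simp: less_imp_neq[symmetric])

lemma c_powr_m: "t \<in> {0..\<tau>} \<Longrightarrow> c t powr m = c t * R' t"
  using c_pos[of t] powr_add[of "c t" 1 "m - 1"] by (simp add: R'_def)

lemma c_deriv:
  assumes t: "t \<in> {0<..<\<tau>}"
  shows "(c has_real_derivative - (real DIM('a) * c t * R' t / R t)) (at t)"
proof -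
  have Rt: "0 < R t" using t by (intro R_pos) auto
  have "((\<lambda>t. M / R t ^ DIM('a)) has_real_derivative -
      (real DIM('a) * (M / R t ^ DIM('a)) * R' t / R t)) (at t)"
  proof (rule DERIV_cong)
    have "(R has_real_derivative R' t) (at t)" using t R_deriv[of t] by (simp add: R'_def)
    then show "((\<lambda>t. M / R t ^ DIM('a)) has_real_derivative
        (0 * R t ^ DIM('a) - M * (real DIM('a) * (R' t * R t ^ (DIM('a) - Suc 0)))) /
            (R t ^ DIM('a) * R t ^ DIM('a))) (at t)"
      using Rt by (intro DERIV_divide DERIV_const DERIV_power) auto
    have "R t ^ DIM('a) = R t * R t ^ (DIM('a) - Suc 0)" by (simp add: power_eq_if)
    then show "(0 * R t ^ DIM('a) - M * (real DIM('a) * (R' t * R t ^ (DIM('a) - Suc 0)))) /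
        (R t ^ DIM('a) * R t ^ DIM('a))
        = - (real DIM('a) * (M / R t ^ DIM('a)) * R' t / R t)"
      using Rt by (simp add: field_simps)
  qed
  then have "(c has_real_derivative - (real DIM('a) * (M / R t ^ DIM('a)) * R' t / R t)) (at t)"
    by (rule has_field_derivative_transform_within_open[where S="{0<..<\<tau>}"]) (use t in \<open>auto simp: c_eq\<close>)
  then show ?thesis using t by (simp add: c_eq)
qed

lemma ball_domain: "t \<in> {0<..<\<tau>} \<Longrightarrow> ball_domain \<Omega> x0 (R t)"
  using open_domain R_pos cball_sub by unfold_locales auto

text \<open>Space-time integrals are taken in the coordinates \<open>(t, y)\<close> with \<open>x = x\<^sub>0 + R(t) y\<close>, so that \<open>y\<close>
    ranges
  over the fixed unit ball.\<close>

definition adm :: "(real \<Rightarrow> 'a \<Rightarrow> real) \<Rightarrow> bool" where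
  "adm f \<longleftrightarrow> (\<lambda>p. indicator ({0<..<\<tau>} \<times> ball 0 1) p * f (fst p) (snd p)) \<in> borel_measurable borel \<and>
     (\<exists>C. \<forall>t\<in>{0<..<\<tau>}. \<forall>y\<in>ball 0 1. \<bar>f t y\<bar> \<le> C)"

lemma adm_measurable: "adm f \<Longrightarrow>
    (\<lambda>p. indicator ({0<..<\<tau>} \<times> ball 0 1) p * f (fst p) (snd p)) \<in> borel_measurable borel"
  by (simp add: adm_def)

lemma adm_bound: assumes "adm f" obtains C where "\<And>t y. t \<in> {0<..<\<tau>} \<Longrightarrow> y \<in> ball 0 1 \<Longrightarrow> \<bar>f t y\<bar> \<le> C"
  using assms unfolding adm_def by metis

definition slice :: "('a \<Rightarrow> real) \<Rightarrow> real" where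
  "slice g = (\<integral>y. indicator (ball 0 1) y * g y \<partial>lborel)"

definition II :: "(real \<Rightarrow> 'a \<Rightarrow> real) \<Rightarrow> real" where
  "II f = (\<integral>t. slice (f t) \<partial>lebesgue_on {0<..<\<tau>})"

lemma adm_add: assumes "adm f" "adm g" shows "adm (\<lambda>t y. f t y + g t y)"
proof -
  obtain C D where "\<And>t y. t \<in> {0<..<\<tau>} \<Longrightarrow> y \<in> ball 0 1 \<Longrightarrow> \<bar>f t y\<bar> \<le> C" "\<And>t y. t \<in> {0<..<\<tau>} \<Longrightarrow>
      y \<in> ball 0 1 \<Longrightarrow> \<bar>g t y\<bar> \<le> D"
    using assms unfolding adm_def by blast
  then have "\<forall>t\<in>{0<..<\<tau>}. \<forall>y\<in>ball 0 1. \<bar>f t y + g t y\<bar> \<le> C + D"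
    using abs_triangle_ineq add_mono order_trans by meson
  moreover have "(\<lambda>p. indicator ({0<..<\<tau>} \<times> ball 0 1) p * f (fst p) (snd p) +
      indicator ({0<..<\<tau>} \<times> ball 0 1) p * g (fst p) (snd p)) \<in> borel_measurable borel"
    by (intro borel_measurable_add adm_measurable assms)
  ultimately show ?thesis unfolding adm_def distrib_left by blast
qed

lemma adm_mult: assumes "adm f" "adm g" shows "adm (\<lambda>t y. f t y * g t y)"
proof -
  obtain C D where CD: "\<And>t y. t \<in> {0<..<\<tau>} \<Longrightarrow> y \<in> ball 0 1 \<Longrightarrow> \<bar>f t y\<bar> \<le> C" "\<And>t y. t \<in> {0<..<\<tau>} \<Longrightarrow>
      y \<in> ball 0 1 \<Longrightarrow> \<bar>g t y\<bar> \<le> D"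
    using assms unfolding adm_def by blast
  have bd: "\<forall>t\<in>{0<..<\<tau>}. \<forall>y\<in>ball 0 1. \<bar>f t y * g t y\<bar> \<le> C * D"
  proof (intro ballI)
    fix t and y :: 'a assume "t \<in> {0<..<\<tau>}" "y \<in> ball 0 1"
    note CD[OF this]
    moreover from this have "0 \<le> C" using abs_ge_zero order_trans by blast
    ultimately show "\<bar>f t y * g t y\<bar> \<le> C * D" by (simp add: abs_mult mult_mono)
  qed
  have "(\<lambda>p. (indicator ({0<..<\<tau>} \<times> ball 0 1) p * f (fst p) (snd p)) *
      (indicator ({0<..<\<tau>} \<times> ball 0 1) p * g (fst p) (snd p))) \<in> borel_measurable borel"
    by (intro borel_measurable_times adm_measurable assms)
  moreover have "(\<lambda>p. (indicator ({0<..<\<tau>} \<times> ball 0 1) p * f (fst p) (snd p)) *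
      (indicator ({0<..<\<tau>} \<times> ball 0 1) p * g (fst p) (snd p)))
     = (\<lambda>p. indicator ({0<..<\<tau>} \<times> ball (0::'a) 1) p * (f (fst p) (snd p) * g (fst p) (snd p)))"
    by (auto simp: fun_eq_iff indicator_def)
  ultimately have "(\<lambda>p. indicator ({0<..<\<tau>} \<times> ball (0::'a) 1) p *
      (f (fst p) (snd p) * g (fst p) (snd p))) \<in> borel_measurable borel"
    by (simp only:)
  then show ?thesis unfolding adm_def using bd by blast
qed

lemma adm_coeff:
  assumes "(\<lambda>t. indicator {0<..<\<tau>} t * b t) \<in> borel_measurable borel" "\<And>t. t \<in> {0<..<\<tau>} \<Longrightarrow> \<bar>b t\<bar> \<le> C"
  shows "adm (\<lambda>t y. b t)"
proof -
  have "fst \<in> (borel \<Otimes>\<^sub>M borel :: (real \<times> 'a) measure) \<rightarrow>\<^sub>M borel" by measurable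
  from measurable_compose[OF this assms(1)]
  have "(\<lambda>p::real \<times> 'a. indicator {0<..<\<tau>} (fst p) * b (fst p)) \<in> borel_measurable borel"
    by (simp only: borel_prod)
  moreover have [measurable]:
      "(\<lambda>p::real \<times> 'a. indicator (ball 0 1) (snd p) :: real) \<in> borel_measurable borel"
    unfolding borel_prod[symmetric] by measurable
  ultimately have "(\<lambda>p::real \<times> 'a. indicator (ball 0 1) (snd p) *
      (indicator {0<..<\<tau>} (fst p) * b (fst p))) \<in> borel_measurable borel"
    by (rule borel_measurable_times[rotated])
  moreover have "(\<lambda>p::real \<times> 'a. indicator (ball 0 1) (snd p) *
      (indicator {0<..<\<tau>} (fst p) * b (fst p))) = (\<lambda>p. indicator ({0<..<\<tau>} \<times> ball 0 1) p * b (fst p))"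
    by (auto simp: fun_eq_iff indicator_def)
  ultimately have "(\<lambda>p. indicator ({0<..<\<tau>} \<times> ball (0::'a) 1) p * b (fst p)) \<in> borel_measurable borel"
    by (simp only:)
  then show ?thesis unfolding adm_def using assms(2) by (intro conjI exI[of _ C] ballI)
qed

lemma adm_cont: assumes "continuous_on {0..\<tau>} b" shows "adm (\<lambda>t y. b t)"
proof -
  have "bounded (b ` {0..\<tau>})" using assms by (intro compact_imp_bounded compact_continuous_image) auto
  then obtain C where C: "\<And>t. t \<in> {0..\<tau>} \<Longrightarrow> \<bar>b t\<bar> \<le> C" unfolding bounded_iff
    by (metis image_eqI real_norm_def)
  show ?thesis
  proof (rule adm_coeff[of _ C])
    show "(\<lambda>t. indicator {0<..<\<tau>} t * b t) \<in> borel_measurable borel"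
      using assms by (intro measurable_indicator_mult) (auto intro: continuous_on_subset)
  qed (use C in auto)
qed

lemma R_bound: obtains C where "\<And>t. t \<in> {0..\<tau>} \<Longrightarrow> R t \<le> C"
proof -
  have "bounded (R ` {0..\<tau>})" using R_cont by (intro compact_imp_bounded compact_continuous_image) auto
  then obtain C where "\<And>t. t \<in> {0..\<tau>} \<Longrightarrow> \<bar>R t\<bar> \<le> C" unfolding bounded_iff
    by (metis image_eqI real_norm_def)
  then show thesis by (intro that[of C]) (meson abs_le_D1)
qed

lemma adm_moved:
  fixes g :: "real \<times> 'a \<Rightarrow> real"
  assumes g: "continuous_on UNIV g" and q: "into_cball q"
  shows "adm (\<lambda>t y. g (t, x0 + R t *\<^sub>R q y))"
proof -
  have [measurable]: "g \<in> borel_measurable borel" "q \<in> borel_measurable borel"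
    using g q by (auto simp: into_cball_def intro: borel_measurable_continuous_onI)
  have "(\<lambda>p. indicator ({0<..<\<tau>} \<times> ball 0 1) p * g (fst p, x0 + R (fst p) *\<^sub>R q (snd p))) \<in>
      borel_measurable (borel \<Otimes>\<^sub>M borel)"
  proof -
    have "(\<lambda>p. (fst p, x0 + R (fst p) *\<^sub>R q (snd p))) \<in> borel \<Otimes>\<^sub>M borel \<rightarrow>\<^sub>M
        (borel :: (real \<times> 'a) measure)"
      by measurable
    then have [measurable]: "(\<lambda>p. g (fst p, x0 + R (fst p) *\<^sub>R q (snd p))) \<in> borel_measurable
        (borel \<Otimes>\<^sub>M borel)"
      by (rule measurable_compose) measurable
    show ?thesis by measurable
  qed
  moreover obtain C where C: "\<And>t. t \<in> {0..\<tau>} \<Longrightarrow> R t \<le> C" using R_bound by blast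
  have "compact ({0..\<tau>} \<times> cball x0 C)" by (intro compact_Times) auto
  then have "bounded (g ` ({0..\<tau>} \<times> cball x0 C))"
    using g by (intro compact_imp_bounded compact_continuous_image) (auto intro: continuous_on_subset)
  then obtain D where D: "\<And>p. p \<in> {0..\<tau>} \<times> cball x0 C \<Longrightarrow> \<bar>g p\<bar> \<le> D" unfolding bounded_iff
    by (metis image_eqI real_norm_def)
  have "\<bar>g (t, x0 + R t *\<^sub>R q y)\<bar> \<le> D" if "t \<in> {0<..<\<tau>}" "y \<in> ball 0 1" for t y
  proof (rule D)
    have "R t * norm (q y) \<le> C * 1"
      using that q C[of t] R_pos[of t] by (intro mult_mono) (auto simp: into_cball_def)
    then show "(t, x0 + R t *\<^sub>R q y) \<in> {0..\<tau>} \<times> cball x0 C"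
      using that R_pos[of t] by (auto simp: dist_norm)
  qed
  ultimately show ?thesis unfolding adm_def borel_prod by blast
qed

lemma adm_integrable:
  assumes f: "adm f"
  shows "integrable (lborel \<Otimes>\<^sub>M lborel) (\<lambda>p. indicator ({0<..<\<tau>} \<times> ball 0 1) p * f (fst p) (snd p))"
proof -
  obtain C where C: "\<And>t y. t \<in> {0<..<\<tau>} \<Longrightarrow> y \<in> ball 0 1 \<Longrightarrow> \<bar>f t y\<bar> \<le> C"
    using f unfolding adm_def by blast
  have "integrable (lborel \<Otimes>\<^sub>M lborel) (\<lambda>p. indicator ({0<..<\<tau>} \<times> ball (0::'a) 1) p * \<bar>C\<bar>)"
  proof -
    have "emeasure (lborel \<Otimes>\<^sub>M lborel) ({0<..<\<tau>} \<times> ball (0::'a) 1) < \<infinity>"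
      using emeasure_lborel_ball_finite[of "0::'a" 1] \<tau>
      by (subst lborel.emeasure_pair_measure_Times) (auto simp: ennreal_mult_less_top)
    then show ?thesis by (simp add: integrable_indicator_iff)
  qed
  then show ?thesis
  proof (rule Bochner_Integration.integrable_bound)
    show "(\<lambda>p. indicator ({0<..<\<tau>} \<times> ball 0 1) p * f (fst p) (snd p)) \<in> borel_measurable
        (lborel \<Otimes>\<^sub>M lborel)"
      using f by (simp add: adm_def lborel_prod)
    show "AE p in lborel \<Otimes>\<^sub>M lborel. norm (indicator ({0<..<\<tau>} \<times> ball 0 1) p * f (fst p) (snd p)) \<le>
        norm (indicator ({0<..<\<tau>} \<times> ball (0::'a) 1) p * \<bar>C\<bar>)"
      using C by (intro AE_I2) (force simp: indicator_def)
  qed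
qed

lemma split_indicator: "indicator ({0<..<\<tau>} \<times> ball (0::'a) 1) (t, y) * z =
    indicator {0<..<\<tau>} t * (indicator (ball 0 1) y * (z :: real))"
  by (simp add: indicator_def)

lemma slice_integrable:
  assumes f: "adm f" and t: "t \<in> {0<..<\<tau>}"
  shows "integrable lborel (\<lambda>y. indicator (ball 0 1) y * f t y)"
proof -
  obtain C where C: "\<And>t y. t \<in> {0<..<\<tau>} \<Longrightarrow> y \<in> ball 0 1 \<Longrightarrow> \<bar>f t y\<bar> \<le> C"
    using f unfolding adm_def by blast
  have "(\<lambda>p. indicator ({0<..<\<tau>} \<times> ball 0 1) p * f (fst p) (snd p)) \<in> borel_measurable (borel \<Otimes>\<^sub>M borel)"
    using f by (simp add: adm_def borel_prod)
  from measurable_compose[OF measurable_Pair1' this, of t]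
  have "(\<lambda>y. indicator {0<..<\<tau>} t * (indicator (ball 0 1) y * f t y)) \<in> borel_measurable borel"
    by (simp only: fst_conv snd_conv split_indicator space_borel UNIV_I)
  then have "(\<lambda>y. indicator (ball 0 1) y * f t y) \<in> borel_measurable borel"
    using t by simp
  then show ?thesis by (rule integrable_indicator_ball) (use C t in auto)
qed

text \<open>The form over the product gives additivity and monotonicity; the form with time inside
  is the one for the fundamental theorem along each curve; the form with space inside matches the
  slices.\<close>

lemma II_fubini:
  assumes f: "adm f"
  shows "integrable (lebesgue_on {0<..<\<tau>}) (\<lambda>t. slice (f t))"
    and "II f = (\<integral>t. indicator {0<..<\<tau>} t * slice (f t) \<partial>lborel)"
    and "II f = (\<integral>p. indicator ({0<..<\<tau>} \<times> ball 0 1) p * f (fst p) (snd p) \<partial>(lborel \<Otimes>\<^sub>M lborel))"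
    and "II f = (\<integral>y. indicator (ball 0 1) y * (\<integral>t. indicator {0<..<\<tau>} t * f t y \<partial>lborel) \<partial>lborel)"
proof -
  let ?F = "\<lambda>t y. indicator ({0<..<\<tau>} \<times> ball 0 1) (t, y) * f t y"
  have i: "integrable (lborel \<Otimes>\<^sub>M lborel) (\<lambda>(t, y). ?F t y)"
    using adm_integrable[OF f] by (simp add: case_prod_unfold)
  have sl: "(\<integral>y. ?F t y \<partial>lborel) = indicator {0<..<\<tau>} t * slice (f t)" for t
    unfolding split_indicator slice_def by simp
  have int: "integrable lborel (\<lambda>t. indicator {0<..<\<tau>} t * slice (f t))"
    using lborel_pair.integrable_fst[OF i] unfolding sl .
  then have "integrable lebesgue (\<lambda>t. indicator {0<..<\<tau>} t * slice (f t))"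
    using integrable_completion by blast
  then show "integrable (lebesgue_on {0<..<\<tau>}) (\<lambda>t. slice (f t))"
    by (subst integrable_restrict_space) auto
  show 1: "II f = (\<integral>t. indicator {0<..<\<tau>} t * slice (f t) \<partial>lborel)"
    unfolding II_def
    using integral_completion[OF borel_measurable_integrable[OF int]]
    by (subst integral_restrict_space) auto
  have 2: "\<dots> = (\<integral>p. (\<lambda>(t, y). ?F t y) p \<partial>(lborel \<Otimes>\<^sub>M lborel))"
    using lborel_pair.integral_fst[OF i] unfolding sl .
  then show "II f = (\<integral>p. indicator ({0<..<\<tau>} \<times> ball 0 1) p * f (fst p) (snd p) \<partial>(lborel \<Otimes>\<^sub>M lborel))"
    using 1 by (simp add: case_prod_unfold)
  have "(\<integral>p. (\<lambda>(t, y). ?F t y) p \<partial>(lborel \<Otimes>\<^sub>M lborel)) = (\<integral>y. (\<integral>t. ?F t y \<partial>lborel) \<partial>lborel)"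
    using lborel_pair.integral_snd[OF i] by simp
  also have "\<dots> = (\<integral>y. indicator (ball 0 1) y * (\<integral>t. indicator {0<..<\<tau>} t * f t y \<partial>lborel) \<partial>lborel)"
    unfolding split_indicator by (simp add: mult.left_commute[of _ "indicator (ball (0::'a) 1) _"])
  finally show "II f = (\<integral>y. indicator (ball 0 1) y * (\<integral>t. indicator {0<..<\<tau>} t * f t y \<partial>lborel) \<partial>lborel)"
    using 1 2 by simp
qed

lemma II_add: "adm f \<Longrightarrow> adm g \<Longrightarrow> II (\<lambda>t y. f t y + g t y) = II f + II g"
  using adm_integrable[of f] adm_integrable[of g]
  by (simp add: II_fubini(3) adm_add distrib_left)

lemma II_cong:
  assumes "\<And>t. t \<in> {0<..<\<tau>} \<Longrightarrow> slice (f t) = slice (g t)" shows "II f = II g"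
  unfolding II_def by (rule Bochner_Integration.integral_cong) (use assms in auto)

lemma II_mono:
  assumes "adm f" "adm g" "\<And>t y. t \<in> {0<..<\<tau>} \<Longrightarrow> y \<in> ball 0 1 \<Longrightarrow> f t y \<le> g t y" shows "II f \<le> II g"
  unfolding II_fubini(3)[OF assms(1)] II_fubini(3)[OF assms(2)]
  by (rule Bochner_Integration.integral_mono[OF adm_integrable[OF assms(1)] adm_integrable[OF assms(2)]])
    (use assms(3) in \<open>auto simp: indicator_def\<close>)

lemma slice_cmult: "slice (\<lambda>y. k * f y) = k * slice f"
  unfolding slice_def by (subst integral_mult_right_zero[symmetric]) (simp add: mult.left_commute)

lemma slice_add:
  assumes "adm f" "adm g" "t \<in> {0<..<\<tau>}"
  shows "slice (\<lambda>y. f t y + g t y) = slice (f t) + slice (g t)"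
  unfolding slice_def using slice_integrable[OF assms(1,3)] slice_integrable[OF assms(2,3)]
  by (simp add: distrib_left)

end

section \<open>Test functions along the moving ball\<close>

lemma test_function_grad:
  fixes \<psi> :: "real \<times> 'a::euclidean_space \<Rightarrow> real"
  assumes "smooth \<psi>"
  shows "partial_deriv (1, 0) \<psi> p = fst (grad \<psi> p)"
    and "((\<lambda>y. \<psi> (t, y)) has_derivative (\<lambda>h. snd (grad \<psi> (t, x)) \<bullet> h)) (at x)"
    and "grad (\<lambda>y. \<psi> (t, y)) x = snd (grad \<psi> (t, x))"
proof -
  have "(1, 0) \<in> (Basis :: (real \<times> 'a) set)" by (simp add: Basis_prod_def)
  then show "partial_deriv (1, 0) \<psi> p = fst (grad \<psi> p)"
    by (simp add: partial_deriv_eq_grad inner_prod_def)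
  have "((\<lambda>y. \<psi> (t, y)) has_derivative (\<lambda>h. grad \<psi> (t, x) \<bullet> (0, h))) (at x)"
    by (rule has_derivative_compose[where g=\<psi>
        and f="\<lambda>y. (t, y)", OF _ smooth_has_derivative(1)[OF assms]])
      (auto intro!: derivative_eq_intros)
  then show "((\<lambda>y. \<psi> (t, y)) has_derivative (\<lambda>h. snd (grad \<psi> (t, x)) \<bullet> h)) (at x)"
    by (simp add: inner_prod_def)
  then show "grad (\<lambda>y. \<psi> (t, y)) x = snd (grad \<psi> (t, x))" by (rule grad_unique)
qed

context moving_ball begin

definition radial :: "(real \<times> 'a \<Rightarrow> real) \<Rightarrow> real \<times> 'a \<Rightarrow> real" where
  "radial \<psi> p = (snd p - x0) \<bullet> snd (grad \<psi> p)"

definition moved :: "(real \<times> 'a \<Rightarrow> real) \<Rightarrow> real \<Rightarrow> 'a \<Rightarrow> real" where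
  "moved g t y = g (t, x0 + R t *\<^sub>R y)"

lemma test_function_cont:
  assumes "smooth \<psi>"
  shows "continuous_on UNIV \<psi>" "continuous_on UNIV (\<lambda>p. fst (grad \<psi> p))" "continuous_on UNIV (radial \<psi>)"
  unfolding radial_def[abs_def]
  by (intro continuous_intros smooth_continuous smooth_has_derivative(2) assms)+

lemma adm_test:
  assumes "smooth \<psi>"
  shows "adm (moved \<psi>)" "adm (moved (\<lambda>p. fst (grad \<psi> p)))" "adm (moved (radial \<psi>))"
    "adm (\<lambda>t y. moved \<psi> t (sgn y))"
  unfolding moved_def[abs_def]
  by (rule adm_moved[OF test_function_cont(1)[OF assms] into_cball_ident],
      rule adm_moved[OF test_function_cont(2)[OF assms] into_cball_ident],
      rule adm_moved[OF test_function_cont(3)[OF assms] into_cball_ident],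
      rule adm_moved[OF test_function_cont(1)[OF assms] into_cball_sgn])

text \<open>This is the radial divergence identity for the pulled back test function: its gradient
  contains a factor \<open>R t\<close>, which turns \<open>y\<close> into \<open>x - x0\<close>.
  Radial derivatives are thereby exchanged for the difference of a sphere and a ball
  integral.\<close>

lemma gauss_slice:
  assumes "smooth \<psi>" and t: "t \<in> {0<..<\<tau>}"
  shows "real DIM('a) * slice (moved \<psi> t) + slice (moved (radial \<psi>) t) =
      real DIM('a) * slice (\<lambda>y. moved \<psi> t (sgn y))"
proof -
  interpret ball_domain \<Omega> x0 "R t" by (rule ball_domain[OF t])
  interpret u: c1_unit_ball "\<lambda>y. \<psi> (t, x0 + R t *\<^sub>R y)" "\<lambda>y. R t *\<^sub>R snd (grad \<psi> (t, x0 + R t *\<^sub>R y))"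
  proof (rule c1_scaled)
    show "continuous_on (cball x0 (R t)) (\<lambda>x. snd (grad \<psi> (t, x)))"
      by (intro continuous_intros continuous_on_compose2[OF smooth_has_derivative(2)[OF assms(1)]]) auto
  qed (rule test_function_grad(2)[OF assms(1)])
  show ?thesis using u.gauss_radial by (simp add: slice_def moved_def radial_def)
qed

lemma integrable_time:
  assumes f: "adm f" and y: "y \<in> ball 0 1"
  shows "integrable lborel (\<lambda>t. indicator {0<..<\<tau>} t * f t y)"
proof -
  obtain C where C: "\<And>t y. t \<in> {0<..<\<tau>} \<Longrightarrow> y \<in> ball 0 1 \<Longrightarrow> \<bar>f t y\<bar> \<le> C"
    using adm_bound[OF f] by blast
  have "(\<lambda>p. indicator ({0<..<\<tau>} \<times> ball 0 1) p * f (fst p) (snd p)) \<in> borel_measurable (borel \<Otimes>\<^sub>M borel)"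
    using adm_measurable[OF f] by (simp only: borel_prod)
  from measurable_compose[OF measurable_Pair2' this, of y]
  have "(\<lambda>t. indicator {0<..<\<tau>} t * (indicator (ball 0 1) y * f t y)) \<in> borel_measurable borel"
    by (simp only: fst_conv snd_conv split_indicator space_borel UNIV_I)
  then have meas: "(\<lambda>t. indicator {0<..<\<tau>} t * f t y) \<in> borel_measurable lborel"
    using y by simp
  show ?thesis
  proof (rule Bochner_Integration.integrable_bound[OF _ meas])
    show "integrable lborel (\<lambda>t. indicator {0<..<\<tau>} t * \<bar>C\<bar>)" using \<tau>
      by (simp add: integrable_indicator_iff)
    show "AE t in lborel. norm (indicator {0<..<\<tau>} t * f t y) \<le> norm (indicator {0<..<\<tau>} t * \<bar>C\<bar>)"
      using C y by (intro AE_I2) (force simp: indicator_def)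
  qed
qed

text \<open>The projection of the compact set \<open>K\<close> to the time axis is a compact subset
  of the open interval. So the support keeps away from both end times, although in space it may
  reach the boundary.\<close>

lemma test_support:
  assumes \<psi>: "\<psi> \<in> Cc_inf_upto \<tau> \<Omega>"
  obtains \<alpha> \<beta> where "0 < \<alpha>" "\<beta> < \<tau>" "\<And>t x. t \<in> {0<..<\<tau>} \<Longrightarrow> x \<in> \<Omega> \<Longrightarrow> t < \<alpha> \<or> \<beta> < t \<Longrightarrow> \<psi> (t, x) = 0"
proof -
  obtain K where K: "compact K" "K \<subseteq> {0<..<\<tau>} \<times> closure \<Omega>"
      "\<And>p. p \<in> ({0<..<\<tau>} \<times> closure \<Omega>) - K \<Longrightarrow> \<psi> p = 0"
    using \<psi> by (auto simp: Cc_inf_upto_def)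
  have S: "compact (fst ` K)" "fst ` K \<subseteq> {0<..<\<tau>}"
    using K by (auto intro!: compact_continuous_image continuous_intros)
  have "\<exists>\<alpha> \<beta>. 0 < \<alpha> \<and> \<beta> < \<tau> \<and> fst ` K \<subseteq> {\<alpha>..\<beta>}"
  proof (cases "K = {}")
    \<comment> \<open>There is nothing to enclose, so any values with \<open>0 < \<alpha>\<close>
      and \<open>\<beta> < \<tau>\<close> will do.\<close>
    case True then show ?thesis by (intro exI[of _ 1] exI[of _ "\<tau> - 1"]) auto
  next
    case False
    then have "fst ` K \<noteq> {}" by blast
    obtain \<alpha> where \<alpha>: "\<alpha> \<in> fst ` K" "\<forall>t\<in>fst ` K. \<alpha> \<le> t"
      using compact_attains_inf[OF S(1) \<open>fst ` K \<noteq> {}\<close>] by blast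
    obtain \<beta> where \<beta>: "\<beta> \<in> fst ` K" "\<forall>t\<in>fst ` K. t \<le> \<beta>"
      using compact_attains_sup[OF S(1) \<open>fst ` K \<noteq> {}\<close>] by blast
    have "\<alpha> \<in> {0<..<\<tau>}" "\<beta> \<in> {0<..<\<tau>}" using \<alpha>(1) \<beta>(1) S(2) by blast+
    moreover have "fst ` K \<subseteq> {\<alpha>..\<beta>}" using \<alpha>(2) \<beta>(2) by (meson atLeastAtMost_iff subsetI)
    ultimately show ?thesis by (intro exI[of _ \<alpha>] exI[of _ \<beta>]) simp
  qed
  then obtain \<alpha> \<beta> where ab: "0 < \<alpha>" "\<beta> < \<tau>" "fst ` K \<subseteq> {\<alpha>..\<beta>}" by blast
  show thesis
  proof (rule that[OF ab(1,2)])
    fix t x assume "t \<in> {0<..<\<tau>}" "x \<in> \<Omega>" "t < \<alpha> \<or> \<beta> < t"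
    note tx = this
    have "(t, x) \<notin> K"
    proof
      assume "(t, x) \<in> K"
      then have "t \<in> {\<alpha>..\<beta>}" using ab(3) by (metis fst_conv image_eqI subset_iff)
      then show False using tx(3) by auto
    qed
    moreover have "x \<in> closure \<Omega>" using tx(2) closure_subset by blast
    ultimately show "\<psi> (t, x) = 0" using tx(1) by (intro K(3)) blast
  qed
qed

text \<open>For each \<open>y\<close> the integrand is the time derivative of \<open>a(t) \<psi>(t, x\<^sub>0 + R(t) y)\<close>, which vanishes
  near both ends of the time interval.\<close>

lemma transport_zero:
  assumes \<psi>: "\<psi> \<in> Cc_inf_upto \<tau> \<Omega>"
    and a: "\<And>t. t \<in> {0<..<\<tau>} \<Longrightarrow> (a has_real_derivative a' t) (at t)"
    and adm: "adm (\<lambda>t y. a t)" "adm (\<lambda>t y. a' t)"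
  shows "adm (\<lambda>t y. a' t * moved \<psi> t y +
      (a t * moved (\<lambda>p. fst (grad \<psi> p)) t y + (a t * (R' t / R t)) * moved (radial \<psi>) t y))"
    and "II (\<lambda>t y. a' t * moved \<psi> t y +
        (a t * moved (\<lambda>p. fst (grad \<psi> p)) t y + (a t * (R' t / R t)) * moved (radial \<psi>) t y)) = 0"
proof -
  let ?D = "\<lambda>t y. a' t * moved \<psi> t y +
      (a t * moved (\<lambda>p. fst (grad \<psi> p)) t y + (a t * (R' t / R t)) * moved (radial \<psi>) t y)"
  have sm: "smooth \<psi>" using \<psi> by (simp add: Cc_inf_upto_def)
  have "continuous_on {0..\<tau>} (\<lambda>t. R' t / R t)"
    using R_pos by (intro continuous_intros R'_cont R_cont) (auto simp: less_imp_neq[symmetric])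
  from adm_cont[OF this] show admD: "adm ?D"
    by (intro adm_add adm_mult adm adm_test sm)
  obtain \<alpha> \<beta> where ab: "0 < \<alpha>" "\<beta> < \<tau>" "\<And>t x. t \<in> {0<..<\<tau>} \<Longrightarrow> x \<in> \<Omega> \<Longrightarrow> t < \<alpha> \<or> \<beta> < t \<Longrightarrow> \<psi> (t, x) = 0"
    using test_support[OF \<psi>] by metis
  have zero: "(\<integral>t. indicator {0<..<\<tau>} t * ?D t y \<partial>lborel) = 0" if y: "y \<in> ball 0 1" for y
  proof -
    \<comment> \<open>Set to zero outside the open time interval, the product is differentiable
      everywhere, because it vanishes near both ends. The fundamental theorem then applies on the
      closed interval with zero end values.\<close>
    define F where "F t = (if t \<in> {0<..<\<tau>} then a t * \<psi> (t, x0 + R t *\<^sub>R y) else 0)" for t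
    have F0: "F t = 0" if "t < \<alpha> \<or> \<beta> < t" for t
    proof (cases "t \<in> {0<..<\<tau>}")
      case True
      interpret ball_domain \<Omega> x0 "R t" by (rule ball_domain[OF True])
      show ?thesis using True that y ab(3)[of t "x0 + R t *\<^sub>R y"] into_domain[of y] by (simp add: F_def)
    qed (simp only: F_def if_False)
    have "(F has_real_derivative indicator {0<..<\<tau>} t * ?D t y) (at t)" for t
    proof (cases "t \<in> {0<..<\<tau>}")
      case True
      then have t: "t \<in> {0..\<tau>}" and Rt: "R t \<noteq> 0" using R_pos[of t] by auto
      have mv: "((\<lambda>t. (t, x0 + R t *\<^sub>R y)) has_derivative (\<lambda>h. (h, (h * R' t) *\<^sub>R y))) (at t)"
        using R_deriv[OF t] unfolding R'_def[symmetric] has_field_derivative_def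
        by (auto intro!: derivative_eq_intros simp: mult.commute)
      have "((\<lambda>t. \<psi> (t, x0 + R t *\<^sub>R y)) has_derivative
          (\<lambda>h. grad \<psi> (t, x0 + R t *\<^sub>R y) \<bullet> (h, (h * R' t) *\<^sub>R y))) (at t)"
        by (rule has_derivative_compose[OF mv smooth_has_derivative(1)[OF sm]])
      \<comment> \<open>The curve has velocity \<open>R' y\<close>, which is \<open>R' / R\<close>
        times \<open>x - x0\<close>; hence the radial derivative.\<close>
      moreover have "(\<lambda>h. grad \<psi> (t, x0 + R t *\<^sub>R y) \<bullet> (h, (h * R' t) *\<^sub>R y)) =
          (*) (moved (\<lambda>p. fst (grad \<psi> p)) t y + (R' t / R t) * moved (radial \<psi>) t y)"
        using Rt by (auto simp: fun_eq_iff inner_prod_def moved_def radial_def inner_commute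
            algebra_simps)
      ultimately have "((\<lambda>t. \<psi> (t, x0 + R t *\<^sub>R y)) has_real_derivative
          moved (\<lambda>p. fst (grad \<psi> p)) t y + (R' t / R t) * moved (radial \<psi>) t y) (at t)"
        by (simp add: has_field_derivative_def)
      from DERIV_mult[OF a[OF True] this]
      have "((\<lambda>t. a t * \<psi> (t, x0 + R t *\<^sub>R y)) has_real_derivative ?D t y) (at t)"
        by (rule DERIV_cong) (simp add: moved_def algebra_simps)
      then have "(F has_real_derivative ?D t y) (at t)"
        by (rule has_field_derivative_transform_within_open[where S="{0<..<\<tau>}"])
            (use True in \<open>auto simp: F_def\<close>)
      then show ?thesis using True by simp
    next
      case False
      then have "t \<in> {..<\<alpha>} \<union> {\<beta><..}" using ab by auto
      moreover have "((\<lambda>_. 0) has_real_derivative 0) (at t)" by simp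
      ultimately have "(F has_real_derivative 0) (at t)"
        by (rule_tac has_field_derivative_transform_within_open[where S="{..<\<alpha>} \<union> {\<beta><..}"])
            (auto simp: F0)
      then show ?thesis using False by simp
    qed
    then have "((\<lambda>t. indicator {0<..<\<tau>} t * ?D t y) has_integral (F \<tau> - F 0)) {0..\<tau>}"
      using \<tau> by (intro fundamental_theorem_of_calculus)
        (auto simp: has_real_derivative_iff_has_vector_derivative[symmetric] intro:
            has_field_derivative_at_within)
    moreover have "F \<tau> - F 0 = 0" by (simp add: F_def)
    ultimately have "((\<lambda>t. indicator {0<..<\<tau>} t * ?D t y) has_integral 0) {0..\<tau>}" by simp
    then have "((\<lambda>t. indicator {0<..<\<tau>} t * ?D t y) has_integral 0) UNIV"
      by (rule has_integral_on_superset) auto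
    then show ?thesis
      using integral_lborel[OF integrable_time[OF admD y]] by (simp add: integral_unique)
  qed
  have "II ?D = (\<integral>y. indicator (ball 0 1) y * (\<integral>t. indicator {0<..<\<tau>} t * ?D t y \<partial>lborel) \<partial>lborel)"
    by (rule II_fubini(4)[OF admD])
  also have "\<dots> = (\<integral>(y::'a). 0 \<partial>lborel)"
  proof (rule Bochner_Integration.integral_cong[OF refl])
    fix y :: 'a
    show "indicator (ball 0 1) y * (\<integral>t. indicator {0<..<\<tau>} t * ?D t y \<partial>lborel) = 0"
      using zero[of y] by (cases "y \<in> ball 0 1") simp_all
  qed
  finally show "II ?D = 0" by simp
qed

text \<open>After \<open>transport_zero\<close> there remain \<open>B \<psi>\<close> and the radial
  derivative with coefficient \<open>b - a R' / R\<close>. By \<open>gauss_slice\<close> they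
  combine to a pure surface term as soon as this coefficient is \<open>B / N\<close>, which is the
  relation imposed on \<open>b\<close>. The time derivative of \<open>u\<close> uses
  \<open>a = M\<close> and \<open>B = 0\<close>, the entropy inequality
  \<open>a = J R^N\<close>.\<close>

lemma transport:
  assumes \<psi>: "\<psi> \<in> Cc_inf_upto \<tau> \<Omega>"
    and a: "\<And>t. t \<in> {0<..<\<tau>} \<Longrightarrow> (a has_real_derivative - B t) (at t)"
    and adm_a: "adm (\<lambda>t y. a t)" and adm_B: "adm (\<lambda>t y. B t)" and adm_b: "adm (\<lambda>t y. b t)"
    and b: "\<And>t. t \<in> {0<..<\<tau>} \<Longrightarrow> b t = a t * (R' t / R t) + B t / real DIM('a)"
  shows "II (\<lambda>t y. a t * moved (\<lambda>p. fst (grad \<psi> p)) t y) + II (\<lambda>t y. b t * moved (radial \<psi>) t y)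
    = II (\<lambda>t y. B t * moved \<psi> t (sgn y))"
proof -
  have sm: "smooth \<psi>" using \<psi> by (simp add: Cc_inf_upto_def)
  note adms = adm_test[OF sm] adm_a adm_B adm_b adm_mult adm_add
  have adm_nB: "adm (\<lambda>t y. - B t)"
  proof -
    have "adm (\<lambda>t y. (- 1) * B t)" by (intro adm_mult adm_B adm_cont continuous_intros)
    then show ?thesis by simp
  qed
  note D = transport_zero[OF \<psi> a adm_a adm_nB]
  let ?D = "\<lambda>t y. - B t * moved \<psi> t y +
      (a t * moved (\<lambda>p. fst (grad \<psi> p)) t y + (a t * (R' t / R t)) * moved (radial \<psi>) t y)"
  let ?N = "real DIM('a)"
  have aR: "adm (\<lambda>t y. a t * (R' t / R t))"
    using R_pos by (intro adm_mult adm_a adm_cont continuous_intros R'_cont R_cont)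
        (auto simp: less_imp_neq[symmetric])
  have "II (\<lambda>t y. a t * moved (\<lambda>p. fst (grad \<psi> p)) t y) + II (\<lambda>t y. b t * moved (radial \<psi>) t y)
     = II (\<lambda>t y. a t * moved (\<lambda>p. fst (grad \<psi> p)) t y + b t * moved (radial \<psi>) t y)"
    by (rule II_add[symmetric]) (intro adms)+
  also have "\<dots> = II (\<lambda>t y. ?D t y + B t * moved \<psi> t (sgn y))"
  proof (rule II_cong)
    fix t assume t: "t \<in> {0<..<\<tau>}"
    have g: "?N * slice (moved \<psi> t) + slice (moved (radial \<psi>) t) = ?N * slice (\<lambda>y. moved \<psi> t (sgn y))"
      by (rule gauss_slice[OF sm t])
    have l: "slice (\<lambda>y. a t * moved (\<lambda>p. fst (grad \<psi> p)) t y + b t * moved (radial \<psi>) t y)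
      = a t * slice (moved (\<lambda>p. fst (grad \<psi> p)) t) + b t * slice (moved (radial \<psi>) t)"
      by (subst slice_add[OF _ _ t]) (intro adms | simp only: slice_cmult)+
    have r: "slice (\<lambda>y. ?D t y + B t * moved \<psi> t (sgn y)) =
      (- B t * slice (moved \<psi> t) + (a t * slice (moved (\<lambda>p. fst (grad \<psi> p)) t) + (a t * (R' t / R t)) *
          slice (moved (radial \<psi>) t)))
      + B t * slice (\<lambda>y. moved \<psi> t (sgn y))"
    proof -
      have "slice (\<lambda>y. ?D t y + B t * moved \<psi> t (sgn y)) =
          slice (?D t) + slice (\<lambda>y. B t * moved \<psi> t (sgn y))"
        by (rule slice_add[OF D(1) _ t]) (assumption | intro adms)+
      also have "slice (?D t) = slice (\<lambda>y. - B t * moved \<psi> t y) +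
          slice (\<lambda>y. a t * moved (\<lambda>p. fst (grad \<psi> p)) t y + (a t * (R' t / R t)) * moved (radial \<psi>) t y)"
        by (rule slice_add[OF _ _ t]) (intro adms adm_nB aR)+
      also have "slice (\<lambda>y. a t * moved (\<lambda>p. fst (grad \<psi> p)) t y +
          (a t * (R' t / R t)) * moved (radial \<psi>) t y)
        = slice (\<lambda>y. a t * moved (\<lambda>p. fst (grad \<psi> p)) t y) + slice
            (\<lambda>y. (a t * (R' t / R t)) * moved (radial \<psi>) t y)"
        by (rule slice_add[OF _ _ t]) (intro adms aR)+
      finally show ?thesis by (simp only: slice_cmult)
    qed
    have X: "slice (moved (radial \<psi>) t) = ?N * (slice (\<lambda>y. moved \<psi> t (sgn y)) - slice (moved \<psi> t))"
      using g by (simp only: right_diff_distrib)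
    have "B t / ?N * slice (moved (radial \<psi>) t) =
        B t * (slice (\<lambda>y. moved \<psi> t (sgn y)) - slice (moved \<psi> t))"
      unfolding X by simp
    then show "slice (\<lambda>y. a t * moved (\<lambda>p. fst (grad \<psi> p)) t y + b t * moved (radial \<psi>) t y)
       = slice (\<lambda>y. ?D t y + B t * moved \<psi> t (sgn y))"
      unfolding l r by (subst b[OF t]) (simp add: distrib_right right_diff_distrib)
  qed
  also have "\<dots> = II ?D + II (\<lambda>t y. B t * moved \<psi> t (sgn y))"
    by (rule II_add[OF D(1)]) (assumption | intro adms)+
  finally show ?thesis using D(2) by simp
qed

end

section \<open>The explicit solution and its regularity\<close>

lemma borel_imp_lebesgue_on: "f \<in> borel_measurable borel \<Longrightarrow> f \<in> borel_measurable (lebesgue_on S)"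
  by (simp add: measurable_completion measurable_restrict_space1)

context moving_ball begin

definition u :: "real \<Rightarrow> 'a \<Rightarrow> real" where "u t x = c t * indicator (ball x0 (R t)) x"

definition w :: "real \<Rightarrow> 'a \<Rightarrow> 'a" where
  "w t x = indicator (ball x0 (R t)) x *\<^sub>R (- (inverse (R t) *\<^sub>R (x - x0)))"

text \<open>Inside the ball the flux is \<open>- coef (x - x0)\<close>, with divergence
  \<open>- N coef\<close>; \<open>\<kappa>\<close> is the density \<open>N coef\<close> in unit ball
  coordinates, Jacobian \<open>R^N\<close> included.\<close>

definition coef :: "real \<Rightarrow> real" where "coef t = c t powr m / R t"
definition \<kappa> :: "real \<Rightarrow> real" where "\<kappa> t = coef t * real DIM('a) * R t ^ DIM('a)"

lemma coef_eq: "t \<in> {0..\<tau>} \<Longrightarrow> coef t = c t * R' t / R t"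
  by (simp add: coef_def c_powr_m)

lemma coef_nonneg: "t \<in> {0..\<tau>} \<Longrightarrow> 0 \<le> coef t" using R_pos[of t] by (simp add: coef_def)
lemma \<kappa>_nonneg: "t \<in> {0..\<tau>} \<Longrightarrow> 0 \<le> \<kappa> t" using coef_nonneg R_pos[of t] by (simp add: \<kappa>_def)

lemma coef_cont: "continuous_on {0..\<tau>} coef"
proof -
  have "continuous_on {0..\<tau>} (\<lambda>t. c t * R' t / R t)"
    using R_pos by (intro continuous_intros c_cont R'_cont R_cont) (auto simp: less_imp_neq[symmetric])
  then show ?thesis by (rule continuous_on_eq) (simp add: coef_eq)
qed

lemma \<kappa>_cont: "continuous_on {0..\<tau>} \<kappa>"
  unfolding \<kappa>_def[abs_def] by (intro continuous_intros coef_cont R_cont)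

lemma \<kappa>_measurable [measurable]: "\<kappa> \<in> borel_measurable borel"
  unfolding \<kappa>_def[abs_def] coef_def[abs_def] by measurable

lemma flux_eq: "flux m u w t x = indicator (ball x0 (R t)) x *\<^sub>R (- (coef t *\<^sub>R (x - x0)))"
  by (auto simp: flux_def phi_def u_def w_def coef_def indicator_def divide_inverse)

lemma u_measurable_pair: "case_prod u \<in> borel_measurable borel"
proof -
  have "(\<lambda>p. if dist x0 (snd p) < R (fst p) then c (fst p) else 0) \<in> borel_measurable (borel \<Otimes>\<^sub>M borel)"
    by measurable
  moreover have "case_prod u = (\<lambda>p. if dist x0 (snd p) < R (fst p) then c (fst p) else 0)"
    by (auto simp: fun_eq_iff u_def indicator_def)
  ultimately show ?thesis by (simp only: borel_prod)
qed

lemma w_measurable_pair: "case_prod w \<in> borel_measurable borel"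
proof -
  have "(\<lambda>p. if dist x0 (snd p) < R (fst p) then - (inverse (R (fst p)) *\<^sub>R (snd p - x0)) else 0) \<in>
      borel_measurable (borel \<Otimes>\<^sub>M borel)"
    by measurable
  moreover have "case_prod w =
      (\<lambda>p. if dist x0 (snd p) < R (fst p) then - (inverse (R (fst p)) *\<^sub>R (snd p - x0)) else 0)"
    by (auto simp: fun_eq_iff w_def indicator_def)
  ultimately show ?thesis by (simp only: borel_prod)
qed

lemma norm_w_le: assumes "t \<in> {0..\<tau>}" shows "norm (w t x) \<le> 1"
proof (cases "x \<in> ball x0 (R t)")
  case True
  then have "norm (x - x0) \<le> R t" by (simp add: dist_norm norm_minus_commute)
  then show ?thesis using True R_pos[OF assms] by (simp add: w_def divide_simps)
qed (simp add: w_def)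

lemma u_measurable: "u t \<in> borel_measurable borel"
  unfolding u_def[abs_def] by measurable

lemma c_bound: obtains C where "0 < C" "\<And>t. t \<in> {0..\<tau>} \<Longrightarrow> c t \<le> C"
proof -
  have "bounded (c ` {0..\<tau>})" using c_cont by (intro compact_imp_bounded compact_continuous_image) auto
  then obtain C where "\<And>t. t \<in> {0..\<tau>} \<Longrightarrow> \<bar>c t\<bar> \<le> C" unfolding bounded_iff
    by (metis image_eqI real_norm_def)
  then show thesis by (intro that[of "max C 1"]) (auto simp: le_max_iff_disj dest: abs_le_D1)
qed

lemma u_nonneg: "t \<in> {0..\<tau>} \<Longrightarrow> 0 \<le> u t x" using c_pos[of t] by (simp add: u_def)

lemma u_le: "t \<in> {0..\<tau>} \<Longrightarrow> u t x \<le> c t" using c_pos[of t] by (simp add: u_def indicator_def)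

lemma finite_measure_domain: "finite_measure (lebesgue_on \<Omega>)"
  using bounded_set_imp_lmeasurable[OF bounded_domain] open_domain
    by (intro finite_measure_lebesgue_on) auto

lemma Linf_plus_u0: "Linf_plus (lebesgue_on \<Omega>) (u 0)"
  unfolding Linf_plus_def Linf_def
proof (intro conjI exI)
  have 0: "0 \<in> {0..\<tau>}" using \<tau> by simp
  show "u 0 \<in> borel_measurable (lebesgue_on \<Omega>)" by (rule borel_imp_lebesgue_on[OF u_measurable])
  show "AE x in lebesgue_on \<Omega>. norm (u 0 x) \<le> c 0" using u_nonneg[OF 0] u_le[OF 0] by (intro AE_I2) simp
  show "AE x in lebesgue_on \<Omega>. 0 \<le> u 0 x" using u_nonneg[OF 0] by (intro AE_I2)
qed

text \<open>A point off the sphere of radius \<open>R t\<close>, which is a null set, is eventually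
  inside or eventually outside the nearby balls, so \<open>u\<close> converges there. A bound for
  the height on the closed time interval dominates.\<close>

lemma in_C_L1_u: "in_C_L1 \<tau> \<Omega> u"
  unfolding in_C_L1_def
proof (intro ballI conjI)
  fix t assume "t \<in> {0..<\<tau>}"
  then have t: "t \<in> {0..\<tau>}" by simp
  show "integrable (lebesgue_on \<Omega>) (u t)"
  proof (rule finite_measure.integrable_const_bound[OF finite_measure_domain])
    show "AE x in lebesgue_on \<Omega>. norm (u t x) \<le> c t" using u_nonneg[OF t] u_le[OF t] by (intro AE_I2) simp
  qed (rule borel_imp_lebesgue_on[OF u_measurable])
  obtain C where C: "0 < C" "\<And>t. t \<in> {0..\<tau>} \<Longrightarrow> c t \<le> C" using c_bound by blast
  show "((\<lambda>s. \<integral>x. \<bar>u s x - u t x\<bar> \<partial>(lebesgue_on \<Omega>)) \<longlongrightarrow> 0) (at t within {0..<\<tau>})"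
    unfolding tendsto_at_iff_sequentially comp_def
  proof (intro allI impI)
    fix X :: "nat \<Rightarrow> real"
    assume X: "\<forall>i. X i \<in> {0..<\<tau>} - {t}" "X \<longlonglongrightarrow> t"
    have Xi: "X i \<in> {0..\<tau>}" for i using X(1) by (auto dest!: spec[of _ i])
    have cX: "(\<lambda>n. c (X n)) \<longlonglongrightarrow> c t"
      by (rule continuous_on_tendsto_compose[OF c_cont X(2) t]) (use Xi in simp)
    have RX: "(\<lambda>n. R (X n)) \<longlonglongrightarrow> R t"
      by (rule continuous_on_tendsto_compose[OF R_cont X(2) t]) (use Xi in simp)
    have "negligible (sphere x0 (R t))" by (rule negligible_sphere)
    then have "AE x in lebesgue. dist x0 x \<noteq> R t"
      by (intro AE_I'[of "sphere x0 (R t)"]) (auto simp: negligible_iff_null_sets)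
    then have AE: "AE x in lebesgue_on \<Omega>. dist x0 x \<noteq> R t"
      using open_domain by (auto simp: AE_restrict_space_iff elim: eventually_mono)
    have "(\<lambda>n. \<integral>x. \<bar>u (X n) x - u t x\<bar> \<partial>(lebesgue_on \<Omega>)) \<longlonglongrightarrow> (\<integral>x. 0 \<partial>(lebesgue_on \<Omega>))"
    proof (rule integral_dominated_convergence[where w="\<lambda>_. C"])
      show "(\<lambda>x. \<bar>u (X n) x - u t x\<bar>) \<in> borel_measurable (lebesgue_on \<Omega>)" for n
        using u_measurable by (intro borel_imp_lebesgue_on) measurable
      show "integrable (lebesgue_on \<Omega>) (\<lambda>_. C)"
        using finite_measure.integrable_const[OF finite_measure_domain] .
      show "AE x in lebesgue_on \<Omega>. norm \<bar>u (X n) x - u t x\<bar> \<le> C" for n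
      proof (rule AE_I2)
        fix x
        have "0 \<le> u (X n) x" "u (X n) x \<le> C" "0 \<le> u t x" "u t x \<le> C"
          using u_nonneg[OF Xi[of n]] u_le[OF Xi[of n], of x] C(2)[OF Xi[of n]] u_nonneg[OF t]
              u_le[OF t, of x] C(2)[OF t] by auto
        then show "norm \<bar>u (X n) x - u t x\<bar> \<le> C" by simp
      qed
      show "AE x in lebesgue_on \<Omega>. (\<lambda>n. \<bar>u (X n) x - u t x\<bar>) \<longlonglongrightarrow> 0"
        using AE
      proof eventually_elim
        case (elim x)
        have "(\<lambda>n. u (X n) x) \<longlonglongrightarrow> u t x"
        proof (cases "dist x0 x < R t")
          case True
          have "\<forall>\<^sub>F n in sequentially. dist x0 x < R (X n)" using RX True by (rule order_tendstoD)
          then have "\<forall>\<^sub>F n in sequentially. c (X n) = u (X n) x"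
            by (rule eventually_mono) (simp add: u_def)
          moreover have "(\<lambda>n. c (X n)) \<longlonglongrightarrow> u t x" using cX True by (simp add: u_def)
          ultimately show ?thesis by (rule Lim_transform_eventually[rotated])
        next
          case False
          then have "R t < dist x0 x" using elim by simp
          then have "\<forall>\<^sub>F n in sequentially. R (X n) < dist x0 x" by (rule order_tendstoD(2)[OF RX])
          then have "\<forall>\<^sub>F n in sequentially. 0 = u (X n) x" by (rule eventually_mono) (simp add: u_def)
          moreover have "u t x = 0" using False by (simp add: u_def)
          ultimately show ?thesis by (simp add: Lim_transform_eventually[OF tendsto_const])
        qed
        then have "(\<lambda>n. \<bar>u (X n) x - u t x\<bar>) \<longlonglongrightarrow> \<bar>u t x - u t x\<bar>" by (intro tendsto_intros)
        then show ?case by simp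
      qed
    qed simp
    then show "(\<lambda>n. \<integral>x. \<bar>u (X n) x - u t x\<bar> \<partial>(lebesgue_on \<Omega>)) \<longlonglongrightarrow> 0" by simp
  qed
qed

lemma AE_Q: "(\<And>t x. t \<in> {0<..<\<tau>} \<Longrightarrow> x \<in> \<Omega> \<Longrightarrow> P (t, x)) \<Longrightarrow> AE p in lebesgue_on ({0<..<\<tau>} \<times> \<Omega>). P p"
  by (rule AE_I2) (auto simp: space_restrict_space)

lemma Linf_u: "Linf (lebesgue_on ({0<..<\<tau>} \<times> \<Omega>)) (case_prod u)"
proof -
  obtain C where C: "\<And>t. t \<in> {0..\<tau>} \<Longrightarrow> c t \<le> C" using c_bound by blast
  have "AE p in lebesgue_on ({0<..<\<tau>} \<times> \<Omega>). norm (case_prod u p) \<le> C"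
  proof (rule AE_Q)
    fix t x assume "t \<in> {0<..<\<tau>}"
    then have "t \<in> {0..\<tau>}" by simp
    from u_nonneg[OF this, of x] u_le[OF this, of x] C[OF this] show "norm (case_prod u (t, x)) \<le> C"
      by simp
  qed
  then show ?thesis unfolding Linf_def using borel_imp_lebesgue_on[OF u_measurable_pair] by blast
qed

text \<open>This reduces \<open>l\<close>, \<open>Phi_fun\<close> and \<open>J_fun\<close> of
  \<open>u\<close> to a multiple of the same indicator, with one value at
  \<open>c t\<close>.\<close>

lemma ind_compose:
  assumes "f 0 = (0::real)" shows "f (u t x) = f (c t) * indicator (ball x0 (R t)) x"
  using assms by (simp add: u_def indicator_def)

lemma integrable_time_cont:
  fixes b :: "real \<Rightarrow> real"
  assumes "continuous_on {0..\<tau>} b" shows "integrable (lebesgue_on {0<..<\<tau>}) b"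
proof -
  have "integrable (lebesgue_on {0..\<tau>}) b" by (rule continuous_imp_integrable_real[OF assms])
  then have "integrable lebesgue (\<lambda>t. indicator {0..\<tau>} t *\<^sub>R b t)"
    by (subst (asm) integrable_restrict_space) auto
  then have "integrable lebesgue (\<lambda>t. indicator {0<..<\<tau>} t *\<^sub>R (indicator {0..\<tau>} t *\<^sub>R b t))"
    by (rule integrable_mult_indicator[rotated]) auto
  moreover have "indicator {0<..<\<tau>} t *\<^sub>R (indicator {0..\<tau>} t *\<^sub>R b t) = indicator {0<..<\<tau>} t *\<^sub>R b t"
      for t
    by (auto simp: indicator_def)
  ultimately have "integrable lebesgue (\<lambda>t. indicator {0<..<\<tau>} t *\<^sub>R b t)" by (simp only:)
  then show ?thesis by (subst integrable_restrict_space) auto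
qed

lemma AE_time: "(\<And>t. t \<in> {0<..<\<tau>} \<Longrightarrow> P t) \<Longrightarrow> AE t in lebesgue_on {0<..<\<tau>}. P t"
  by (rule AE_I2) (auto simp: space_restrict_space)

lemma l_cont:
  assumes "l \<in> Lfun" shows "continuous_on {0..\<tau>} (\<lambda>t. l (c t))"
  by (rule continuous_on_compose2[OF Lfun_continuous[OF assms] c_cont])
      (use c_pos in \<open>auto intro: less_imp_le\<close>)

lemma measure_push_total:
  assumes "ball_domain \<Omega> x0 r" "into_cball p" "0 \<le> k"
  shows "measure (push \<Omega> x0 r (\<lambda>_. k) p) \<Omega> = k * measure lborel (ball (0::'a) 1)"
proof -
  interpret ball_domain \<Omega> x0 r by fact
  have "measure (push \<Omega> x0 r (\<lambda>_. k) p) \<Omega> =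
      (\<integral>y. indicator (ball 0 1) y * (k * indicator \<Omega> (x0 + r *\<^sub>R p y)) \<partial>lborel)"
    using assms open_domain sets_domain by (intro measure_push) auto
  also have "\<dots> = (\<integral>y. k * indicator (ball (0::'a) 1) y \<partial>lborel)"
    using assms(2) into_domain
      by (intro Bochner_Integration.integral_cong) (auto simp: into_cball_def indicator_def)
  finally show ?thesis by simp
qed

lemma in_L1_BV_u:
  assumes l: "l \<in> Lfun" shows "in_L1_BV \<tau> \<Omega> (\<lambda>t x. l (u t x))"
  unfolding in_L1_BV_def
proof (intro conjI exI)
  let ?N = "real DIM('a)" and ?V = "measure lborel (ball (0::'a) 1)"
  let ?\<eta> = "\<lambda>t. push \<Omega> x0 (R t) (\<lambda>_. l (c t) * (?N * R t ^ (DIM('a) - 1))) sgn"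
  have lu: "l (u t x) = 0 + l (c t) * indicator (ball x0 (R t)) x" for t x
    using ind_compose[of l] LfunD(2)[OF l] by simp
  have lc: "0 \<le> l (c t)" if "t \<in> {0<..<\<tau>}" for t using that c_pos[of t] LfunD(1)[OF l] by simp
  \<comment> \<open>Members of \<open>Lfun\<close> are controlled on \<open>[0, \<infinity>)\<close>
    only; composing with \<open>max 0\<close> gives a continuous function on the line that agrees
    with \<open>l\<close> on the values of \<open>u\<close>.\<close>
  have "(\<lambda>s. l (max 0 s)) \<in> borel_measurable borel"
    by (intro borel_measurable_continuous_onI continuous_on_compose2[OF Lfun_continuous[OF l]]
        continuous_intros) auto
  from measurable_compose[OF u_measurable_pair this]
  have "(\<lambda>p. l (max 0 (case_prod u p))) \<in> borel_measurable (lebesgue_on ({0<..<\<tau>} \<times> \<Omega>))"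
    by (rule borel_imp_lebesgue_on)
  moreover have "l (max 0 (case_prod u p)) = (\<lambda>(t, x). l (u t x)) p"
      if "p \<in> space (lebesgue_on ({0<..<\<tau>} \<times> \<Omega>))" for p
    using that u_nonneg[of "fst p" "snd p"] by (auto simp: space_restrict_space max_def case_prod_unfold)
  ultimately show "(\<lambda>(t, x). l (u t x)) \<in> borel_measurable (lebesgue_on ({0<..<\<tau>} \<times> \<Omega>))"
    by (subst (asm) measurable_cong) auto
  show "AE t in lebesgue_on {0<..<\<tau>}. is_abs_gradient \<Omega> (\<lambda>x. l (u t x)) (?\<eta> t)"
    unfolding lu by (intro AE_time ball_domain.is_abs_gradient_ind ball_domain bounded_domain lc)
  \<comment> \<open>In this form the \<open>BV\<close> norm is visibly continuous on the closed time
    interval, hence integrable.\<close>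
  have eq: "(\<integral>x. \<bar>l (u t x)\<bar> \<partial>lebesgue_on \<Omega>) + measure (?\<eta> t) \<Omega> =
      R t ^ DIM('a) * (l (c t) * ?V) + l (c t) * (?N * R t ^ (DIM('a) - 1)) * ?V" if t: "t \<in>
          {0<..<\<tau>}" for t
  proof -
    interpret ball_domain \<Omega> x0 "R t" by (rule ball_domain[OF t])
    have "\<bar>l (u t x)\<bar> = indicator (ball x0 (R t)) x * l (c t)" for x using lc[OF t]
      by (simp add: lu abs_mult)
    then have "(\<integral>x. \<bar>l (u t x)\<bar> \<partial>lebesgue_on \<Omega>) =
        R t ^ DIM('a) * (\<integral>y. indicator (ball (0::'a) 1) y * l (c t) \<partial>lborel)"
      using integral_over_ball(1)[of "\<lambda>_. l (c t)"] by simp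
    moreover have "measure (?\<eta> t) \<Omega> = l (c t) * (?N * R t ^ (DIM('a) - 1)) * ?V"
      using lc[OF t] R_pos by (intro measure_push_total ball_domain[OF t]) auto
    ultimately show ?thesis by simp
  qed
  have "integrable (lebesgue_on {0<..<\<tau>}) (\<lambda>t. R t ^ DIM('a) * (l (c t) * ?V) +
      l (c t) * (?N * R t ^ (DIM('a) - 1)) * ?V)"
    by (intro integrable_time_cont continuous_intros R_cont l_cont l)
  then show "integrable (lebesgue_on {0<..<\<tau>}) (\<lambda>t. (\<integral>x. \<bar>l (u t x)\<bar> \<partial>lebesgue_on \<Omega>) + measure (?\<eta> t) \<Omega>)"
    by (subst Bochner_Integration.integrable_cong[OF refl eq]) auto
qed


section \<open>The time derivative as a space-time measure\<close>

definition jpush :: "('a \<Rightarrow> 'a) \<Rightarrow> (real \<times> 'a) measure" where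
  "jpush p = distr (density (restrict_space (lborel \<Otimes>\<^sub>M lborel) ({0<..<\<tau>} \<times> ball 0 1))
      (\<lambda>q. ennreal (\<kappa> (fst q))))
     (restrict_space borel ({0<..<\<tau>} \<times> \<Omega>)) (\<lambda>q. (fst q, x0 + R (fst q) *\<^sub>R p (snd q)))"

lemma jmap_measurable:
  assumes "into_cball p"
  shows "(\<lambda>q. (fst q, x0 + R (fst q) *\<^sub>R p (snd q))) \<in>
    restrict_space (lborel \<Otimes>\<^sub>M lborel) ({0<..<\<tau>} \<times> ball 0 1) \<rightarrow>\<^sub>M restrict_space borel ({0<..<\<tau>} \<times> \<Omega>)"
proof (rule measurable_restrict_space2)
  have [measurable]: "p \<in> borel_measurable borel" using assms by (simp add: into_cball_def)
  have "(\<lambda>q. (fst q, x0 + R (fst q) *\<^sub>R p (snd q))) \<in> (borel \<Otimes>\<^sub>M borel) \<rightarrow>\<^sub>M (borel \<Otimes>\<^sub>M borel)"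
    by measurable
  then have "(\<lambda>q. (fst q, x0 + R (fst q) *\<^sub>R p (snd q))) \<in> (lborel \<Otimes>\<^sub>M lborel) \<rightarrow>\<^sub>M borel"
    by (simp add: lborel_prod borel_prod)
  then show "(\<lambda>q. (fst q, x0 + R (fst q) *\<^sub>R p (snd q))) \<in>
    restrict_space (lborel \<Otimes>\<^sub>M lborel) ({0<..<\<tau>} \<times> ball 0 1) \<rightarrow>\<^sub>M borel"
    by (rule measurable_restrict_space1)
  have "x0 + R t *\<^sub>R p y \<in> \<Omega>" if "t \<in> {0<..<\<tau>}" "y \<in> ball 0 1" for t y
    using assms that by (intro ball_domain.into_domain[OF ball_domain]) (auto simp: into_cball_def)
  then show "(\<lambda>q. (fst q, x0 + R (fst q) *\<^sub>R p (snd q))) \<in>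
    space (restrict_space (lborel \<Otimes>\<^sub>M lborel) ({0<..<\<tau>} \<times> ball 0 1)) \<rightarrow> {0<..<\<tau>} \<times> \<Omega>"
    by (auto simp: space_restrict_space)
qed

lemma rect_sets: "{0<..<\<tau>} \<times> ball (0::'a) 1 \<in> sets (lborel \<Otimes>\<^sub>M lborel)" by (intro pair_measureI) auto

lemma \<kappa>_fst_measurable: "(\<lambda>q. \<kappa> (fst q)) \<in> borel_measurable
    (restrict_space (lborel \<Otimes>\<^sub>M (lborel :: 'a measure)) ({0<..<\<tau>} \<times> ball 0 1))"
  by (rule measurable_restrict_space1) measurable

lemma adm_\<kappa>: "adm (\<lambda>t y. \<kappa> t)" by (rule adm_cont[OF \<kappa>_cont])

lemma integral_jpush:
  assumes p: "into_cball p" and z: "continuous_on UNIV \<zeta>"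
  shows "(\<integral>q. \<zeta> q \<partial>jpush p) = II (\<lambda>t y. \<kappa> t * \<zeta> (t, x0 + R t *\<^sub>R p y))"
proof -
  let ?S = "restrict_space (lborel \<Otimes>\<^sub>M lborel) ({0<..<\<tau>} \<times> ball (0::'a) 1)"
  let ?f = "\<lambda>q. (fst q, x0 + R (fst q) *\<^sub>R p (snd q))"
  have zm: "\<zeta> \<in> borel_measurable (restrict_space borel ({0<..<\<tau>} \<times> \<Omega>))"
    by (intro measurable_restrict_space1 borel_measurable_continuous_onI z)
  have "(\<integral>q. \<zeta> q \<partial>jpush p) = (\<integral>q. \<zeta> (?f q) \<partial>density ?S (\<lambda>q. ennreal (\<kappa> (fst q))))"
    unfolding jpush_def using jmap_measurable[OF p] zm by (subst integral_distr) auto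
  also have "\<dots> = (\<integral>q. \<kappa> (fst q) *\<^sub>R \<zeta> (?f q) \<partial>?S)"
    using measurable_compose[OF jmap_measurable[OF p] zm] \<kappa>_fst_measurable \<kappa>_nonneg
    by (subst integral_density) (auto simp: space_restrict_space intro!: AE_I2)
  also have "\<dots> = (\<integral>q. indicator ({0<..<\<tau>} \<times> ball (0::'a) 1) q * (\<kappa> (fst q) * \<zeta> (?f q))
      \<partial>(lborel \<Otimes>\<^sub>M lborel))"
    using rect_sets by (subst integral_restrict_space) auto
  also have "\<dots> = II (\<lambda>t y. \<kappa> t * \<zeta> (t, x0 + R t *\<^sub>R p y))"
    by (rule II_fubini(3)[symmetric]) (intro adm_mult adm_\<kappa> adm_moved z p)
  finally show ?thesis .
qed

lemma pos_radon_jpush: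
  assumes p: "into_cball p" shows "pos_radon ({0<..<\<tau>} \<times> \<Omega>) (jpush p)"
proof -
  let ?S = "restrict_space (lborel \<Otimes>\<^sub>M lborel) ({0<..<\<tau>} \<times> ball (0::'a) 1)"
  obtain C where C: "\<And>t y. t \<in> {0<..<\<tau>} \<Longrightarrow> y \<in> ball (0::'a) 1 \<Longrightarrow> \<bar>\<kappa> t\<bar> \<le> C" using adm_bound[OF adm_\<kappa>]
    by blast
  have "finite_measure (density ?S (\<lambda>q. ennreal (\<kappa> (fst q))))"
  proof
    have "emeasure (density ?S (\<lambda>q. ennreal (\<kappa> (fst q)))) (space ?S) =
        (\<integral>\<^sup>+q. ennreal (\<kappa> (fst q)) * indicator (space ?S) q \<partial>?S)"
      by (intro emeasure_density measurable_compose[OF \<kappa>_fst_measurable] measurable_ennreal sets.top)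
    also have "\<dots> \<le> (\<integral>\<^sup>+q. ennreal C \<partial>?S)"
      using C by (intro nn_integral_mono) (force simp: space_restrict_space indicator_def intro!:
          ennreal_leI)
    also have "\<dots> < \<infinity>"
    proof -
      have "emeasure (lborel \<Otimes>\<^sub>M lborel) ({0<..<\<tau>} \<times> ball (0::'a) 1) < \<infinity>"
        using emeasure_lborel_ball_finite[of "0::'a" 1] \<tau>
        by (subst lborel.emeasure_pair_measure_Times) (auto simp: ennreal_mult_less_top)
      then show ?thesis using rect_sets
        by (simp add: space_restrict_space emeasure_restrict_space ennreal_mult_less_top)
    qed
    finally show "emeasure (density ?S (\<lambda>q. ennreal (\<kappa> (fst q))))
        (space (density ?S (\<lambda>q. ennreal (\<kappa> (fst q))))) \<noteq> \<infinity>" by simp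
  qed
  then have "finite_measure (jpush p)"
    unfolding jpush_def by (rule finite_measure.finite_measure_distr) (use jmap_measurable[OF p] in simp)
  then show ?thesis
    using finite_measure.emeasure_finite[of "jpush p"] by (auto simp: pos_radon_def less_top jpush_def)
qed

text \<open>The time derivative is positive on the expanding sphere, where new points are reached,
  and negative inside, where the height decreases.\<close>

definition \<mu>Q :: "(real \<times> 'a) smeasure" where "\<mu>Q = (jpush sgn, jpush (\<lambda>y. y))"

definition \<mu>t :: "real \<Rightarrow> 'a smeasure" where
  "\<mu>t t = (push \<Omega> x0 (R t) (\<lambda>_. \<kappa> t) sgn, push \<Omega> x0 (R t) (\<lambda>_. \<kappa> t) (\<lambda>y. y))"

lemma sm_int_\<mu>t:
  assumes t: "t \<in> {0<..<\<tau>}" and z: "continuous_on UNIV \<zeta>"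
  shows "sm_int (\<mu>t t) (\<lambda>x. \<zeta> (t, x)) = slice (\<lambda>y. \<kappa> t * moved \<zeta> t (sgn y)) -
      slice (\<lambda>y. \<kappa> t * moved \<zeta> t y)"
proof -
  interpret ball_domain \<Omega> x0 "R t" by (rule ball_domain[OF t])
  have "continuous_on UNIV (\<lambda>x. \<zeta> (t, x))" by (intro continuous_on_compose2[OF z] continuous_intros) auto
  then have "(\<lambda>x. \<zeta> (t, x)) \<in> borel_measurable (restrict_space borel \<Omega>)"
    by (intro measurable_restrict_space1 borel_measurable_continuous_onI)
  then show ?thesis
    using t \<kappa>_nonneg[of t] by (simp add: sm_int_def \<mu>t_def integral_push slice_def moved_def)
qed

lemma adm_\<zeta>:
  assumes z: "continuous_on UNIV \<zeta>"
  shows "adm (\<lambda>t y. \<kappa> t * moved \<zeta> t (sgn y))" "adm (\<lambda>t y. \<kappa> t * moved \<zeta> t y)"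
  unfolding moved_def[abs_def]
  by (rule adm_mult[OF adm_\<kappa> adm_moved[OF z into_cball_sgn]], rule
      adm_mult[OF adm_\<kappa> adm_moved[OF z into_cball_ident]])

lemma sm_int_\<mu>Q:
  assumes z: "continuous_on UNIV \<zeta>"
  shows "sm_int \<mu>Q \<zeta> = II (\<lambda>t y. \<kappa> t * moved \<zeta> t (sgn y)) - II (\<lambda>t y. \<kappa> t * moved \<zeta> t y)"
  by (simp add: sm_int_def \<mu>Q_def integral_jpush[OF into_cball_sgn z]
      integral_jpush[OF into_cball_ident z] moved_def)

lemma in_Linf_loc_w_\<mu>: "in_Linf_loc_w \<tau> \<Omega> \<mu>Q \<mu>t"
  unfolding in_Linf_loc_w_def
proof (intro conjI ballI allI impI)
  let ?V = "measure lborel (ball (0::'a) 1)"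
  show "signed_radon ({0<..<\<tau>} \<times> \<Omega>) \<mu>Q"
    by (simp add: signed_radon_def \<mu>Q_def pos_radon_jpush)
  show "AE t in lebesgue_on {0<..<\<tau>}. finite_radon \<Omega> (\<mu>t t)"
    unfolding \<mu>t_def
    by (intro AE_time ball_domain.push_finite_radon ball_domain weight_const \<kappa>_nonneg into_cball_sgn
        into_cball_ident) auto
  have tv: "tot_var (sm_val (\<mu>t t)) \<Omega> = ennreal (2 * \<kappa> t * ?V)" if "t \<in> {0<..<\<tau>}" for t
    unfolding \<mu>t_def using that by (intro ball_domain.tot_var_divergence ball_domain \<kappa>_nonneg) auto
  have "(\<lambda>t. ennreal (2 * \<kappa> t * ?V)) \<in> borel_measurable borel" by measurable
  then have "(\<lambda>t. ennreal (2 * \<kappa> t * ?V)) \<in> borel_measurable (lebesgue_on {0<..<\<tau>})"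
    by (simp add: measurable_completion measurable_restrict_space1)
  then show "(\<lambda>t. tot_var (sm_val (\<mu>t t)) \<Omega>) \<in> borel_measurable (lebesgue_on {0<..<\<tau>})"
    by (subst measurable_cong[OF tv]) auto
  obtain C where C: "\<And>t y. t \<in> {0<..<\<tau>} \<Longrightarrow> y \<in> ball (0::'a) 1 \<Longrightarrow> \<bar>\<kappa> t\<bar> \<le> C" using adm_bound[OF adm_\<kappa>]
    by blast
  fix a :: real
  \<comment> \<open>The bound is uniform on the whole time interval, so one constant serves every
    \<open>a\<close>.\<close>
  have "tot_var (sm_val (\<mu>t t)) \<Omega> \<le> ennreal (2 * C * ?V)" if "t \<in> {0<..<\<tau>}" for t
    using C[OF that, of 0] by (simp only: tv[OF that]) (intro ennreal_leI mult_right_mono; simp)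
  then show "\<exists>C. AE t in lebesgue_on {0<..<\<tau>}. a \<le> t \<longrightarrow> tot_var (sm_val (\<mu>t t)) \<Omega> \<le> ennreal C"
    by (intro exI[of _ "2 * C * ?V"] AE_time) blast
next
  fix \<zeta> assume "\<zeta> \<in> Cc ({0<..<\<tau>} \<times> \<Omega>)"
  then have z: "continuous_on UNIV \<zeta>" by (simp add: Cc_def)
  note i = II_fubini(1)[OF adm_\<zeta>(1)[OF z]] II_fubini(1)[OF adm_\<zeta>(2)[OF z]]
  have eq: "sm_int (\<mu>t t) (\<lambda>x. \<zeta> (t, x)) = slice (\<lambda>y. \<kappa> t * moved \<zeta> t (sgn y)) -
      slice (\<lambda>y. \<kappa> t * moved \<zeta> t y)"
    if "t \<in> space (lebesgue_on {0<..<\<tau>})" for t using that by (intro sm_int_\<mu>t z) auto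
  show "integrable (lebesgue_on {0<..<\<tau>}) (\<lambda>t. sm_int (\<mu>t t) (\<lambda>x. \<zeta> (t, x)))"
    using i by (subst Bochner_Integration.integrable_cong[OF refl eq]) auto
  show "sm_int \<mu>Q \<zeta> = (\<integral>t. sm_int (\<mu>t t) (\<lambda>x. \<zeta> (t, x)) \<partial>lebesgue_on {0<..<\<tau>})"
    using i unfolding sm_int_\<mu>Q[OF z] II_def by (subst Bochner_Integration.integral_cong[OF refl eq]) auto
qed

lemma slice_ball:
  assumes t: "t \<in> {0<..<\<tau>}" and g: "continuous_on UNIV g"
  shows "(\<integral>x. k * indicator (ball x0 (R t)) x * g (t, x) \<partial>lebesgue_on \<Omega>) =
      (k * R t ^ DIM('a)) * slice (moved g t)"
    and "(\<integral>x. k * indicator (ball x0 (R t)) x * g (t, x) \<partial>lborel) =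
        (k * R t ^ DIM('a)) * slice (moved g t)"
proof -
  interpret ball_domain \<Omega> x0 "R t" by (rule ball_domain[OF t])
  have gt: "continuous_on A (\<lambda>x. g (t, x))" for A
    by (intro continuous_on_compose2[OF g] continuous_intros) auto
  show 1: "(\<integral>x. k * indicator (ball x0 (R t)) x * g (t, x) \<partial>lebesgue_on \<Omega>) =
      (k * R t ^ DIM('a)) * slice (moved g t)"
    using integral_over_ball(1)[OF gt] by (simp add: mult.assoc slice_def moved_def)
  have m: "(\<lambda>x. indicator (ball x0 (R t)) x * g (t, x)) \<in> borel_measurable borel"
    by (intro measurable_indicator_mult gt) auto
  have "(\<integral>x. indicator (ball x0 (R t)) x * g (t, x) \<partial>lebesgue_on \<Omega>) =
      (\<integral>x. indicator \<Omega> x *\<^sub>R (indicator (ball x0 (R t)) x * g (t, x)) \<partial>lebesgue)"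
    using open_domain by (subst integral_restrict_space) auto
  also have "\<dots> = (\<integral>x. indicator (ball x0 (R t)) x * g (t, x) \<partial>lebesgue)"
    using ball_sub by (intro Bochner_Integration.integral_cong) (auto simp: indicator_def)
  also have "\<dots> = (\<integral>x. indicator (ball x0 (R t)) x * g (t, x) \<partial>lborel)"
    using m by (intro integral_completion) simp
  finally show "(\<integral>x. k * indicator (ball x0 (R t)) x * g (t, x) \<partial>lborel) =
      (k * R t ^ DIM('a)) * slice (moved g t)"
    using 1 by (simp add: mult.assoc)
qed

text \<open>In unit ball coordinates height times Jacobian is
  \<open>c t * R t ^ DIM('a) = M\<close>, so integration against \<open>u\<close> has a constant
  weight.\<close>

lemma integral_u_Q:
  assumes g: "continuous_on UNIV g"
  shows "(\<integral>p. u (fst p) (snd p) * g p \<partial>lebesgue_on ({0<..<\<tau>} \<times> \<Omega>)) = II (\<lambda>t y. M * moved g t y)"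
proof -
  \<comment> \<open>Since \<open>u\<close> vanishes outside the ball, \<open>\<Omega>\<close> may be
    dropped from the indicator. The integrand is then Borel and Fubini applies to the product of the
    two \<open>lborel\<close> measures.\<close>
  let ?F = "\<lambda>p. indicator ({0<..<\<tau>} \<times> UNIV) p * (u (fst p) (snd p) * g p)"
  obtain C where C: "\<And>t. t \<in> {0..\<tau>} \<Longrightarrow> R t \<le> C" using R_bound by blast
  obtain C' where C': "0 < C'" "\<And>t. t \<in> {0..\<tau>} \<Longrightarrow> c t \<le> C'" using c_bound by blast
  have "bounded (g ` ({0..\<tau>} \<times> cball x0 C))"
    using g by (intro compact_imp_bounded compact_continuous_image compact_Times)
        (auto intro: continuous_on_subset)
  then obtain D where D: "\<And>p. p \<in> {0..\<tau>} \<times> cball x0 C \<Longrightarrow> \<bar>g p\<bar> \<le> D" unfolding bounded_iff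
    by (metis image_eqI real_norm_def)
  have Fm: "?F \<in> borel_measurable borel"
  proof -
    have "(\<lambda>p. case_prod u p * g p) \<in> borel_measurable borel"
      by (intro borel_measurable_times u_measurable_pair borel_measurable_continuous_onI g)
    then have "(\<lambda>p. u (fst p) (snd p) * g p) \<in> borel_measurable borel" by (simp only: case_prod_unfold)
    moreover have "open ({0<..<\<tau>} \<times> (UNIV :: 'a set))" by (intro open_Times) auto
    then have "(indicator ({0<..<\<tau>} \<times> UNIV) :: real \<times> 'a \<Rightarrow> real) \<in> borel_measurable borel"
      by (intro borel_measurable_indicator borel_open)
    ultimately show ?thesis by (rule borel_measurable_times[rotated])
  qed
  have Fi: "integrable (lborel \<Otimes>\<^sub>M lborel) ?F"
  proof (rule Bochner_Integration.integrable_bound)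
    have "emeasure (lborel \<Otimes>\<^sub>M lborel) ({0<..<\<tau>} \<times> cball x0 C) < \<infinity>"
      using emeasure_lborel_cball_finite[of x0 C] \<tau>
      by (subst lborel.emeasure_pair_measure_Times) (auto simp: ennreal_mult_less_top)
    then show "integrable (lborel \<Otimes>\<^sub>M lborel) (\<lambda>p. indicator ({0<..<\<tau>} \<times> cball x0 C) p * (C' * \<bar>D\<bar>))"
      by (simp add: integrable_indicator_iff)
    show "?F \<in> borel_measurable (lborel \<Otimes>\<^sub>M lborel)" using Fm by (simp add: lborel_prod)
    show "AE p in lborel \<Otimes>\<^sub>M lborel. norm (?F p) \<le>
        norm (indicator ({0<..<\<tau>} \<times> cball x0 C) p * (C' * \<bar>D\<bar>))"
    proof (rule AE_I2)
      fix p :: "real \<times> 'a"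
      obtain t x where p: "p = (t, x)" by (cases p)
      show "norm (?F p) \<le> norm (indicator ({0<..<\<tau>} \<times> cball x0 C) p * (C' * \<bar>D\<bar>))"
      proof (cases "t \<in> {0<..<\<tau>} \<and> x \<in> ball x0 (R t)")
        case True
        then have t: "t \<in> {0..\<tau>}" by auto
        have x: "x \<in> cball x0 C" using True C[OF t] by auto
        have "\<bar>u t x\<bar> * \<bar>g (t, x)\<bar> \<le> C' * \<bar>D\<bar>"
        proof (rule mult_mono)
          show "\<bar>u t x\<bar> \<le> C'" using u_nonneg[OF t, of x] u_le[OF t, of x] C'(2)[OF t] by simp
          show "\<bar>g (t, x)\<bar> \<le> \<bar>D\<bar>" using D[of "(t, x)"] t x by (simp add: order_trans[OF _ abs_ge_self])
        qed (use C' in auto)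
        then show ?thesis using True x C'(1) by (simp add: p abs_mult)
      next
        case False
        then show ?thesis using C'(1) by (auto simp: p u_def indicator_def)
      qed
    qed
  qed
  have "(\<integral>p. u (fst p) (snd p) * g p \<partial>lebesgue_on ({0<..<\<tau>} \<times> \<Omega>)) =
      (\<integral>p. indicator ({0<..<\<tau>} \<times> \<Omega>) p *\<^sub>R (u (fst p) (snd p) * g p) \<partial>lebesgue)"
  proof (subst integral_restrict_space)
    have "{0<..<\<tau>} \<times> \<Omega> \<in> sets borel" by (intro borel_open open_Times open_domain) auto
    then show "{0<..<\<tau>} \<times> \<Omega> \<inter> space lebesgue \<in> sets lebesgue" by (simp add: sets_completionI_sets)
  qed simp
  also have "\<dots> = (\<integral>p. ?F p \<partial>lebesgue)"
  proof (rule Bochner_Integration.integral_cong[OF refl])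
    fix p :: "real \<times> 'a"
    obtain t x where p: "p = (t, x)" by (cases p)
    have "x \<in> \<Omega>" if "t \<in> {0<..<\<tau>}" "x \<in> ball x0 (R t)"
      using ball_domain.ball_sub[OF ball_domain[OF that(1)]] that(2) by blast
    then show "indicator ({0<..<\<tau>} \<times> \<Omega>) p *\<^sub>R (u (fst p) (snd p) * g p) = ?F p"
      by (auto simp: p u_def indicator_def)
  qed
  also have "\<dots> = (\<integral>p. ?F p \<partial>lborel)" using Fm by (intro integral_completion) simp
  also have "\<dots> = (\<integral>p. ?F p \<partial>(lborel \<Otimes>\<^sub>M lborel))" by (simp only: lborel_prod)
  also have "\<dots> = (\<integral>t. \<integral>x. ?F (t, x) \<partial>lborel \<partial>lborel)"
    using lborel_pair.integral_fst[of "\<lambda>t x. ?F (t, x)"] Fi by (simp add: case_prod_unfold)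
  also have "\<dots> = (\<integral>t. indicator {0<..<\<tau>} t * slice (\<lambda>y. M * moved g t y) \<partial>lborel)"
  proof (rule Bochner_Integration.integral_cong[OF refl])
    fix t :: real
    show "(\<integral>x. ?F (t, x) \<partial>lborel) = indicator {0<..<\<tau>} t * slice (\<lambda>y. M * moved g t y)"
    proof (cases "t \<in> {0<..<\<tau>}")
      case True
      have "(\<integral>x. ?F (t, x) \<partial>lborel) = (\<integral>x. c t * indicator (ball x0 (R t)) x * g (t, x) \<partial>lborel)"
        using True by (simp add: u_def indicator_def)
      also have "\<dots> = (c t * R t ^ DIM('a)) * slice (moved g t)" by (rule slice_ball[OF True g])
      also have "c t * R t ^ DIM('a) = M" using True R_pos[of t] by (simp add: c_eq)
      finally show ?thesis using True by (simp add: slice_cmult)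
    qed (simp add: indicator_def)
  qed
  also have "\<dots> = II (\<lambda>t y. M * moved g t y)"
    unfolding moved_def by (rule II_fubini(2)[symmetric])
        (intro adm_mult adm_cont continuous_intros adm_moved g into_cball_ident)
  finally show ?thesis .
qed

lemma Cc_inf_subset_upto: "Cc_inf ({0<..<\<tau>} \<times> \<Omega>) \<subseteq> Cc_inf_upto \<tau> \<Omega>"
proof
  fix \<psi> :: "real \<times> 'a \<Rightarrow> real" assume \<psi>: "\<psi> \<in> Cc_inf ({0<..<\<tau>} \<times> \<Omega>)"
  then have "supp \<psi> \<subseteq> {0<..<\<tau>} \<times> closure \<Omega>" using closure_subset by (fastforce simp: Cc_inf_def)
  then show "\<psi> \<in> Cc_inf_upto \<tau> \<Omega>"
    using \<psi> by (auto simp: Cc_inf_def Cc_inf_upto_def zero_off_supp intro!: exI[of _ "supp \<psi>"])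
qed

text \<open>The constant choice \<open>a = M\<close> in \<open>transport\<close>, with
  \<open>B = 0\<close>, exchanges the time derivative of the test function for a radial one. Then
  \<open>gauss_slice\<close> splits the latter into sphere minus ball, with weight
  \<open>N M R' / R = \<kappa>\<close>.\<close>

lemma is_time_derivative_\<mu>: "is_time_derivative \<tau> \<Omega> u \<mu>Q"
  unfolding is_time_derivative_def
proof
  fix \<psi> assume "\<psi> \<in> Cc_inf ({0<..<\<tau>} \<times> \<Omega>)"
  then have \<psi>: "\<psi> \<in> Cc_inf_upto \<tau> \<Omega>" using Cc_inf_subset_upto by blast
  then have sm: "smooth \<psi>" by (simp add: Cc_inf_upto_def)
  have adm_b: "adm (\<lambda>t y. M * (R' t / R t))"
    using R_pos by (intro adm_cont continuous_intros R'_cont R_cont) (auto simp: less_imp_neq[symmetric])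
  have "II (\<lambda>t y. M * moved (\<lambda>p. fst (grad \<psi> p)) t y) +
      II (\<lambda>t y. (M * (R' t / R t)) * moved (radial \<psi>) t y)
      = II (\<lambda>t y. 0 * moved \<psi> t (sgn y))"
  proof (rule transport[OF \<psi>, of "\<lambda>_. M" "\<lambda>_. 0"])
    show "adm (\<lambda>t y. M * (R' t / R t))" by (rule adm_b)
    show "adm (\<lambda>t y. M)" "adm (\<lambda>t y. 0)" by (intro adm_cont continuous_intros)+
  qed auto
  also have "\<dots> = 0" by (simp add: II_def slice_def)
  finally have 1: "- II (\<lambda>t y. M * moved (\<lambda>p. fst (grad \<psi> p)) t y) =
      II (\<lambda>t y. (M * (R' t / R t)) * moved (radial \<psi>) t y)" by simp
  have adm_nk: "adm (\<lambda>t y. - (\<kappa> t * moved \<psi> t y))"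
  proof -
    have "adm (\<lambda>t y. (- 1) * (\<kappa> t * moved \<psi> t y))"
      by (intro adm_mult adm_cont[of "\<lambda>_. - 1"] adm_\<kappa> adm_test sm continuous_intros)
    then show ?thesis by simp
  qed
  note z = adm_\<zeta>[OF smooth_continuous[OF sm]]
  have "II (\<lambda>t y. (M * (R' t / R t)) * moved (radial \<psi>) t y) + II (\<lambda>t y. \<kappa> t * moved \<psi> t y) =
     II (\<lambda>t y. (M * (R' t / R t)) * moved (radial \<psi>) t y + \<kappa> t * moved \<psi> t y)"
    by (rule II_add[symmetric]) (intro adm_mult adm_b adm_test sm adm_\<kappa>)+
  also have "\<dots> = II (\<lambda>t y. \<kappa> t * moved \<psi> t (sgn y))"
  proof (rule II_cong)
    fix t assume t: "t \<in> {0<..<\<tau>}"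
    then have t': "t \<in> {0..\<tau>}" by simp
    have "slice (\<lambda>y. (M * (R' t / R t)) * moved (radial \<psi>) t y + \<kappa> t * moved \<psi> t y)
      = (M * (R' t / R t)) * slice (moved (radial \<psi>) t) + \<kappa> t * slice (moved \<psi> t)"
      by (subst slice_add[OF _ _ t]) (intro adm_mult adm_b adm_test sm adm_\<kappa> | simp only: slice_cmult)+
    also have "slice (moved (radial \<psi>) t) =
        real DIM('a) * (slice (\<lambda>y. moved \<psi> t (sgn y)) - slice (moved \<psi> t))"
      using gauss_slice[OF sm t] by (simp only: right_diff_distrib)
    also have "\<kappa> t = M * (R' t / R t) * real DIM('a)"
      using R_pos[OF t'] by (simp add: \<kappa>_def coef_eq[OF t'] c_eq[OF t'])
    finally show "slice (\<lambda>y. (M * (R' t / R t)) * moved (radial \<psi>) t y + \<kappa> t * moved \<psi> t y) =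
        slice (\<lambda>y. \<kappa> t * moved \<psi> t (sgn y))"
      unfolding slice_cmult using R_pos[OF t']
      by (simp add: \<kappa>_def coef_eq[OF t'] c_eq[OF t'] algebra_simps)
  qed
  finally have 2: "II (\<lambda>t y. (M * (R' t / R t)) * moved (radial \<psi>) t y) =
     II (\<lambda>t y. \<kappa> t * moved \<psi> t (sgn y)) - II (\<lambda>t y. \<kappa> t * moved \<psi> t y)" by simp
  have "(\<integral>p. u (fst p) (snd p) * partial_deriv (1, 0) \<psi> p \<partial>lebesgue_on ({0<..<\<tau>} \<times> \<Omega>)) =
      II (\<lambda>t y. M * moved (\<lambda>p. fst (grad \<psi> p)) t y)"
    unfolding test_function_grad(1)[OF sm] by (rule integral_u_Q[OF test_function_cont(2)[OF sm]])
  then show "sm_int \<mu>Q \<psi> = -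
      (\<integral>p. u (fst p) (snd p) * partial_deriv (1, 0) \<psi> p \<partial>lebesgue_on ({0<..<\<tau>} \<times> \<Omega>))"
    unfolding sm_int_\<mu>Q[OF smooth_continuous[OF sm]] using 1 2 by simp
qed


text \<open>Pulled back to the unit ball, the two terms on the right combine by
  \<open>transport\<close>, with \<open>a = J R^N\<close>, into one surface term of density
  \<open>B\<close>. The left side is a surface term of density \<open>\<Phi> S\<close>, so for
  nonnegative test functions it suffices that \<open>\<Phi> S \<le> B\<close> at each time.\<close>

lemma entropy_ineq_u: "entropy_ineq m \<Omega> \<tau> (Cc_inf_upto \<tau> \<Omega>) u (flux m u w)"
  unfolding entropy_ineq_def
proof
  let ?N = "real DIM('a)"
  fix l assume l: "l \<in> Lfun"
  define \<Phi> where "\<Phi> t = Phi_fun m l (c t)" for t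
  define S where "S t = ?N * R t ^ (DIM('a) - 1)" for t
  define J where "J t = J_fun l (c t)" for t
  \<comment> \<open>This is minus the time derivative of \<open>J R^N\<close>: as
    \<open>c' = - N c R' / R\<close>, the factor \<open>J\<close> contributes
    \<open>- N c R' / R\<close> times \<open>l(c)\<close>, and the factor \<open>R^N\<close>
    contributes \<open>N R' / R\<close> times \<open>J\<close>.\<close>
  define B where "B t = ?N * R t ^ DIM('a) * (R' t / R t) * (l (c t) * c t - J t)" for t
  let ?\<eta> = "\<lambda>t. push \<Omega> x0 (R t) (\<lambda>_. \<Phi> t * S t) sgn"
  have \<Phi>0: "0 \<le> \<Phi> t" if "t \<in> {0..\<tau>}" for t
    unfolding \<Phi>_def by (rule Phi_nonneg[OF l m]) (use c_pos[OF that] in simp)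
  have S0: "0 \<le> S t" if "t \<in> {0..\<tau>}" for t using R_pos[OF that] by (simp add: S_def)
  have J_cont: "continuous_on {0..\<tau>} J"
  proof -
    have "isCont (J_fun l) s" if "s \<in> {0<..}" for s using DERIV_isCont[OF J_deriv[OF l]] that by simp
    then have "continuous_on {0<..} (J_fun l)" by (intro continuous_at_imp_continuous_on ballI)
    then show ?thesis unfolding J_def[abs_def]
      by (rule continuous_on_compose2[OF _ c_cont]) (use c_pos in auto)
  qed
  have adm_J: "adm (\<lambda>t y. J t * R t ^ DIM('a))" by (intro adm_cont continuous_intros J_cont R_cont)
  have adm_B: "adm (\<lambda>t y. B t)"
    unfolding B_def using R_pos
    by (intro adm_cont continuous_intros J_cont R_cont R'_cont c_cont l_cont l)
        (auto simp: less_imp_neq[symmetric])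
  have adm_b: "adm (\<lambda>t y. l (c t) * coef t * R t ^ DIM('a))"
    by (intro adm_cont continuous_intros R_cont coef_cont l_cont l)
  \<comment> \<open>Monotonicity of \<open>Phi_fun\<close> gives both measurability in time and the
    bound by its value at the largest height.\<close>
  have adm_\<Phi>: "adm (\<lambda>t y. \<Phi> t * S t)"
  proof (rule adm_mult)
    obtain C where C: "\<And>t. t \<in> {0..\<tau>} \<Longrightarrow> c t \<le> C" using c_bound by blast
    show "adm (\<lambda>t y. \<Phi> t)"
    proof (rule adm_coeff[where C="Phi_fun m l C"])
      have [measurable]: "Phi_fun m l \<in> borel_measurable borel"
        by (rule borel_measurable_mono[OF Phi_mono[OF l m]])
      show "(\<lambda>t. indicator {0<..<\<tau>} t * \<Phi> t) \<in> borel_measurable borel" unfolding \<Phi>_def by measurable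
      fix t assume "t \<in> {0<..<\<tau>}"
      then have t: "t \<in> {0..\<tau>}" by simp
      have "\<Phi> t \<le> Phi_fun m l C" unfolding \<Phi>_def by (rule monoD[OF Phi_mono[OF l m] C[OF t]])
      then show "\<bar>\<Phi> t\<bar> \<le> Phi_fun m l C" using \<Phi>0[OF t] by simp
    qed
    show "adm (\<lambda>t y. S t)" unfolding S_def by (intro adm_cont continuous_intros R_cont)
  qed
  show "\<exists>\<eta>. (AE t in lebesgue_on {0<..<\<tau>}. is_abs_gradient \<Omega> (\<lambda>x. Phi_fun m l (u t x)) (\<eta> t)) \<and>
     (\<forall>\<psi>\<in>Cc_inf_upto \<tau> \<Omega>. (\<forall>t\<in>{0<..<\<tau>}. \<forall>x\<in>\<Omega>. 0 \<le> \<psi> (t, x)) \<longrightarrow>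
        integrable (lebesgue_on {0<..<\<tau>}) (\<lambda>t. \<integral>x. \<psi> (t, x) \<partial>(\<eta> t)) \<and>
        (\<integral>t. (\<integral>x. \<psi> (t, x) \<partial>(\<eta> t)) \<partial>(lebesgue_on {0<..<\<tau>}))
          \<le> (\<integral>t. (\<integral>x. J_fun l (u t x) * partial_deriv (1, 0) \<psi> (t, x)
                \<partial>(lebesgue_on \<Omega>)) \<partial>(lebesgue_on {0<..<\<tau>}))
           - (\<integral>t. (\<integral>x. l (u t x) * (flux m u w t x \<bullet> grad (\<lambda>y. \<psi> (t, y)) x)
                \<partial>(lebesgue_on \<Omega>)) \<partial>(lebesgue_on {0<..<\<tau>})))"
  proof (intro exI[of _ ?\<eta>] conjI ballI impI)
    have Phi_u: "Phi_fun m l (u t x) = 0 + \<Phi> t * indicator (ball x0 (R t)) x" for t x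
      using ind_compose[of "Phi_fun m l", OF Phi_zero] by (simp add: \<Phi>_def)
    show "AE t in lebesgue_on {0<..<\<tau>}. is_abs_gradient \<Omega> (\<lambda>x. Phi_fun m l (u t x)) (?\<eta> t)"
      unfolding Phi_u S_def by (intro AE_time ball_domain.is_abs_gradient_ind ball_domain bounded_domain
          \<Phi>0) auto
    fix \<psi> assume \<psi>: "\<psi> \<in> Cc_inf_upto \<tau> \<Omega>"
    then have sm: "smooth \<psi>" by (simp add: Cc_inf_upto_def)
    assume pos: "\<forall>t\<in>{0<..<\<tau>}. \<forall>x\<in>\<Omega>. 0 \<le> \<psi> (t, x)"
    have L: "(\<integral>x. \<psi> (t, x) \<partial>?\<eta> t) = slice (\<lambda>y. \<Phi> t * S t * moved \<psi> t (sgn y))"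
        if "t \<in> space (lebesgue_on {0<..<\<tau>})" for t
    proof -
      have t: "t \<in> {0<..<\<tau>}" using that by simp
      interpret bd: ball_domain \<Omega> x0 "R t" by (rule ball_domain[OF t])
      have "continuous_on UNIV (\<lambda>x. \<psi> (t, x))"
        by (intro continuous_on_compose2[OF smooth_continuous[OF sm]] continuous_intros) auto
      then have "(\<lambda>x. \<psi> (t, x)) \<in> borel_measurable (restrict_space borel \<Omega>)"
        by (intro measurable_restrict_space1 borel_measurable_continuous_onI)
      then show ?thesis using \<Phi>0[of t] S0[of t] t
        by (subst bd.integral_push) (auto simp: slice_def moved_def)
    qed
    have adm_L: "adm (\<lambda>t y. \<Phi> t * S t * moved \<psi> t (sgn y))" by (intro adm_mult[OF adm_\<Phi>] adm_test sm)
    have adm_BS: "adm (\<lambda>t y. B t * moved \<psi> t (sgn y))" by (intro adm_mult[OF adm_B] adm_test sm)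
    show "integrable (lebesgue_on {0<..<\<tau>}) (\<lambda>t. \<integral>x. \<psi> (t, x) \<partial>?\<eta> t)"
      using II_fubini(1)[OF adm_L] by (subst Bochner_Integration.integrable_cong[OF refl L]) auto
    have "(\<integral>t. (\<integral>x. \<psi> (t, x) \<partial>?\<eta> t) \<partial>(lebesgue_on {0<..<\<tau>})) = II (\<lambda>t y. \<Phi> t * S t * moved \<psi> t (sgn y))"
      unfolding II_def by (rule Bochner_Integration.integral_cong[OF refl L])
    also have "\<dots> \<le> II (\<lambda>t y. B t * moved \<psi> t (sgn y))"
    proof (rule II_mono[OF adm_L adm_BS])
      fix t and y :: 'a assume t: "t \<in> {0<..<\<tau>}" and y: "y \<in> ball 0 1"
      then have t': "t \<in> {0..\<tau>}" by simp
      interpret bd: ball_domain \<Omega> x0 "R t" by (rule ball_domain[OF t])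
      \<comment> \<open>The sphere lies in \<open>\<Omega>\<close>, so nonnegativity on
        \<open>\<Omega>\<close> reaches the surface values.\<close>
      have "0 \<le> moved \<psi> t (sgn y)"
        using pos t bd.into_domain[of "sgn y"] by (simp add: moved_def norm_sgn)
      moreover have "\<Phi> t * S t \<le> B t"
      proof -
        \<comment> \<open>Here \<open>Phi_le\<close> is used at the height \<open>c t\<close>, with
          \<open>c^(m-1) = R'\<close>; multiplication by the area factor \<open>S\<close> gives
          \<open>B\<close> exactly.\<close>
        have "\<Phi> t \<le> R' t * (c t * l (c t) - J t)"
          using Phi_le[OF l m c_pos[OF t']] by (simp add: \<Phi>_def J_def R'_def)
        then have "\<Phi> t * S t \<le> R' t * (c t * l (c t) - J t) * S t" using S0[OF t']
          by (rule mult_right_mono)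
        also have "\<dots> = B t"
        proof -
          have "R t ^ DIM('a) = R t * R t ^ (DIM('a) - 1)" by (simp add: power_eq_if)
          then show ?thesis using R_pos[OF t'] by (simp add: B_def S_def algebra_simps)
        qed
        finally show ?thesis .
      qed
      ultimately show "\<Phi> t * S t * moved \<psi> t (sgn y) \<le> B t * moved \<psi> t (sgn y)" by (intro mult_right_mono)
    qed
    also have "\<dots> = II (\<lambda>t y. (J t * R t ^ DIM('a)) * moved (\<lambda>p. fst (grad \<psi> p)) t y)
        + II (\<lambda>t y. (l (c t) * coef t * R t ^ DIM('a)) * moved (radial \<psi>) t y)"
    proof (rule transport[OF \<psi> _ adm_J adm_B adm_b, symmetric])
      fix t assume t: "t \<in> {0<..<\<tau>}"
      then have t': "t \<in> {0..\<tau>}" by simp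
      have Rt: "0 < R t" by (rule R_pos[OF t'])
      have RN: "R t ^ DIM('a) = R t * R t ^ (DIM('a) - Suc 0)" by (simp add: power_eq_if)
      have dJ: "(J has_real_derivative l (c t) * - (?N * c t * R' t / R t)) (at t)"
        unfolding J_def[abs_def] by (rule DERIV_chain2[OF J_deriv[OF l c_pos[OF t']] c_deriv[OF t]])
      have dR: "((\<lambda>t. R t ^ DIM('a)) has_real_derivative ?N * (R' t * R t ^ (DIM('a) - Suc 0))) (at t)"
        using R_deriv[OF t'] unfolding R'_def by (rule DERIV_power)
      show "((\<lambda>t. J t * R t ^ DIM('a)) has_real_derivative - B t) (at t)"
        by (rule DERIV_cong[OF DERIV_mult[OF dJ dR]]) (use Rt in \<open>simp add: B_def RN field_simps\<close>)
      \<comment> \<open>The \<open>J\<close> parts cancel; what is left is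
        \<open>l(c) c R' / R\<close> times \<open>R^N\<close>, the flux term.\<close>
      show "l (c t) * coef t * R t ^ DIM('a) = J t * R t ^ DIM('a) * (R' t / R t) + B t / ?N"
        using Rt by (simp add: B_def coef_eq[OF t'] field_simps)
    qed
    also have "II (\<lambda>t y. (J t * R t ^ DIM('a)) * moved (\<lambda>p. fst (grad \<psi> p)) t y) =
        (\<integral>t. (\<integral>x. J_fun l (u t x) * partial_deriv (1, 0) \<psi> (t, x) \<partial>(lebesgue_on \<Omega>))
            \<partial>(lebesgue_on {0<..<\<tau>}))"
      unfolding II_def
    proof (rule Bochner_Integration.integral_cong[OF refl])
      fix t assume "t \<in> space (lebesgue_on {0<..<\<tau>})"
      then have t: "t \<in> {0<..<\<tau>}" by simp
      have "J_fun l (u t x) = J t * indicator (ball x0 (R t)) x" for x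
        using ind_compose[of "J_fun l", OF J_zero] by (simp add: J_def)
      then show "slice (\<lambda>y. (J t * R t ^ DIM('a)) * moved (\<lambda>p. fst (grad \<psi> p)) t y) =
          (\<integral>x. J_fun l (u t x) * partial_deriv (1, 0) \<psi> (t, x) \<partial>(lebesgue_on \<Omega>))"
        using slice_ball(1)[OF t test_function_cont(2)[OF sm]]
        by (simp only: slice_cmult test_function_grad(1)[OF sm])
    qed
    also have "II (\<lambda>t y. (l (c t) * coef t * R t ^ DIM('a)) * moved (radial \<psi>) t y) =
        - (\<integral>t. (\<integral>x. l (u t x) * (flux m u w t x \<bullet> grad (\<lambda>y. \<psi> (t, y)) x) \<partial>(lebesgue_on \<Omega>))
            \<partial>(lebesgue_on {0<..<\<tau>}))"
      unfolding II_def
    proof (subst Bochner_Integration.integral_minus[symmetric], rule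
        Bochner_Integration.integral_cong[OF refl])
      fix t assume "t \<in> space (lebesgue_on {0<..<\<tau>})"
      then have t: "t \<in> {0<..<\<tau>}" by simp
      have "l (u t x) * (flux m u w t x \<bullet> grad (\<lambda>y. \<psi> (t, y)) x) =
        (- (l (c t) * coef t)) * indicator (ball x0 (R t)) x * radial \<psi> (t, x)" for x
        by (simp add: flux_eq test_function_grad(3)[OF sm] radial_def u_def indicator_def)
      then show "slice (\<lambda>y. (l (c t) * coef t * R t ^ DIM('a)) * moved (radial \<psi>) t y) =
          - (\<integral>x. l (u t x) * (flux m u w t x \<bullet> grad (\<lambda>y. \<psi> (t, y)) x) \<partial>(lebesgue_on \<Omega>))"
        using slice_ball(1)[OF t test_function_cont(3)[OF sm], of "- (l (c t) * coef t)"]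
        by (simp only: slice_cmult mult_minus_left minus_minus)
    qed
    finally show "(\<integral>t. (\<integral>x. \<psi> (t, x) \<partial>?\<eta> t) \<partial>(lebesgue_on {0<..<\<tau>}))
          \<le> (\<integral>t. (\<integral>x. J_fun l (u t x) * partial_deriv (1, 0) \<psi> (t, x)
                \<partial>(lebesgue_on \<Omega>)) \<partial>(lebesgue_on {0<..<\<tau>}))
           - (\<integral>t. (\<integral>x. l (u t x) * (flux m u w t x \<bullet> grad (\<lambda>y. \<psi> (t, y)) x)
                \<partial>(lebesgue_on \<Omega>)) \<partial>(lebesgue_on {0<..<\<tau>}))"
      by simp
  qed
qed

section \<open>The two boundary value problems\<close>

lemma entropy_sol_common_u:
  assumes "\<T> \<subseteq> Cc_inf_upto \<tau> \<Omega>"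
  shows "entropy_sol_common m \<Omega> \<tau> \<T> (u 0) u w"
  unfolding entropy_sol_common_def
proof (intro conjI ballI)
  show "AE x in lebesgue_on \<Omega>. 0 \<le> u t x" if "t \<in> {0..<\<tau>}" for t
    using that u_nonneg[of t] by (intro AE_I2) simp
  show "case_prod w \<in> borel_measurable (lebesgue_on ({0<..<\<tau>} \<times> \<Omega>))"
    by (rule borel_imp_lebesgue_on[OF w_measurable_pair])
  show "AE p in lebesgue_on ({0<..<\<tau>} \<times> \<Omega>). norm (w (fst p) (snd p)) \<le> 1"
    by (rule AE_Q) (simp add: norm_w_le)
  have "AE t in lebesgue_on {0<..<\<tau>}. has_divergence \<Omega> (flux m u w t) (\<mu>t t)"
    unfolding \<mu>t_def \<kappa>_def
    by (intro AE_time ball_domain.has_divergence_radial ball_domain flux_eq coef_nonneg) auto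
  then show "\<exists>\<mu> \<mu>t. is_time_derivative \<tau> \<Omega> u \<mu> \<and> in_Linf_loc_w \<tau> \<Omega> \<mu> \<mu>t \<and>
      (AE t in lebesgue_on {0<..<\<tau>}. has_divergence \<Omega> (flux m u w t) (\<mu>t t))"
    using is_time_derivative_\<mu> in_Linf_loc_w_\<mu> by blast
  show "entropy_ineq m \<Omega> \<tau> \<T> u (flux m u w)"
    using entropy_ineq_u assms unfolding entropy_ineq_def by (meson subsetD)
qed (use Linf_plus_u0 in_C_L1_u Linf_u in_L1_BV_u in \<open>auto simp: case_prod_unfold\<close>)

lemma normal_trace_flux: "t \<in> {0<..<\<tau>} \<Longrightarrow> normal_trace \<Omega> (flux m u w t) (\<lambda>_. 0)"
  by (rule ball_domain.normal_trace_radial[OF ball_domain flux_eq coef_nonneg]) auto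

theorem entropy_solutions: "entropy_solution_D m \<Omega> \<tau> (u 0) (\<lambda>_. 0) u" "entropy_solution_N m \<Omega> \<tau> (u 0) u"
proof -
  show "entropy_solution_D m \<Omega> \<tau> (u 0) (\<lambda>_. 0) u"
    unfolding entropy_solution_D_def
  proof (intro conjI exI[of _ w] entropy_sol_common_u Cc_inf_subset_upto)
    show "Linf_plus (surface \<Omega>) (\<lambda>_. 0)" by (auto simp: Linf_plus_def Linf_def intro!: exI[of _ 0])
    show "AE t in lebesgue_on {0<..<\<tau>}. \<exists>\<theta> \<kappa>.
          TBV_trace \<Omega> (u t) \<theta> \<and> normal_trace \<Omega> (flux m u w t) \<kappa> \<and>
          (AE x in surface \<Omega>. 0 \<le> \<theta> x) \<and>
          (AE x in surface \<Omega>. 0 < \<theta> x \<longrightarrow> \<kappa> x = - phi m (\<theta> x))"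
    proof (rule AE_time)
      fix t assume t: "t \<in> {0<..<\<tau>}"
      have "TBV_trace \<Omega> (u t) (\<lambda>_. 0)"
        using c_pos[of t] t by (intro ball_domain.TBV_trace_ind[OF ball_domain[OF t] bounded_domain, of
            "c t"]) (auto simp: u_def)
      \<comment> \<open>With trace 0 and datum 0 no boundary point has \<open>u > g\<close>, so the
        flux condition is vacuous.\<close>
      then show "\<exists>\<theta> \<kappa>. TBV_trace \<Omega> (u t) \<theta> \<and> normal_trace \<Omega> (flux m u w t) \<kappa> \<and>
          (AE x in surface \<Omega>. 0 \<le> \<theta> x) \<and> (AE x in surface \<Omega>. 0 < \<theta> x \<longrightarrow> \<kappa> x = - phi m (\<theta> x))"
        using normal_trace_flux[OF t] by (intro exI[of _ "\<lambda>_. 0"]) auto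
    qed
  qed
  have "AE t in lebesgue_on {0<..<\<tau>}. \<exists>\<kappa>. normal_trace \<Omega> (flux m u w t) \<kappa> \<and> (AE x in surface \<Omega>. \<kappa> x = 0)"
    by (rule AE_time) (use normal_trace_flux in fastforce)
  then show "entropy_solution_N m \<Omega> \<tau> (u 0) u"
    unfolding entropy_solution_N_def using entropy_sol_common_u by blast
qed

end

section \<open>The source-type solution\<close>

theorem theorem5p1:
  fixes \<Omega> :: "'a::euclidean_space set" and x0 :: 'a
    and m \<alpha> X t0 T \<tau> :: real
    and r :: "real \<Rightarrow> real" and B :: "real \<Rightarrow> 'a set"
    and us :: "real \<Rightarrow> 'a \<Rightarrow> real"
  assumes "1 < m"
    and "open \<Omega>" and "bounded \<Omega>" and "lipschitz_boundary \<Omega>"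
    and \<alpha>: "\<alpha> = 1 / (real DIM('a) * (m - 1) + 1)"
    and "x0 \<in> \<Omega>" and "0 < X" and "0 < t0" and "0 < T"
    and "ball x0 (inverse X * (inverse \<alpha> * t0 * T) powr \<alpha>) \<subseteq> \<Omega>"
    and r: "\<And>t. r t = (inverse \<alpha> * (t0 + t)) powr \<alpha>"
    and B: "\<And>t. B t = ball x0 (inverse X * T powr \<alpha> * r t)"
    \<comment> \<open>supremum of a subset of \<open>[0,\<infinity>)\<close>, so that it is \<open>0\<close> if no such \<open>t\<close> exists\<close>
    and \<tau>: "\<tau> = Sup (insert 0 {t. 0 < t \<and> compact (closure (B t)) \<and> closure (B t) \<subseteq> \<Omega>})"
    and us: "\<And>t x. us t x =
        T powr (1 / (m - 1) - \<alpha> * real DIM('a)) * X powr (- 1 / (m - 1))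
          * r t powr (- real DIM('a)) * indicat_real (B t) x"
  shows "entropy_solution_D m \<Omega> \<tau> (us 0) (\<lambda>_. 0) us \<and>
         entropy_solution_N m \<Omega> \<tau> (us 0) us"
proof -
  let ?N = "real DIM('a)"
  define q where "q = inverse X * T powr \<alpha>"
  define K where "K = T powr (1 / (m - 1) - \<alpha> * ?N) * X powr (- 1 / (m - 1))"
  define R where "R t = q * r t" for t
  define c where "c t = K * r t powr (- ?N)" for t
  note pos = \<open>0 < X\<close> \<open>0 < t0\<close> \<open>0 < T\<close> \<open>1 < m\<close>
  have \<alpha>_pos: "0 < \<alpha>" using pos by (simp add: \<alpha> add_nonneg_pos)
  \<comment> \<open>The equation that fixes \<open>\<alpha>\<close>: it matches the powers of
    \<open>inverse \<alpha> * (t0 + t)\<close> on the two sides of the speed law.\<close>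
  have \<alpha>_eq: "\<alpha> * ?N * (m - 1) = 1 - \<alpha>"
  proof -
    have "?N * (m - 1) + 1 > 0" using pos by (intro add_nonneg_pos mult_nonneg_nonneg) auto
    then show ?thesis by (simp add: \<alpha> field_simps)
  qed
  have q: "0 < q" using pos by (simp add: q_def)
  have K: "0 < K" using pos by (simp add: K_def)
  have B_eq: "B t = ball x0 (R t)" for t by (simp add: B R_def q_def)
  have base: "0 < inverse \<alpha> * (t0 + t)" if "0 \<le> t" for t using \<alpha>_pos pos that by simp
  have r_pos: "0 < r t" if "0 \<le> t" for t using base[OF that] unfolding r powr_gt_zero
    by (rule less_imp_neq[symmetric])
  have R_pos: "0 < R t" if "0 \<le> t" for t using r_pos[OF that] q by (simp add: R_def)
  have R_mono: "R s \<le> R t" if "0 \<le> s" "s \<le> t" for s t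
  proof -
    have "inverse \<alpha> * (t0 + s) \<le> inverse \<alpha> * (t0 + t)" using that \<alpha>_pos by (intro mult_left_mono) auto
    then have "r s \<le> r t" using base[OF that(1)] \<alpha>_pos unfolding r by (intro powr_mono2) auto
    then show ?thesis using q by (simp add: R_def)
  qed
  have closure_B: "closure (B t) = cball x0 (R t)" if "0 \<le> t" for t
    using R_pos[OF that] by (simp add: B_eq)
  let ?S = "insert 0 {t. 0 < t \<and> compact (closure (B t)) \<and> closure (B t) \<subseteq> \<Omega>}"
  obtain b where b: "0 < b" "\<Omega> \<subseteq> ball x0 b" using bounded_subset_ballD[OF \<open>bounded \<Omega>\<close>] by blast
  \<comment> \<open>A ball inside the bounded \<open>\<Omega>\<close> has radius below
    \<open>b\<close>; solving \<open>R t < b\<close> for \<open>t\<close> gives the bound.\<close>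
  have bdd: "bdd_above ?S"
  proof (rule bdd_aboveI)
    fix t assume "t \<in> ?S"
    then consider "t = 0" | "0 < t" "cball x0 (R t) \<subseteq> ball x0 b" using closure_B[of t] b(2) by auto
    then show "t \<le> \<alpha> * (b / q) powr (1 / \<alpha>)"
    proof cases
      case 1 then show ?thesis using \<alpha>_pos by simp
    next
      case 2
      have "R t < b" using 2 R_pos[of t] by (simp add: cball_subset_ball_iff)
      then have "r t < b / q" using q by (simp add: R_def field_simps)
      then have "r t powr (1 / \<alpha>) \<le> (b / q) powr (1 / \<alpha>)" using r_pos[of t] 2 \<alpha>_pos
        by (intro powr_mono2) auto
      moreover have "r t powr (1 / \<alpha>) = inverse \<alpha> * (t0 + t)"
        using base[of t] 2 \<alpha>_pos by (simp add: r powr_powr)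
      ultimately have "t0 + t \<le> \<alpha> * (b / q) powr (1 / \<alpha>)" using \<alpha>_pos by (simp add: field_simps)
      then show ?thesis using pos by simp
    qed
  qed
  \<comment> \<open>The inserted 0 makes the supremum nonnegative; if there is no admissible
    positive time, the open time interval is empty.\<close>
  have \<tau>0: "0 \<le> \<tau>" unfolding \<tau> by (intro cSup_upper bdd) simp
  \<comment> \<open>The conserved product \<open>c R^N\<close> is \<open>K q^N\<close>, since
    \<open>c = K r^(-N)\<close> and \<open>R = q r\<close>.\<close>
  interpret moving_ball \<Omega> x0 m \<tau> "K * q ^ DIM('a)" R c
  proof
    show "open \<Omega>" "bounded \<Omega>" "1 < m" "0 \<le> \<tau>" by fact+
    show "0 < K * q ^ DIM('a)" using K q by simp
    show "R \<in> borel_measurable borel" unfolding R_def[abs_def] r by measurable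
    show "c \<in> borel_measurable borel" unfolding c_def[abs_def] r by measurable
    fix t assume "t \<in> {0..\<tau>}"
    then have t: "0 \<le> t" by simp
    show "0 < R t" by (rule R_pos[OF t])
    have rN: "r t powr (- ?N) = 1 / r t ^ DIM('a)"
      using r_pos[OF t] by (simp add: powr_minus_divide powr_realpow)
    show "c t = K * q ^ DIM('a) / R t ^ DIM('a)"
      using q by (simp add: c_def R_def rN power_mult_distrib)
    have "(r has_real_derivative (inverse \<alpha> * (t0 + t)) powr (\<alpha> - 1)) (at t)"
    proof -
      have "((\<lambda>t. (inverse \<alpha> * (t0 + t)) powr \<alpha>) has_real_derivative \<alpha> * (inverse \<alpha> * (t0 + t)) powr
          (\<alpha> - 1) * inverse \<alpha>) (at t)"
      proof (rule DERIV_chain2[where f="\<lambda>x. x powr \<alpha>" and g="\<lambda>t. inverse \<alpha> * (t0 + t)"])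
        show "((\<lambda>x. x powr \<alpha>) has_real_derivative \<alpha> * (inverse \<alpha> * (t0 + t)) powr (\<alpha> - 1))
            (at (inverse \<alpha> * (t0 + t)))"
          by (rule has_real_derivative_powr[OF base[OF t]])
      qed (auto intro!: derivative_eq_intros)
      moreover have "r = (\<lambda>t. (inverse \<alpha> * (t0 + t)) powr \<alpha>)" using r by blast
      moreover have "\<alpha> * (inverse \<alpha> * (t0 + t)) powr (\<alpha> - 1) * inverse \<alpha> =
          (inverse \<alpha> * (t0 + t)) powr (\<alpha> - 1)"
        using \<alpha>_pos by simp
      ultimately show ?thesis by (simp only:)
    qed
    then have "(R has_real_derivative q * (inverse \<alpha> * (t0 + t)) powr (\<alpha> - 1)) (at t)"
      unfolding R_def[abs_def] by (rule DERIV_cmult)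
    \<comment> \<open>The powers of \<open>T\<close> and \<open>X\<close> in \<open>K\<close> are
      such that \<open>K^(m-1) = q\<close>, and the powers of time agree by
      \<open>\<alpha>_eq\<close>.\<close>
    moreover have "c t powr (m - 1) = q * (inverse \<alpha> * (t0 + t)) powr (\<alpha> - 1)"
    proof -
      have e1: "(1 / (m - 1) - \<alpha> * ?N) * (m - 1) = \<alpha>"
        using \<alpha>_eq pos by (simp add: left_diff_distrib)
      have e2: "(- 1 / (m - 1)) * (m - 1) = - 1" using pos by simp
      have e3: "\<alpha> * - ?N * (m - 1) = \<alpha> - 1" using \<alpha>_eq by (simp add: algebra_simps)
      have "K powr (m - 1) = T powr ((1 / (m - 1) - \<alpha> * ?N) * (m - 1)) * X powr
          ((- 1 / (m - 1)) * (m - 1))"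
        using pos by (simp only: K_def powr_mult powr_powr)
      also have "\<dots> = q" using pos unfolding e1 e2 by (simp add: q_def powr_minus)
      finally have Kq: "K powr (m - 1) = q" .
      have "(r t powr (- ?N)) powr (m - 1) = (inverse \<alpha> * (t0 + t)) powr (\<alpha> * - ?N * (m - 1))"
        by (simp only: r powr_powr)
      then show ?thesis unfolding c_def e3 using K Kq by (simp add: powr_mult)
    qed
    ultimately show "(R has_real_derivative c t powr (m - 1)) (at t)" by simp
  next
    fix t assume t: "t \<in> {0<..<\<tau>}"
    then have "t < Sup ?S" by (simp add: \<tau>)
    \<comment> \<open>Some admissible \<open>s\<close> lies beyond \<open>t\<close> because
      \<open>t\<close> is below the supremum; the balls grow with time, so the one at
      \<open>t\<close> is contained in the one at \<open>s\<close>.\<close>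
    then obtain s where s: "s \<in> ?S" "t < s" using less_cSup_iff[OF _ bdd] by auto
    then have "cball x0 (R s) \<subseteq> \<Omega>" using t closure_B[of s] by auto
    moreover have "cball x0 (R t) \<subseteq> cball x0 (R s)" using t s R_mono[of t s] by (intro subset_cball) auto
    ultimately show "cball x0 (R t) \<subseteq> \<Omega>" by blast
  qed
  have "us = u" by (intro ext) (simp add: us u_def c_def K_def B_eq)
  then show ?thesis using entropy_solutions by simp
qed

end
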